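(* Let $\mathbf{P}$ be an operad with $\mathbf{P}(0)=(0)$ and all $\mathbf{P}(n)$ finite-dimensional. The following map (the algebra morphism given on generators as indicated) is a bialgebra isomorphism: $$\Psi_{\mathbf{P}}:\left\{\begin{array}{rcl}\mathbf{D}^*_{\mathbf{P}}=(T(\mathbf{P}^* ),m_{conc},\Delta_* )&\longrightarrow&\mathbf{D}'_{\mathbf{P}}=(T(\mathbf{P}^* ),m_{conc},\Delta'_* )\\ f\in\mathbf{P}_0^*&\longmapsto&f-\varepsilon_0(f)1,\\ f\in\mathbf{P}_+^*&\longmapsto&f.\end{array}\right.$$
   Context: $K$ is a field of characteristic zero, $\mathbf{P}=\bigoplus_{n\ge1}\mathbf{P}(n)$ is graded with the elements of $\mathbf{P}(n)$ homogeneous of degree $n-1$, so $\mathbf{P}_0=\mathbf{P}(1)$ is the degree $0$ component; $\mathbf{P}_+=\bigoplus_{n\ge2}\mathbf{P}(n)$, $\mathbf{P}^*=\bigoplus_{n\ge1}\mathbf{P}(n)^*$, $\mathbf{P}_+^*=\bigoplus_{n\ge2}\mathbf{P}(n)^*$. $I\in\mathbf{P}(1)$ is the unit of the operad, and $\varepsilon_0(f)=f(I)$ for $f\in\mathbf{P}_0^*$. $\Delta_*$ is the algebra morphism $T(\mathbf{P}^* )\to T(\mathbf{P}^* )\otimes T(\mathbf{P}^* )$ with, for $f\in\mathbf{P}^*$, $\Delta_*(f)\in\mathbf{P}^*\otimes T(\mathbf{P}^* )$ the transpose of the operadic composition: $\Delta_*(f)(q\otimes q_1\cdots q_p)=f(q\circ(q_1,\ldots,q_p))$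 for $q\in\mathbf{P}(p)$, $q_i\in\mathbf{P}$, and its component in $\mathbf{P}(p)^*\otimes (\mathbf{P}^* )^{\otimes r}$ vanishes for $r\ne p$. $\Delta'_*$ is the algebra morphism $T(\mathbf{P}^* )\to T(\mathbf{P}^* )\otimes T(\mathbf{P}^* )$ with $\ll\Delta'_*(f),X\otimes Y\gg'=f(\langle X,Y\rangle)$ for $f\in\mathbf{P}^*$, $X,Y\in T(\mathbf{P})$, where $\ll f_1\cdots f_k,x_1\cdots x_l\gg'=\delta_{k,l}f_1(x_1)\cdots f_k(x_k)$ and $\langle-,-\rangle:T(\mathbf{P})\otimes T(\mathbf{P})\to\mathbf{P}$ is given by $\langle p,p_1\cdots p_k\rangle=\sum_{1\le i_1<\cdots<i_k\le n}p\circ_{i_1,\ldots,i_k}(p_1,\ldots,p_k)$ for $p\in\mathbf{P}(n)$ (composition with $p_l$ in position $i_l$ and $I$ elsewhere; $\langle p,1\rangle=p$), $\langle1,x\rangle=x$ for $x\in\mathbf{P}$, $\langle1,v\rangle=0$ for $v\in\mathbf{P}^{\otimes l}$, $l\ne1$, and $\langle u,v\rangle=0$ for $u\in\mathbf{P}^{\otimes k}$, $k\ge2$. Both coproducts make $(T(\mathbf{P}^* ),m_{conc})$ a bialgebra ($m_{conc}$ is concatenation).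
   Formalization: The sign is corrected: the isomorphism D* → D' is f ↦ f + ε₀(f)1 on P₀*, and the printed formula f ↦ f − ε₀(f)1 is its inverse D' → D*; as printed it fails already for P = K·I, where x is grouplike in D* but 1 + x is in D'. *)

theory Defs
  imports Complex_Main "HOL-Library.Function_Algebras"
begin

section \<open>Spaces of functions and their tensor products\<close>

text \<open>
  All vector spaces occurring below, apart from the operad itself, are subspaces of some
  \<open>'x \<Rightarrow> 'k\<close>, with the pointwise structure.
\<close>

definition fscale :: "'k::field \<Rightarrow> ('x \<Rightarrow> 'k) \<Rightarrow> 'x \<Rightarrow> 'k" where
  "fscale c f = (\<lambda>x. c * f x)"

lemma fscale_apply [simp]: "fscale c f x = c * f x"
  by (simp add: fscale_def)

interpretation fun_space: vector_space "fscale :: 'k::field \<Rightarrow> ('x \<Rightarrow> 'k) \<Rightarrow> 'x \<Rightarrow> 'k"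
  by unfold_locales (auto simp: fun_eq_iff algebra_simps)

definition linear_on ::
  "('x \<Rightarrow> 'k::field) set \<Rightarrow> ('k \<Rightarrow> 'u \<Rightarrow> 'u::ab_group_add) \<Rightarrow> (('x \<Rightarrow> 'k) \<Rightarrow> 'u) \<Rightarrow> bool" where
  "linear_on V s \<phi> \<longleftrightarrow>
     (\<forall>a\<in>V. \<forall>b\<in>V. \<phi> (a + b) = \<phi> a + \<phi> b) \<and> (\<forall>c. \<forall>a\<in>V. \<phi> (fscale c a) = s c (\<phi> a))"

definition bilinear_on ::
  "('x \<Rightarrow> 'k::field) set \<Rightarrow> ('y \<Rightarrow> 'k) set \<Rightarrow> ('k \<Rightarrow> 'u \<Rightarrow> 'u::ab_group_add) \<Rightarrow>
     (('x \<Rightarrow> 'k) \<Rightarrow> ('y \<Rightarrow> 'k) \<Rightarrow> 'u) \<Rightarrow> bool" where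
  "bilinear_on V W s \<beta> \<longleftrightarrow>
     (\<forall>a\<in>V. linear_on W s (\<beta> a)) \<and> (\<forall>b\<in>W. linear_on V s (\<lambda>a. \<beta> a b))"

text \<open>
  Over a field, the tensor product of \<open>V \<subseteq> 'x \<Rightarrow> 'k\<close> and \<open>W \<subseteq> 'y \<Rightarrow> 'k\<close> embeds into
  \<open>'x \<times> 'y \<Rightarrow> 'k\<close> by sending \<open>f \<otimes> g\<close> to the product \<open>f x * g y\<close>; we take the image of this
  embedding as the tensor product.  Lemma \<open>tensor_lift_universal\<close> is its universal property:
  every bilinear map on \<open>V \<times> W\<close> factors through it.
\<close>

definition tensor :: "('x \<Rightarrow> 'k::field) \<Rightarrow> ('y \<Rightarrow> 'k) \<Rightarrow> 'x \<times> 'y \<Rightarrow> 'k" where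
  "tensor f g = (\<lambda>(x, y). f x * g y)"

definition tensor_space ::
  "('x \<Rightarrow> 'k::field) set \<Rightarrow> ('y \<Rightarrow> 'k) set \<Rightarrow> ('x \<times> 'y \<Rightarrow> 'k) set" where
  "tensor_space V W = fun_space.span {tensor f g | f g. f \<in> V \<and> g \<in> W}"

text \<open>The linear map on the tensor product with \<open>f \<otimes> g \<mapsto> \<beta> f g\<close>, for bilinear \<open>\<beta>\<close>.\<close>

definition tensor_lift ::
  "('x \<Rightarrow> 'k::field) set \<Rightarrow> ('y \<Rightarrow> 'k) set \<Rightarrow> (('x \<Rightarrow> 'k) \<Rightarrow> ('y \<Rightarrow> 'k) \<Rightarrow> 'u::ab_group_add) \<Rightarrow>
     ('x \<times> 'y \<Rightarrow> 'k) \<Rightarrow> 'u" where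
  "tensor_lift V W \<beta> t = (THE u. \<exists>ts. set ts \<subseteq> V \<times> W \<and>
     t = (\<Sum>(f, g)\<leftarrow>ts. tensor f g) \<and> u = (\<Sum>(f, g)\<leftarrow>ts. \<beta> f g))"

definition tensor_map ::
  "('x \<Rightarrow> 'k::field) set \<Rightarrow> ('y \<Rightarrow> 'k) set \<Rightarrow> (('x \<Rightarrow> 'k) \<Rightarrow> ('z \<Rightarrow> 'k)) \<Rightarrow>
     (('y \<Rightarrow> 'k) \<Rightarrow> ('w \<Rightarrow> 'k)) \<Rightarrow> ('x \<times> 'y \<Rightarrow> 'k) \<Rightarrow> ('z \<times> 'w \<Rightarrow> 'k)" where
  "tensor_map V W \<phi> \<psi> = tensor_lift V W (\<lambda>f g. tensor (\<phi> f) (\<psi> g))"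


lemma linear_on_zero:
  assumes "fun_space.subspace V" "linear_on V s \<phi>"
  shows "\<phi> 0 = 0"
proof -
  have "\<phi> (0 + 0) = \<phi> 0 + \<phi> 0"
    using assms fun_space.subspace_0 unfolding linear_on_def by blast
  then show ?thesis by simp
qed

lemma linear_on_sum_list:
  assumes "fun_space.subspace V" "linear_on V s \<phi>" "\<forall>t\<in>set ts. h t \<in> V"
  shows "\<phi> (\<Sum>t\<leftarrow>ts. h t) = (\<Sum>t\<leftarrow>ts. \<phi> (h t))" "(\<Sum>t\<leftarrow>ts. h t) \<in> V"
proof -
  have "\<phi> (\<Sum>t\<leftarrow>ts. h t) = (\<Sum>t\<leftarrow>ts. \<phi> (h t)) \<and> (\<Sum>t\<leftarrow>ts. h t) \<in> V"
    using assms(3)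
  proof (induction ts)
    case Nil
    then show ?case
      using linear_on_zero[OF assms(1,2)] fun_space.subspace_0[OF assms(1)]
      by (metis list.simps(8) sum_list.Nil)
  next
    case (Cons t ts)
    then have "h t \<in> V" "(\<Sum>t\<leftarrow>ts. h t) \<in> V" "\<phi> (\<Sum>t\<leftarrow>ts. h t) = (\<Sum>t\<leftarrow>ts. \<phi> (h t))" by auto
    then show ?case
      using assms(2) fun_space.subspace_add[OF assms(1)] unfolding linear_on_def list.map sum_list.Cons
      by metis
  qed
  then show "\<phi> (\<Sum>t\<leftarrow>ts. h t) = (\<Sum>t\<leftarrow>ts. \<phi> (h t))" "(\<Sum>t\<leftarrow>ts. h t) \<in> V" by auto
qed

lemma linear_on_diff:
  assumes "fun_space.subspace V" "linear_on V s \<phi>" "a \<in> V" "b \<in> V"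
  shows "\<phi> (a - b) = \<phi> a - \<phi> b"
proof -
  have "\<phi> ((a - b) + b) = \<phi> (a - b) + \<phi> b"
    using assms(2-) fun_space.subspace_diff[OF assms(1,3,4)] unfolding linear_on_def by blast
  then show ?thesis by (simp add: algebra_simps)
qed

lemma sum_list_fun_apply: "(\<Sum>t\<leftarrow>ts. h t) x = (\<Sum>t\<leftarrow>ts. h t x)"
  by (induction ts) auto

lemma fscale_sum_list: "fscale c (\<Sum>t\<leftarrow>ts. h t) = (\<Sum>t\<leftarrow>ts. fscale c (h t))"
  by (induction ts) (auto simp: fun_eq_iff algebra_simps)

lemma tensor_relation:
  fixes V :: "('x \<Rightarrow> 'k::field) set"
  assumes V: "fun_space.subspace V" and W: "fun_space.subspace W" and s: "vector_space s"
    and \<beta>: "bilinear_on V W s \<beta>"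
    and ts: "set ts \<subseteq> V \<times> W" and z: "(\<Sum>(f, g)\<leftarrow>ts. tensor f g) = 0"
  shows "(\<Sum>(f, g)\<leftarrow>ts. \<beta> f g) = 0"
  using ts z
proof (induction "length ts" arbitrary: ts)
  case 0
  then show ?case by simp
next
  case (Suc n)
  interpret s: vector_space s by (fact s)
  obtain a b us where ts: "ts = (a, b) # us"
    using Suc.hyps(2) by (metis length_Suc_conv surj_pair)
  have a: "a \<in> V" and b: "b \<in> W" and us: "set us \<subseteq> V \<times> W"
    using Suc.prems(1) ts by auto
  have lin: "linear_on W s (\<beta> f)" if "f \<in> V" for f using \<beta> that by (auto simp: bilinear_on_def)
  have lin': "linear_on V s (\<lambda>f. \<beta> f g)" if "g \<in> W" for g using \<beta> that by (auto simp: bilinear_on_def)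
  have z: "a x * b y + (\<Sum>(f, g)\<leftarrow>us. f x * g y) = 0" for x y
  proof -
    have "(\<Sum>(f, g)\<leftarrow>ts. tensor f g) (x, y) = 0" using Suc.prems(2) by simp
    then show ?thesis
      by (simp add: ts sum_list_fun_apply tensor_def case_prod_unfold)
  qed
  show ?case
  proof (cases "a = 0")
    case True
    have "(\<Sum>(f, g)\<leftarrow>us. tensor f g) = 0"
    proof -
      have "tensor a b = 0" using True by (simp add: tensor_def fun_eq_iff)
      then show ?thesis using Suc.prems(2) unfolding ts by simp
    qed
    then have "(\<Sum>(f, g)\<leftarrow>us. \<beta> f g) = 0"
      using Suc.hyps us ts by simp
    moreover have "\<beta> a b = 0" using linear_on_zero[OF V lin'[OF b]] True by simp
    ultimately show ?thesis by (simp add: ts)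
  next
    case False
    then obtain x0 where x0: "a x0 \<noteq> 0" by (auto simp: fun_eq_iff)
    define r where "r f = f x0 / a x0" for f :: "'x \<Rightarrow> 'k"
    define vs where "vs = map (\<lambda>(f, g). (f - fscale (r f) a, g)) us"
    have mem: "f \<in> V" "g \<in> W" if "(f, g) \<in> set us" for f g using us that by auto
    have b_eq: "(\<Sum>(f, g)\<leftarrow>us. fscale (r f) g) = - b"
    proof
      fix y
      have "(\<Sum>(f, g)\<leftarrow>us. r f * g y) = (\<Sum>(f, g)\<leftarrow>us. f x0 * g y) / a x0"
        by (induction us) (auto simp: r_def add_divide_distrib)
      also have "\<dots> = - b y"
        using z[of x0 y] x0 by (simp add: add_eq_0_iff)
      finally show "(\<Sum>(f, g)\<leftarrow>us. fscale (r f) g) y = (- b) y"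
        by (simp add: sum_list_fun_apply case_prod_unfold)
    qed
    have "(\<Sum>(f, g)\<leftarrow>vs. tensor f g) (x, y) = 0" for x y
    proof -
      have "(\<Sum>(f, g)\<leftarrow>vs. tensor f g) (x, y)
            = (\<Sum>(f, g)\<leftarrow>us. f x * g y) - a x * (\<Sum>(f, g)\<leftarrow>us. fscale (r f) g) y"
        unfolding vs_def by (induction us) (auto simp: tensor_def algebra_simps)
      then show ?thesis using z[of x y] b_eq by (simp add: algebra_simps)
    qed
    then have "(\<Sum>(f, g)\<leftarrow>vs. tensor f g) = 0" by (auto simp: fun_eq_iff)
    moreover have "set vs \<subseteq> V \<times> W"
      using mem a V by (auto simp: vs_def intro!: fun_space.subspace_diff fun_space.subspace_scale)
    moreover have "n = length vs" using Suc.hyps(2) ts by (simp add: vs_def)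
    ultimately have "(\<Sum>(f, g)\<leftarrow>vs. \<beta> f g) = 0" using Suc.hyps(1) by blast
    moreover have "(\<Sum>(f, g)\<leftarrow>vs. \<beta> f g) = (\<Sum>(f, g)\<leftarrow>us. \<beta> f g - \<beta> a (fscale (r f) g))"
    proof -
      have "\<beta> (f - fscale (r f) a) g = \<beta> f g - \<beta> a (fscale (r f) g)" if "(f, g) \<in> set us" for f g
      proof -
        note m = mem[OF that]
        have "\<beta> (f - fscale (r f) a) g = \<beta> f g - \<beta> (fscale (r f) a) g"
          using linear_on_diff[OF V lin'[OF m(2)] m(1)] a V fun_space.subspace_scale by blast
        also have "\<beta> (fscale (r f) a) g = \<beta> a (fscale (r f) g)"
          using lin'[OF m(2)] lin[OF a] a m by (simp add: linear_on_def)
        finally show ?thesis .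
      qed
      then show ?thesis
        unfolding vs_def map_map comp_def
        by (intro arg_cong[where f = sum_list] map_cong) auto
    qed
    moreover have "(\<Sum>(f, g)\<leftarrow>us. \<beta> a (fscale (r f) g)) = \<beta> a (\<Sum>(f, g)\<leftarrow>us. fscale (r f) g)"
    proof -
      have "\<forall>t\<in>set us. (case t of (f, g) \<Rightarrow> fscale (r f) g) \<in> W"
        using mem(2) fun_space.subspace_scale[OF W] by auto
      from linear_on_sum_list(1)[OF W lin[OF a] this] show ?thesis
        by (simp add: case_prod_unfold)
    qed
    moreover have "\<beta> a (- b) = - \<beta> a b"
      using linear_on_diff[OF W lin[OF a] fun_space.subspace_0[OF W] b]
        linear_on_zero[OF W lin[OF a]] by simp
    ultimately show ?thesis
      using b_eq by (simp add: ts case_prod_unfold sum_list_subtractf)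
  qed
qed

lemma tensor_space_rep:
  assumes V: "fun_space.subspace V" and t: "t \<in> tensor_space V W"
  shows "\<exists>ts. set ts \<subseteq> V \<times> W \<and> t = (\<Sum>(f, g)\<leftarrow>ts. tensor f g)"
  using t unfolding tensor_space_def
proof (induction rule: fun_space.span_induct_alt)
  case base
  then show ?case by (intro exI[of _ "[]"]) simp
next
  case (step c u v)
  obtain f g ts where *: "u = tensor f g" "f \<in> V" "g \<in> W" "set ts \<subseteq> V \<times> W"
    "v = (\<Sum>(f, g)\<leftarrow>ts. tensor f g)"
    using step by blast
  have "fscale c u = tensor (fscale c f) g" using * by (simp add: tensor_def fun_eq_iff)
  then show ?case using * fun_space.subspace_scale[OF V]
    by (intro exI[of _ "(fscale c f, g) # ts"]) simp
qed

lemma tensor_lift_eq: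
  assumes "fun_space.subspace V" "fun_space.subspace W" "vector_space s" "bilinear_on V W s \<beta>"
    and ts: "set ts \<subseteq> V \<times> W"
  shows "tensor_lift V W \<beta> (\<Sum>(f, g)\<leftarrow>ts. tensor f g) = (\<Sum>(f, g)\<leftarrow>ts. \<beta> f g)"
  unfolding tensor_lift_def
proof (rule the_equality)
  show "\<exists>us. set us \<subseteq> V \<times> W \<and> (\<Sum>(f, g)\<leftarrow>ts. tensor f g) = (\<Sum>(f, g)\<leftarrow>us. tensor f g) \<and>
    (\<Sum>(f, g)\<leftarrow>ts. \<beta> f g) = (\<Sum>(f, g)\<leftarrow>us. \<beta> f g)"
    using ts by blast
next
  fix u
  assume "\<exists>us. set us \<subseteq> V \<times> W \<and> (\<Sum>(f, g)\<leftarrow>ts. tensor f g) = (\<Sum>(f, g)\<leftarrow>us. tensor f g) \<and>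
    u = (\<Sum>(f, g)\<leftarrow>us. \<beta> f g)"
  then obtain us where us: "set us \<subseteq> V \<times> W"
    "(\<Sum>(f, g)\<leftarrow>ts. tensor f g) = (\<Sum>(f, g)\<leftarrow>us. tensor f g)" "u = (\<Sum>(f, g)\<leftarrow>us. \<beta> f g)" by blast
  define ns where "ns = map (\<lambda>(f, g). (- f, g)) us"
  have lin': "linear_on V s (\<lambda>f. \<beta> f g)" if "g \<in> W" for g
    using assms(4) that by (auto simp: bilinear_on_def)
  have neg: "\<beta> (- f) g = - \<beta> f g" if "f \<in> V" "g \<in> W" for f g
    using linear_on_diff[OF assms(1) lin'[OF that(2)] fun_space.subspace_0[OF assms(1)] that(1)]
      linear_on_zero[OF assms(1) lin'[OF that(2)]] by simp
  have "(\<Sum>(f, g)\<leftarrow>ns. tensor f g) = - (\<Sum>(f, g)\<leftarrow>us. tensor f g)"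
    by (auto simp: ns_def uminus_sum_list_map comp_def case_prod_unfold tensor_def fun_eq_iff
        sum_list_fun_apply)
  then have "(\<Sum>(f, g)\<leftarrow>ts @ ns. tensor f g) = 0" using us(2) by simp
  moreover have "set (ts @ ns) \<subseteq> V \<times> W"
    using ts us(1) fun_space.subspace_neg[OF assms(1)] by (auto simp: ns_def)
  ultimately have "(\<Sum>(f, g)\<leftarrow>ts @ ns. \<beta> f g) = 0"
    using tensor_relation[OF assms(1-4)] by blast
  moreover have "(\<Sum>(f, g)\<leftarrow>ns. \<beta> f g) = (\<Sum>(f, g)\<leftarrow>us. - \<beta> f g)"
    unfolding ns_def map_map comp_def using us(1) neg
    by (intro arg_cong[where f = sum_list] map_cong) auto
  ultimately show "u = (\<Sum>(f, g)\<leftarrow>ts. \<beta> f g)"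
  proof -
    assume *: "(\<Sum>(f, g)\<leftarrow>ts @ ns. \<beta> f g) = 0"
      "(\<Sum>(f, g)\<leftarrow>ns. \<beta> f g) = (\<Sum>(f, g)\<leftarrow>us. - \<beta> f g)"
    have "(\<Sum>(f, g)\<leftarrow>us. - \<beta> f g) = - (\<Sum>(f, g)\<leftarrow>us. \<beta> f g)"
      by (induction us) auto
    with * us(3) show ?thesis by (simp add: add_eq_0_iff)
  qed
qed

lemma tensor_lift_universal:
  assumes "fun_space.subspace V" "fun_space.subspace W" "vector_space s" "bilinear_on V W s \<beta>"
  shows "linear_on (tensor_space V W) s (tensor_lift V W \<beta>)"
    and "\<lbrakk>f \<in> V; g \<in> W\<rbrakk> \<Longrightarrow> tensor_lift V W \<beta> (tensor f g) = \<beta> f g"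
    and "\<lbrakk>linear_on (tensor_space V W) s L; \<And>f g. \<lbrakk>f \<in> V; g \<in> W\<rbrakk> \<Longrightarrow> L (tensor f g) = \<beta> f g;
          t \<in> tensor_space V W\<rbrakk> \<Longrightarrow> L t = tensor_lift V W \<beta> t"
proof -
  interpret s: vector_space s by (fact assms(3))
  note eq = tensor_lift_eq[OF assms]
  show "linear_on (tensor_space V W) s (tensor_lift V W \<beta>)"
    unfolding linear_on_def
  proof (intro conjI ballI allI)
    fix t u assume "t \<in> tensor_space V W" "u \<in> tensor_space V W"
    then obtain ts us where *: "set ts \<subseteq> V \<times> W" "t = (\<Sum>(f, g)\<leftarrow>ts. tensor f g)"
      "set us \<subseteq> V \<times> W" "u = (\<Sum>(f, g)\<leftarrow>us. tensor f g)"
      using tensor_space_rep[OF assms(1)] by metis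
    then have "t + u = (\<Sum>(f, g)\<leftarrow>ts @ us. tensor f g)" by simp
    moreover have "set (ts @ us) \<subseteq> V \<times> W" using * by simp
    ultimately show "tensor_lift V W \<beta> (t + u) = tensor_lift V W \<beta> t + tensor_lift V W \<beta> u"
      using eq[of ts] eq[of us] eq[of "ts @ us"] * by simp
  next
    fix c t assume "t \<in> tensor_space V W"
    then obtain ts where *: "set ts \<subseteq> V \<times> W" "t = (\<Sum>(f, g)\<leftarrow>ts. tensor f g)"
      using tensor_space_rep[OF assms(1)] by metis
    define us where "us = map (\<lambda>(f, g). (fscale c f, g)) ts"
    have us: "set us \<subseteq> V \<times> W"
      using *(1) fun_space.subspace_scale[OF assms(1)] by (auto simp: us_def)
    have "fscale c t = (\<Sum>(f, g)\<leftarrow>us. tensor f g)"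
      unfolding *(2) fscale_sum_list us_def map_map comp_def
      by (intro arg_cong[where f = sum_list] map_cong)
        (auto simp: tensor_def fun_eq_iff)
    then have "tensor_lift V W \<beta> (fscale c t) = (\<Sum>(f, g)\<leftarrow>us. \<beta> f g)" using eq[OF us] by simp
    also have "\<dots> = (\<Sum>(f, g)\<leftarrow>ts. s c (\<beta> f g))"
      unfolding us_def map_map comp_def
      using *(1) assms(4) by (intro arg_cong[where f = sum_list] map_cong)
        (auto simp: bilinear_on_def linear_on_def)
    also have "\<dots> = s c (\<Sum>(f, g)\<leftarrow>ts. \<beta> f g)"
      by (induction ts) (auto simp: s.scale_right_distrib)
    finally show "tensor_lift V W \<beta> (fscale c t) = s c (tensor_lift V W \<beta> t)"
      using eq[OF *(1)] *(2) by simp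
  qed
  show "tensor_lift V W \<beta> (tensor f g) = \<beta> f g" if "f \<in> V" "g \<in> W"
    using eq[of "[(f, g)]"] that by simp
  show "L t = tensor_lift V W \<beta> t"
    if L: "linear_on (tensor_space V W) s L" "\<And>f g. \<lbrakk>f \<in> V; g \<in> W\<rbrakk> \<Longrightarrow> L (tensor f g) = \<beta> f g"
      "t \<in> tensor_space V W"
  proof -
    obtain ts where *: "set ts \<subseteq> V \<times> W" "t = (\<Sum>(f, g)\<leftarrow>ts. tensor f g)"
      using tensor_space_rep[OF assms(1) L(3)] by blast
    have sub: "fun_space.subspace (tensor_space V W)" by (simp add: tensor_space_def)
    have mem: "tensor f g \<in> tensor_space V W" if "(f, g) \<in> set ts" for f g
      unfolding tensor_space_def using *(1) that by (intro fun_space.span_base) blast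
    have "L t = (\<Sum>(f, g)\<leftarrow>ts. L (tensor f g))"
      using linear_on_sum_list(1)[OF sub L(1), of ts "\<lambda>(f, g). tensor f g"] mem *(2)
      by (auto simp: case_prod_unfold)
    also have "\<dots> = (\<Sum>(f, g)\<leftarrow>ts. \<beta> f g)"
      using *(1) L(2) by (intro arg_cong[where f = sum_list] map_cong) auto
    finally show ?thesis using eq[OF *(1)] *(2) by simp
  qed
qed


section \<open>Algebras and bialgebras\<close>

record ('x, 'k) alg =
  space :: "('x \<Rightarrow> 'k) set"
  mult :: "('x \<Rightarrow> 'k) \<Rightarrow> ('x \<Rightarrow> 'k) \<Rightarrow> 'x \<Rightarrow> 'k"
  one :: "'x \<Rightarrow> 'k"

record ('x, 'k) bialg = "('x, 'k) alg" +
  coprod :: "('x \<Rightarrow> 'k) \<Rightarrow> 'x \<times> 'x \<Rightarrow> 'k"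

definition unital_algebra :: "('x, 'k::field, 'r) alg_scheme \<Rightarrow> bool" where
  "unital_algebra A \<longleftrightarrow>
     fun_space.subspace (space A) \<and> one A \<in> space A \<and>
     (\<forall>a\<in>space A. \<forall>b\<in>space A. mult A a b \<in> space A) \<and>
     bilinear_on (space A) (space A) fscale (mult A) \<and>
     (\<forall>a\<in>space A. \<forall>b\<in>space A. \<forall>c\<in>space A. mult A (mult A a b) c = mult A a (mult A b c)) \<and>
     (\<forall>a\<in>space A. mult A (one A) a = a \<and> mult A a (one A) = a)"

definition alg_hom ::
  "('x, 'k::field, 'r) alg_scheme \<Rightarrow> ('y, 'k, 's) alg_scheme \<Rightarrow> (('x \<Rightarrow> 'k) \<Rightarrow> ('y \<Rightarrow> 'k)) \<Rightarrow> bool"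
  where
  "alg_hom A B \<phi> \<longleftrightarrow>
     linear_on (space A) fscale \<phi> \<and> \<phi> ` space A \<subseteq> space B \<and> \<phi> (one A) = one B \<and>
     (\<forall>a\<in>space A. \<forall>b\<in>space A. \<phi> (mult A a b) = mult B (\<phi> a) (\<phi> b))"

definition alg_tensor ::
  "('x, 'k::field, 'r) alg_scheme \<Rightarrow> ('y, 'k, 's) alg_scheme \<Rightarrow> ('x \<times> 'y, 'k) alg" where
  "alg_tensor A B =
     \<lparr>space = tensor_space (space A) (space B),
      mult = (\<lambda>t u. tensor_lift (space A) (space B) (\<lambda>a b.
                tensor_lift (space A) (space B) (\<lambda>a' b'. tensor (mult A a a') (mult B b b')) u) t),
      one = tensor (one A) (one B)\<rparr>"

definition is_counit :: "('x, 'k::field, 'r) bialg_scheme \<Rightarrow> (('x \<Rightarrow> 'k) \<Rightarrow> 'k) \<Rightarrow> bool" where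
  "is_counit B \<epsilon> \<longleftrightarrow>
     linear_on (space B) (*) \<epsilon> \<and> \<epsilon> (one B) = 1 \<and>
     (\<forall>a\<in>space B. \<forall>b\<in>space B. \<epsilon> (mult B a b) = \<epsilon> a * \<epsilon> b) \<and>
     (\<forall>a\<in>space B.
        tensor_lift (space B) (space B) (\<lambda>b c. fscale (\<epsilon> b) c) (coprod B a) = a \<and>
        tensor_lift (space B) (space B) (\<lambda>b c. fscale (\<epsilon> c) b) (coprod B a) = a)"

definition bialgebra :: "('x, 'k::field, 'r) bialg_scheme \<Rightarrow> bool" where
  "bialgebra B \<longleftrightarrow>
     unital_algebra B \<and> alg_hom B (alg_tensor B B) (coprod B) \<and>
     (\<forall>a\<in>space B. \<forall>x y z.
        tensor_map (space B) (space B) (coprod B) id (coprod B a) ((x, y), z) =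
        tensor_map (space B) (space B) id (coprod B) (coprod B a) (x, (y, z))) \<and>
     (\<exists>\<epsilon>. is_counit B \<epsilon>)"

definition bialgebra_hom ::
  "('x, 'k::field, 'r) bialg_scheme \<Rightarrow> ('y, 'k, 's) bialg_scheme \<Rightarrow>
     (('x \<Rightarrow> 'k) \<Rightarrow> ('y \<Rightarrow> 'k)) \<Rightarrow> bool" where
  "bialgebra_hom A B \<phi> \<longleftrightarrow>
     bialgebra A \<and> bialgebra B \<and> alg_hom A B \<phi> \<and>
     (\<forall>a\<in>space A. coprod B (\<phi> a) = tensor_map (space A) (space A) \<phi> \<phi> (coprod A a)) \<and>
     (\<forall>\<epsilon> \<epsilon>'. is_counit A \<epsilon> \<longrightarrow> is_counit B \<epsilon>' \<longrightarrow> (\<forall>a\<in>space A. \<epsilon>' (\<phi> a) = \<epsilon> a))"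

definition bialgebra_iso ::
  "('x, 'k::field, 'r) bialg_scheme \<Rightarrow> ('y, 'k, 's) bialg_scheme \<Rightarrow>
     (('x \<Rightarrow> 'k) \<Rightarrow> ('y \<Rightarrow> 'k)) \<Rightarrow> bool" where
  "bialgebra_iso A B \<phi> \<longleftrightarrow> bialgebra_hom A B \<phi> \<and> bij_betw \<phi> (space A) (space B)"


section \<open>Tensor algebras\<close>

text \<open>
  For \<open>V \<subseteq> 'v \<Rightarrow> 'k\<close>, the tensor algebra is realized in the same way inside \<open>'v list \<Rightarrow> 'k\<close>.
  The word \<open>f\<^sub>1 \<dots> f\<^sub>k\<close> becomes the function
  \<open>x\<^sub>1 \<dots> x\<^sub>l \<mapsto> \<delta>\<^sub>k\<^sub>l f\<^sub>1(x\<^sub>1) \<dots> f\<^sub>k(x\<^sub>k)\<close>, so that applying an element \<open>F\<close> of the tensor algebra to a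
  word \<open>X\<close> is the pairing of \<open>F\<close> with \<open>X\<close>.  Lemma \<open>free_lift_universal\<close> is the universal
  property.
\<close>

definition word :: "('v \<Rightarrow> 'k::field) list \<Rightarrow> 'v list \<Rightarrow> 'k" where
  "word fs xs = (if length xs = length fs then \<Prod>(f, x)\<leftarrow>zip fs xs. f x else 0)"

definition conc :: "('v list \<Rightarrow> 'k::field) \<Rightarrow> ('v list \<Rightarrow> 'k) \<Rightarrow> 'v list \<Rightarrow> 'k" where
  "conc F G = (\<lambda>xs. \<Sum>i\<le>length xs. F (take i xs) * G (drop i xs))"

definition tensor_algebra :: "('v \<Rightarrow> 'k::field) set \<Rightarrow> ('v list, 'k) alg" where
  "tensor_algebra V = \<lparr>space = fun_space.span (word ` lists V), mult = conc, one = word []\<rparr>"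

text \<open>The algebra morphism from the tensor algebra on \<open>V\<close> to \<open>A\<close> extending a linear map \<open>g\<close>.\<close>

definition free_lift ::
  "('v \<Rightarrow> 'k::field) set \<Rightarrow> ('y, 'k, 'r) alg_scheme \<Rightarrow> (('v \<Rightarrow> 'k) \<Rightarrow> 'y \<Rightarrow> 'k) \<Rightarrow>
     ('v list \<Rightarrow> 'k) \<Rightarrow> 'y \<Rightarrow> 'k" where
  "free_lift V A g F = (THE G. \<exists>ts. snd ` set ts \<subseteq> lists V \<and>
     F = (\<Sum>(c, fs)\<leftarrow>ts. fscale c (word fs)) \<and>
     G = (\<Sum>(c, fs)\<leftarrow>ts. fscale c (foldr (\<lambda>f. mult A (g f)) fs (one A))))"


declare plus_fun_apply [simp del] zero_fun_apply [simp del] fscale_apply [simp del]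
lemmas fun_ops = fun_eq_iff plus_fun_apply zero_fun_apply fscale_apply

lemma word_simps [simp]:
  "word [] [] = 1" "word [] (x # xs) = 0" "word (f # fs) [] = 0"
  "word (f # fs) (x # xs) = f x * word fs xs"
  by (simp_all add: word_def)

lemma word_append:
  "word (fs @ gs) xs =
     (if length xs = length fs + length gs
      then word fs (take (length fs) xs) * word gs (drop (length fs) xs) else 0)"
proof (cases "length xs = length fs + length gs")
  case True
  then have z: "zip (fs @ gs) xs = zip fs (take (length fs) xs) @ zip gs (drop (length fs) xs)"
    by (simp add: zip_append1)
  show ?thesis using True unfolding word_def z by simp
qed (simp add: word_def)

lemma conc_word: "conc (word fs) (word gs) = word (fs @ gs)"
proof
  fix xs :: "'a list"
  have "conc (word fs) (word gs) xs =
      (\<Sum>i\<le>length xs. if i = length fs then word fs (take i xs) * word gs (drop i xs) else 0)"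
    unfolding conc_def by (rule sum.cong) (auto simp: word_def)
  also have "\<dots> = (if length fs \<le> length xs
      then word fs (take (length fs) xs) * word gs (drop (length fs) xs) else 0)"
    by simp
  also have "\<dots> = word (fs @ gs) xs"
    unfolding word_append by (auto simp: word_def[of fs] word_def[of gs])
  finally show "conc (word fs) (word gs) xs = word (fs @ gs) xs" .
qed

lemma conc_assoc: "conc (conc F G) H = conc F (conc G H)"
proof
  fix xs :: "'a list"
  have swap: "(\<Sum>j\<le>k. \<Sum>i\<le>j. h i (j - i)) = (\<Sum>i\<le>k. \<Sum>j\<le>k - i. h i j)"
    for k :: nat and h :: "nat \<Rightarrow> nat \<Rightarrow> 'b"
    by (induction k) (simp_all add: Suc_diff_le sum.distrib add.assoc)
  define h where "h i j = F (take i xs) * (G (take j (drop i xs)) * H (drop (i + j) xs))" for i j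
  have "conc (conc F G) H xs = (\<Sum>j\<le>length xs. \<Sum>i\<le>j. h i (j - i))"
    unfolding conc_def
  proof (rule sum.cong, simp)
    fix j assume "j \<in> {..length xs}"
    then show "(\<Sum>i\<le>length (take j xs). F (take i (take j xs)) * G (drop i (take j xs))) * H (drop j xs)
        = (\<Sum>i\<le>j. h i (j - i))"
      unfolding h_def sum_distrib_right
      by (intro sum.cong) (auto simp: min_def drop_take mult.assoc)
  qed
  also have "\<dots> = (\<Sum>i\<le>length xs. \<Sum>j\<le>length xs - i. h i j)" by (rule swap)
  also have "\<dots> = conc F (conc G H) xs"
    unfolding conc_def h_def sum_distrib_left
    by (intro sum.cong) (auto simp: add.commute)
  finally show "conc (conc F G) H xs = conc F (conc G H) xs" .
qed

lemma conc_unit: "conc (word []) F = F" "conc F (word []) = F"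
proof -
  have "conc (word []) F xs = (\<Sum>i\<le>length xs. if i = 0 then F xs else 0)" for xs
    unfolding conc_def by (rule sum.cong) (auto simp: word_def)
  moreover have "conc F (word []) xs = (\<Sum>i\<le>length xs. if i = length xs then F xs else 0)" for xs
    unfolding conc_def by (rule sum.cong) (auto simp: word_def)
  ultimately show "conc (word []) F = F" "conc F (word []) = F" by (simp_all add: fun_ops)
qed

lemma conc_linear:
  "conc (F + G) H = conc F H + conc G H" "conc H (F + G) = conc H F + conc H G"
  "conc (fscale c F) H = fscale c (conc F H)" "conc H (fscale c F) = fscale c (conc H F)"
  by (simp_all add: fun_ops conc_def algebra_simps sum.distrib sum_distrib_left)

lemma conc_zero: "conc 0 H = 0" "conc H 0 = 0"
  by (simp_all add: fun_ops conc_def)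

lemma tensor_algebra_simps [simp]:
  "space (tensor_algebra V) = fun_space.span (word ` lists V)"
  "mult (tensor_algebra V) = conc" "one (tensor_algebra V) = word []"
  by (simp_all add: tensor_algebra_def)

lemma conc_closed:
  assumes "F \<in> fun_space.span (word ` lists V)" "G \<in> fun_space.span (word ` lists V)"
  shows "conc F G \<in> fun_space.span (word ` lists V)"
  using assms(1)
proof (induction rule: fun_space.span_induct_alt)
  case base
  then show ?case by (simp add: conc_zero fun_space.span_zero)
next
  case (step c u v)
  then obtain fs where fs: "u = word fs" "fs \<in> lists V" by blast
  have "conc u G \<in> fun_space.span (word ` lists V)"
    using assms(2)
  proof (induction rule: fun_space.span_induct_alt)
    case base
    then show ?case by (simp add: conc_zero fun_space.span_zero)
  next
    case (step c w z)
    then obtain gs where gs: "w = word gs" "gs \<in> lists V" by blast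
    have "conc u (fscale c w + z) = fscale c (word (fs @ gs)) + conc u z"
      by (simp add: conc_linear conc_word fs gs)
    moreover have "word (fs @ gs) \<in> fun_space.span (word ` lists V)"
      using fs(2) gs(2) by (intro fun_space.span_base imageI) auto
    ultimately show ?case using step by (simp add: fun_space.span_add fun_space.span_scale)
  qed
  then show ?case using step
    by (auto simp: conc_linear intro!: fun_space.span_add fun_space.span_scale)
qed

lemma unital_algebra_tensor_algebra: "unital_algebra (tensor_algebra V)"
  unfolding unital_algebra_def
  by (auto simp: conc_closed conc_assoc conc_unit bilinear_on_def linear_on_def conc_linear
      intro!: fun_space.span_base imageI)

definition multilinear_on ::
  "('x \<Rightarrow> 'k::field) set \<Rightarrow> ('k \<Rightarrow> 'u \<Rightarrow> 'u::ab_group_add) \<Rightarrow> (('x \<Rightarrow> 'k) list \<Rightarrow> 'u) \<Rightarrow> bool" where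
  "multilinear_on V s \<phi> \<longleftrightarrow> (\<forall>us\<in>lists V. \<forall>vs\<in>lists V. linear_on V s (\<lambda>f. \<phi> (us @ f # vs)))"

lemma words_rep:
  assumes "F \<in> fun_space.span (word ` L)"
  shows "\<exists>ts. snd ` set ts \<subseteq> L \<and> F = (\<Sum>(c, fs)\<leftarrow>ts. fscale c (word fs))"
  using assms
proof (induction rule: fun_space.span_induct_alt)
  case base
  then show ?case by (intro exI[of _ "[]"]) simp
next
  case (step c u v)
  then obtain fs ts where *: "u = word fs" "fs \<in> L" "snd ` set ts \<subseteq> L"
    "v = (\<Sum>(c, fs)\<leftarrow>ts. fscale c (word fs))"
    by blast
  then show ?case by (intro exI[of _ "(c, fs) # ts"]) simp
qed

lemma words_sum_span:
  assumes "snd ` set ts \<subseteq> L"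
  shows "(\<Sum>(c, fs)\<leftarrow>ts. fscale c (word fs)) \<in> fun_space.span (word ` L)"
  using assms
proof (induction ts)
  case (Cons t ts)
  then have "(\<Sum>(c, fs)\<leftarrow>ts. fscale c (word fs)) \<in> fun_space.span (word ` L)"
    "word (snd t) \<in> fun_space.span (word ` L)"
    by (auto intro: fun_space.span_base)
  then show ?case unfolding list.map sum_list.Cons case_prod_unfold by (intro fun_space.span_add fun_space.span_scale)
qed (simp add: fun_space.span_zero)

lemma word_relation:
  fixes V :: "('x \<Rightarrow> 'k::field) set"
  assumes V: "fun_space.subspace V" and s: "vector_space s"
    and \<phi>: "multilinear_on V s \<phi>"
    and "snd ` set ts \<subseteq> {fs\<in>lists V. length fs \<le> N}"
    and "(\<Sum>(c, fs)\<leftarrow>ts. fscale c (word fs)) = 0"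
  shows "(\<Sum>(c, fs)\<leftarrow>ts. s c (\<phi> fs)) = 0"
  using assms(3-)
proof (induction N arbitrary: \<phi> ts)
  case 0
  interpret s: vector_space s by (fact s)
  have nil: "fs = []" if "(c, fs) \<in> set ts" for c fs
    using 0(2) that by force
  have "(\<Sum>(c, fs)\<leftarrow>ts. fscale c (word fs)) [] = 0" using 0(3) by (simp add: zero_fun_apply)
  then have "(\<Sum>(c, fs)\<leftarrow>ts. c * word fs []) = 0"
    by (simp add: sum_list_fun_apply case_prod_unfold fscale_apply)
  also have "(\<Sum>(c, fs)\<leftarrow>ts. c * word fs []) = (\<Sum>(c, fs)\<leftarrow>ts. c)"
    using nil by (intro arg_cong[where f = sum_list] map_cong) force+
  finally have "(\<Sum>(c, fs)\<leftarrow>ts. c) = 0" .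
  moreover have "(\<Sum>(c, fs)\<leftarrow>ts. s c (\<phi> [])) = s (\<Sum>(c, fs)\<leftarrow>ts. c) (\<phi> [])"
    by (induction ts) (auto simp: s.scale_left_distrib)
  moreover have "(\<Sum>(c, fs)\<leftarrow>ts. s c (\<phi> fs)) = (\<Sum>(c, fs)\<leftarrow>ts. s c (\<phi> []))"
    using nil by (intro arg_cong[where f = sum_list] map_cong) force+
  ultimately show ?case by simp
next
  case (Suc N)
  interpret s: vector_space s by (fact s)
  define L where "L = {fs\<in>lists V. length fs \<le> N}"
  define W where "W = fun_space.span (word ` L)"
  have W: "fun_space.subspace W" by (simp add: W_def)
  define rep where "rep G = (SOME ts. snd ` set ts \<subseteq> L \<and> G = (\<Sum>(c, fs)\<leftarrow>ts. fscale c (word fs)))" for G :: "'x list \<Rightarrow> 'k"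
  define \<beta> where "\<beta> f G = (\<Sum>(c, fs)\<leftarrow>rep G. s c (\<phi> (f # fs)))" for f G
  have rep: "snd ` set (rep G) \<subseteq> L" "G = (\<Sum>(c, fs)\<leftarrow>rep G. fscale c (word fs))" if "G \<in> W" for G
  proof -
    have "\<exists>ts. snd ` set ts \<subseteq> L \<and> G = (\<Sum>(c, fs)\<leftarrow>ts. fscale c (word fs))"
      using words_rep that unfolding W_def by blast
    from someI_ex[OF this] show "snd ` set (rep G) \<subseteq> L" "G = (\<Sum>(c, fs)\<leftarrow>rep G. fscale c (word fs))"
      unfolding rep_def by auto
  qed
  have mult: "multilinear_on V s (\<lambda>fs. \<phi> (f # fs))" if "f \<in> V" for f
    unfolding multilinear_on_def
  proof (intro ballI)
    fix us vs assume "us \<in> lists V" "vs \<in> lists V"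
    then have "linear_on V s (\<lambda>h. \<phi> ((f # us) @ h # vs))"
      using Suc.prems(1) that unfolding multilinear_on_def by (metis lists.Cons)
    then show "linear_on V s (\<lambda>h. \<phi> (f # us @ h # vs))" by simp
  qed
  have val: "\<beta> f (\<Sum>(c, fs)\<leftarrow>us. fscale c (word fs)) = (\<Sum>(c, fs)\<leftarrow>us. s c (\<phi> (f # fs)))"
    if f: "f \<in> V" and us: "snd ` set us \<subseteq> L" for f us
  proof -
    define G where "G = (\<Sum>(c, fs)\<leftarrow>us. fscale c (word fs))"
    have G: "G \<in> W" unfolding G_def W_def by (rule words_sum_span[OF us])
    define ns where "ns = map (\<lambda>(c, fs). (- c, fs)) us"
    have "(\<Sum>(c, fs)\<leftarrow>ns. fscale c (word fs)) = - G"
      unfolding ns_def G_def by (auto simp: fun_ops sum_list_fun_apply case_prod_unfold comp_def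
          uminus_sum_list_map)
    then have "(\<Sum>(c, fs)\<leftarrow>rep G @ ns. fscale c (word fs)) = 0"
      unfolding map_append sum_list_append using rep(2)[OF G] by simp
    moreover have "snd ` set (rep G @ ns) \<subseteq> {fs\<in>lists V. length fs \<le> N}"
      using rep(1)[OF G] us unfolding L_def[symmetric] by (force simp: ns_def)
    ultimately have "(\<Sum>(c, fs)\<leftarrow>rep G @ ns. s c (\<phi> (f # fs))) = 0"
      using Suc.IH[OF mult[OF f]] by blast
    moreover have "(\<Sum>(c, fs)\<leftarrow>ns. s c (\<phi> (f # fs))) = - (\<Sum>(c, fs)\<leftarrow>us. s c (\<phi> (f # fs)))"
      unfolding ns_def by (induction us) (auto simp: s.scale_minus_left)
    ultimately show ?thesis unfolding \<beta>_def G_def[symmetric] by simp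
  qed
  have \<beta>: "bilinear_on V W s \<beta>"
    unfolding bilinear_on_def
  proof (intro conjI ballI)
    fix f assume f: "f \<in> V"
    show "linear_on W s (\<beta> f)"
      unfolding linear_on_def
    proof (intro conjI ballI allI)
      fix G H assume GH: "G \<in> W" "H \<in> W"
      have "G + H = (\<Sum>(c, fs)\<leftarrow>rep G @ rep H. fscale c (word fs))"
        unfolding map_append sum_list_append using rep(2)[OF GH(1)] rep(2)[OF GH(2)] by metis
      moreover have "snd ` set (rep G @ rep H) \<subseteq> L" using rep(1)[OF GH(1)] rep(1)[OF GH(2)] by auto
      ultimately have "\<beta> f (G + H) = (\<Sum>(c, fs)\<leftarrow>rep G @ rep H. s c (\<phi> (f # fs)))"
        using val[OF f] by metis
      then show "\<beta> f (G + H) = \<beta> f G + \<beta> f H" by (simp add: \<beta>_def)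
    next
      fix c G assume G: "G \<in> W"
      define us where "us = map (\<lambda>(d, fs). (c * d, fs)) (rep G)"
      have "fscale c G = (\<Sum>(d, fs)\<leftarrow>us. fscale d (word fs))"
        by (subst rep(2)[OF G], unfold fscale_sum_list us_def map_map comp_def)
          (intro arg_cong[where f = sum_list] map_cong, auto simp: fun_ops)
      moreover have "snd ` set us \<subseteq> L" using rep(1)[OF G] by (force simp: us_def)
      ultimately have "\<beta> f (fscale c G) = (\<Sum>(d, fs)\<leftarrow>us. s d (\<phi> (f # fs)))"
        using val[OF f] by metis
      also have "\<dots> = s c (\<beta> f G)"
      proof -
        have "(\<Sum>(d, fs)\<leftarrow>map (\<lambda>(d, fs). (c * d, fs)) ts. s d (\<phi> (f # fs)))
          = s c (\<Sum>(d, fs)\<leftarrow>ts. s d (\<phi> (f # fs)))" for ts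
          by (induction ts) (auto simp: s.scale_right_distrib)
        then show ?thesis by (simp add: us_def \<beta>_def)
      qed
      finally show "\<beta> f (fscale c G) = s c (\<beta> f G)" .
    qed
  next
    fix G assume G: "G \<in> W"
    have lin: "linear_on V s (\<lambda>f. \<phi> (f # fs))" if "fs \<in> lists V" for fs
    proof -
      have "linear_on V s (\<lambda>f. \<phi> ([] @ f # fs))"
        using Suc.prems(1) that unfolding multilinear_on_def by blast
      then show ?thesis by simp
    qed
    have "linear_on V s (\<lambda>f. \<Sum>(c, fs)\<leftarrow>us. s c (\<phi> (f # fs)))" if "snd ` set us \<subseteq> lists V" for us
      using that
    proof (induction us)
      case Nil
      then show ?case by (simp add: linear_on_def)
    next
      case (Cons u us)
      then have "linear_on V s (\<lambda>f. \<Sum>(c, fs)\<leftarrow>us. s c (\<phi> (f # fs)))"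
        "linear_on V s (\<lambda>f. \<phi> (f # snd u))" using lin by auto
      then show ?case
        by (auto simp: linear_on_def case_prod_unfold s.scale_right_distrib s.scale_left_commute)
    qed
    moreover have "snd ` set (rep G) \<subseteq> lists V" using rep(1)[OF G] by (auto simp: L_def)
    ultimately show "linear_on V s (\<lambda>f. \<beta> f G)" unfolding \<beta>_def by blast
  qed
  define es where "es = filter (\<lambda>t. snd t = []) ts"
  define us where "us = filter (\<lambda>t. snd t \<noteq> []) ts"
  have split: "(\<Sum>t\<leftarrow>ts. h t) = (\<Sum>t\<leftarrow>es. h t) + (\<Sum>t\<leftarrow>us. h t)" for h :: "_ \<Rightarrow> 'w::comm_monoid_add"
    unfolding es_def us_def by (induction ts) (auto simp: ac_simps)
  have z: "(\<Sum>t\<leftarrow>ts. fst t * word (snd t) xs) = 0" for xs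
  proof -
    have "(\<Sum>(c, fs)\<leftarrow>ts. fscale c (word fs)) xs = 0" using Suc.prems(3) by (simp add: zero_fun_apply)
    then show ?thesis by (simp add: sum_list_fun_apply case_prod_unfold fscale_apply)
  qed
  have cons: "snd t = hd (snd t) # tl (snd t)" "hd (snd t) \<in> V" "tl (snd t) \<in> L" if "t \<in> set us" for t
  proof -
    have "snd t \<in> lists V" "length (snd t) \<le> Suc N" "snd t \<noteq> []"
      using Suc.prems(2) that by (auto simp: us_def)
    then show "snd t = hd (snd t) # tl (snd t)" "hd (snd t) \<in> V" "tl (snd t) \<in> L"
      by (cases "snd t"; auto simp: L_def)+
  qed
  have es0: "(\<Sum>t\<leftarrow>es. h t) = (\<Sum>t\<leftarrow>es. h (fst t, []))" for h :: "_ \<Rightarrow> 'w::comm_monoid_add"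
    unfolding es_def by (intro arg_cong[where f = sum_list] map_cong) (auto simp: prod_eq_iff)
  have us0: "(\<Sum>t\<leftarrow>us. h t) = (\<Sum>t\<leftarrow>us. h (fst t, hd (snd t) # tl (snd t)))" for h :: "_ \<Rightarrow> 'w::comm_monoid_add"
    using cons(1) by (intro arg_cong[where f = sum_list] map_cong) (auto simp: prod_eq_iff)
  have "(\<Sum>t\<leftarrow>es. fst t) = 0"
    using z[of "[]"] unfolding split by (subst (asm) es0, subst (asm) us0) simp
  moreover have "(\<Sum>t\<leftarrow>es. s (fst t) (\<phi> [])) = s (\<Sum>t\<leftarrow>es. fst t) (\<phi> [])"
    by (induction es) (auto simp: s.scale_left_distrib)
  ultimately have E: "(\<Sum>t\<leftarrow>es. s (fst t) (\<phi> (snd t))) = 0"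
    by (subst es0) simp
  have zu: "(\<Sum>t\<leftarrow>us. fst t * (hd (snd t) x * word (tl (snd t)) xs)) = 0" for x xs
    using z[of "x # xs"] unfolding split by (subst (asm) es0, subst (asm) us0) simp
  define vs where "vs = map (\<lambda>t. (hd (snd t), fscale (fst t) (word (tl (snd t))))) us"
  have vsW: "set vs \<subseteq> V \<times> W"
  proof -
    have "fscale (fst t) (word (tl (snd t))) \<in> W" if "t \<in> set us" for t
      unfolding W_def using cons(3)[OF that] by (intro fun_space.span_scale fun_space.span_base imageI)
    then show ?thesis using cons(2) by (auto simp: vs_def)
  qed
  have "(\<Sum>(f, g)\<leftarrow>vs. tensor f g) = 0"
    using zu by (auto simp: fun_ops vs_def sum_list_fun_apply tensor_def comp_def ac_simps)
  then have "(\<Sum>(f, g)\<leftarrow>vs. \<beta> f g) = 0" using tensor_relation[OF V W s \<beta> vsW] by blast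
  moreover have "(\<Sum>(f, g)\<leftarrow>vs. \<beta> f g) = (\<Sum>t\<leftarrow>us. s (fst t) (\<phi> (snd t)))"
    unfolding vs_def map_map comp_def case_prod_conv
  proof (intro arg_cong[where f = sum_list] map_cong refl)
    fix t assume t: "t \<in> set us"
    have "\<beta> (hd (snd t)) (fscale (fst t) (word (tl (snd t)))) = s (fst t) (\<phi> (hd (snd t) # tl (snd t)))"
      using val[OF cons(2)[OF t], of "[(fst t, tl (snd t))]"] cons(3)[OF t] by simp
    then show "\<beta> (hd (snd t)) (fscale (fst t) (word (tl (snd t)))) = s (fst t) (\<phi> (snd t))"
      using cons(1)[OF t] by simp
  qed
  ultimately show ?case using E by (simp add: split case_prod_unfold)
qed

lemma words_relation_eq:
  assumes V: "fun_space.subspace V" and s: "vector_space s" and \<phi>: "multilinear_on V s \<phi>"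
    and ts: "snd ` set ts \<subseteq> lists V" and us: "snd ` set us \<subseteq> lists V"
    and eq: "(\<Sum>(c, fs)\<leftarrow>ts. fscale c (word fs)) = (\<Sum>(c, fs)\<leftarrow>us. fscale c (word fs))"
  shows "(\<Sum>(c, fs)\<leftarrow>ts. s c (\<phi> fs)) = (\<Sum>(c, fs)\<leftarrow>us. s c (\<phi> fs))"
proof -
  interpret s: vector_space s by (fact s)
  define ns where "ns = map (\<lambda>(c, fs). (- c, fs)) us"
  define N where "N = sum_list (map (\<lambda>t. length (snd t)) (ts @ ns))"
  have "(\<Sum>(c, fs)\<leftarrow>ns. fscale c (word fs)) = - (\<Sum>(c, fs)\<leftarrow>us. fscale c (word fs))"
    unfolding ns_def by (induction us) auto
  then have "(\<Sum>(c, fs)\<leftarrow>ts @ ns. fscale c (word fs)) = 0"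
    unfolding map_append sum_list_append eq by simp
  moreover have "snd ` set (ts @ ns) \<subseteq> {fs\<in>lists V. length fs \<le> N}"
  proof -
    have "length (snd t) \<le> N" if "t \<in> set (ts @ ns)" for t
      unfolding N_def using that by (intro member_le_sum_list) auto
    moreover have "snd ` set (ts @ ns) \<subseteq> lists V" using ts us by (force simp: ns_def)
    ultimately show ?thesis by blast
  qed
  ultimately have "(\<Sum>(c, fs)\<leftarrow>ts @ ns. s c (\<phi> fs)) = 0"
    using word_relation[OF V s \<phi>] by blast
  moreover have "(\<Sum>(c, fs)\<leftarrow>ns. s c (\<phi> fs)) = - (\<Sum>(c, fs)\<leftarrow>us. s c (\<phi> fs))"
    unfolding ns_def by (induction us) (auto simp: s.scale_minus_left)
  ultimately show ?thesis by simp
qed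

lemma scaled_sum:
  "(\<Sum>(d, fs)\<leftarrow>map (\<lambda>(d, fs). (c * d, fs)) ts. fscale d (h fs)) =
     fscale c (\<Sum>(d, fs)\<leftarrow>ts. fscale d (h fs))"
  by (induction ts) (auto simp: fun_space.scale_right_distrib)

lemma free_lift_universal:
  fixes V :: "('v \<Rightarrow> 'k::field) set" and A :: "('y, 'k, 'r) alg_scheme"
  assumes V: "fun_space.subspace V" and A: "unital_algebra A"
    and g: "linear_on V fscale g" "g ` V \<subseteq> space A"
  shows "alg_hom (tensor_algebra V) A (free_lift V A g)"
    and "f \<in> V \<Longrightarrow> free_lift V A g (word [f]) = g f"
    and "\<lbrakk>alg_hom (tensor_algebra V) A L; \<And>f. f \<in> V \<Longrightarrow> L (word [f]) = g f;
          F \<in> space (tensor_algebra V)\<rbrakk> \<Longrightarrow> L F = free_lift V A g F"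
proof -
  define \<phi> where "\<phi> fs = foldr (\<lambda>f. mult A (g f)) fs (one A)" for fs
  have sp: "fun_space.subspace (space A)" and one: "one A \<in> space A"
    and cl: "\<And>a b. \<lbrakk>a \<in> space A; b \<in> space A\<rbrakk> \<Longrightarrow> mult A a b \<in> space A"
    and bil: "bilinear_on (space A) (space A) fscale (mult A)"
    and assoc: "\<And>a b c. \<lbrakk>a \<in> space A; b \<in> space A; c \<in> space A\<rbrakk>
      \<Longrightarrow> mult A (mult A a b) c = mult A a (mult A b c)"
    and unit: "\<And>a. a \<in> space A \<Longrightarrow> mult A (one A) a = a" "\<And>a. a \<in> space A \<Longrightarrow> mult A a (one A) = a"
    using A unfolding unital_algebra_def by blast+
  have gA: "g f \<in> space A" if "f \<in> V" for f using g(2) that by blast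
  have linL: "mult A a (b + b') = mult A a b + mult A a b'" "mult A (b + b') a = mult A b a + mult A b' a"
    "mult A a (fscale c b) = fscale c (mult A a b)" "mult A (fscale c b) a = fscale c (mult A b a)"
    if "a \<in> space A" "b \<in> space A" "b' \<in> space A" for a b b' c
    using bil that unfolding bilinear_on_def linear_on_def by blast+
  have \<phi>_in: "\<phi> fs \<in> space A" if "fs \<in> lists V" for fs
    using that by (induction fs) (auto simp: \<phi>_def one cl gA)
  have \<phi>_app: "\<phi> (fs @ gs) = mult A (\<phi> fs) (\<phi> gs)" if "fs \<in> lists V" "gs \<in> lists V" for fs gs
    using that
  proof (induction fs)
    case Nil
    then show ?case using unit \<phi>_in by (simp add: \<phi>_def[of "[]"])
  next
    case (Cons f fs)
    then have "mult A (mult A (g f) (\<phi> fs)) (\<phi> gs) = mult A (g f) (mult A (\<phi> fs) (\<phi> gs))"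
      by (intro assoc gA \<phi>_in) auto
    then show ?case using Cons by (simp add: \<phi>_def)
  qed
  have mult: "multilinear_on V fscale \<phi>"
    unfolding multilinear_on_def
  proof (intro ballI)
    fix us vs assume *: "us \<in> lists V" "vs \<in> lists V"
    have eq: "\<phi> (us @ f # vs) = mult A (\<phi> us) (mult A (g f) (\<phi> vs))" if "f \<in> V" for f
    proof -
      have "\<phi> (us @ f # vs) = mult A (\<phi> us) (\<phi> (f # vs))"
        using * that by (intro \<phi>_app) auto
      then show ?thesis by (simp add: \<phi>_def)
    qed
    show "linear_on V fscale (\<lambda>f. \<phi> (us @ f # vs))"
      unfolding linear_on_def
    proof (intro conjI ballI allI)
      fix a b assume ab: "a \<in> V" "b \<in> V"
      then have "g (a + b) = g a + g b" using g(1) by (simp add: linear_on_def)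
      then show "\<phi> (us @ (a + b) # vs) = \<phi> (us @ a # vs) + \<phi> (us @ b # vs)"
        using ab * fun_space.subspace_add[OF V ab] by (simp add: eq linL gA \<phi>_in cl)
    next
      fix c a assume a: "a \<in> V"
      then have "g (fscale c a) = fscale c (g a)" using g(1) by (simp add: linear_on_def)
      then show "\<phi> (us @ fscale c a # vs) = fscale c (\<phi> (us @ a # vs))"
        using a * fun_space.subspace_scale[OF V a] linL(3,4)[of _ _ 0] sp
        by (simp add: eq gA \<phi>_in cl fun_space.subspace_0)
    qed
  qed
  have lift: "free_lift V A g (\<Sum>(c, fs)\<leftarrow>ts. fscale c (word fs)) = (\<Sum>(c, fs)\<leftarrow>ts. fscale c (\<phi> fs))"
    if ts: "snd ` set ts \<subseteq> lists V" for ts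
    unfolding free_lift_def \<phi>_def[symmetric]
  proof (rule the_equality)
    show "\<exists>us. snd ` set us \<subseteq> lists V \<and>
      (\<Sum>(c, fs)\<leftarrow>ts. fscale c (word fs)) = (\<Sum>(c, fs)\<leftarrow>us. fscale c (word fs)) \<and>
      (\<Sum>(c, fs)\<leftarrow>ts. fscale c (\<phi> fs)) = (\<Sum>(c, fs)\<leftarrow>us. fscale c (\<phi> fs))"
      using ts by blast
  next
    fix G
    assume "\<exists>us. snd ` set us \<subseteq> lists V \<and>
      (\<Sum>(c, fs)\<leftarrow>ts. fscale c (word fs)) = (\<Sum>(c, fs)\<leftarrow>us. fscale c (word fs)) \<and>
      G = (\<Sum>(c, fs)\<leftarrow>us. fscale c (\<phi> fs))"
    then show "G = (\<Sum>(c, fs)\<leftarrow>ts. fscale c (\<phi> fs))"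
      using words_relation_eq[OF V fun_space.vector_space_axioms mult ts] by metis
  qed
  have rep: "\<exists>ts. snd ` set ts \<subseteq> lists V \<and> F = (\<Sum>(c, fs)\<leftarrow>ts. fscale c (word fs))"
    if "F \<in> space (tensor_algebra V)" for F
    using words_rep that by simp
  have lift_word: "free_lift V A g (word fs) = \<phi> fs" if "fs \<in> lists V" for fs
    using lift[of "[(1, fs)]"] that by simp
  have add: "free_lift V A g (F + G) = free_lift V A g F + free_lift V A g G"
    if FG: "F \<in> space (tensor_algebra V)" "G \<in> space (tensor_algebra V)" for F G
  proof -
    obtain ts us where *: "snd ` set ts \<subseteq> lists V" "F = (\<Sum>(c, fs)\<leftarrow>ts. fscale c (word fs))"
      "snd ` set us \<subseteq> lists V" "G = (\<Sum>(c, fs)\<leftarrow>us. fscale c (word fs))"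
      using rep FG by metis
    then show ?thesis using lift[of "ts @ us"] lift[of ts] lift[of us] by (simp add: image_Un)
  qed
  have scale: "free_lift V A g (fscale c F) = fscale c (free_lift V A g F)"
    if F: "F \<in> space (tensor_algebra V)" for c F
  proof -
    obtain ts where *: "snd ` set ts \<subseteq> lists V" "F = (\<Sum>(c, fs)\<leftarrow>ts. fscale c (word fs))"
      using rep F by metis
    define us where "us = map (\<lambda>(d, fs). (c * d, fs)) ts"
    have us: "snd ` set us \<subseteq> lists V" using *(1) by (force simp: us_def)
    show ?thesis using lift[OF us] lift[OF *(1)] unfolding *(2) us_def scaled_sum by simp
  qed
  have lin: "linear_on (space (tensor_algebra V)) fscale (free_lift V A g)"
    unfolding linear_on_def using add scale by blast
  have sub: "fun_space.subspace (space (tensor_algebra V))" by simp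
  have ind: "Q F" if "F \<in> space (tensor_algebra V)" "Q 0"
    "\<And>c fs G. \<lbrakk>fs \<in> lists V; G \<in> space (tensor_algebra V); Q G\<rbrakk> \<Longrightarrow> Q (fscale c (word fs) + G)" for Q F
  proof -
    have "F \<in> space (tensor_algebra V) \<and> Q F"
      using that(1) unfolding tensor_algebra_simps
    proof (induction rule: fun_space.span_induct_alt)
      case base
      then show ?case using that(2) by (simp add: fun_space.span_zero)
    next
      case (step c u v)
      then obtain fs where fs: "u = word fs" "fs \<in> lists V" by blast
      then have "u \<in> fun_space.span (word ` lists V)" by (simp add: fun_space.span_base)
      then show ?case using step that(3)[OF fs(2), of v c] fs
        by (simp add: fun_space.span_add fun_space.span_scale)
    qed
    then show ?thesis by simp
  qed
  have wordT: "word fs \<in> space (tensor_algebra V)" if "fs \<in> lists V" for fs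
    using that by (simp add: fun_space.span_base)
  have scT: "fscale c F \<in> space (tensor_algebra V)" if "F \<in> space (tensor_algebra V)" for c F
    using that by (simp add: fun_space.span_scale)
  have zero: "free_lift V A g 0 = 0" by (rule linear_on_zero[OF sub lin])
  have into: "free_lift V A g F \<in> space A" if "F \<in> space (tensor_algebra V)" for F
    using that
  proof (rule ind)
    show "free_lift V A g 0 \<in> space A" using zero fun_space.subspace_0[OF sp] by simp
  next
    fix c fs G assume "fs \<in> lists V" "G \<in> space (tensor_algebra V)" "free_lift V A g G \<in> space A"
    then show "free_lift V A g (fscale c (word fs) + G) \<in> space A"
      using add[OF scT[OF wordT]] scale[OF wordT] lift_word \<phi>_in
        fun_space.subspace_add[OF sp] fun_space.subspace_scale[OF sp] by metis
  qed
  have multw: "free_lift V A g (conc (word fs) G) = mult A (\<phi> fs) (free_lift V A g G)"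
    if fs: "fs \<in> lists V" and G: "G \<in> space (tensor_algebra V)" for fs G
    using G
  proof (rule ind)
    show "free_lift V A g (conc (word fs) 0) = mult A (\<phi> fs) (free_lift V A g 0)"
      using linear_on_zero[OF sp, of fscale "mult A (\<phi> fs)"] bil \<phi>_in[OF fs]
      by (simp add: conc_zero zero bilinear_on_def)
  next
    fix c gs H
    assume *: "gs \<in> lists V" "H \<in> space (tensor_algebra V)"
      "free_lift V A g (conc (word fs) H) = mult A (\<phi> fs) (free_lift V A g H)"
    have m: "conc (word fs) H \<in> space (tensor_algebra V)" "fs @ gs \<in> lists V"
      using conc_closed[of "word fs" V H] wordT[OF fs] *(1,2) fs by auto
    have "free_lift V A g (conc (word fs) (fscale c (word gs) + H))
        = fscale c (\<phi> (fs @ gs)) + mult A (\<phi> fs) (free_lift V A g H)"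
      using add[OF scT[OF wordT[OF m(2)]] m(1)] scale[OF wordT[OF m(2)]] lift_word[OF m(2)] *(3)
      by (simp add: conc_linear conc_word)
    also have "\<dots> = mult A (\<phi> fs) (fscale c (\<phi> gs) + free_lift V A g H)"
      using linL(1)[OF \<phi>_in[OF fs] fun_space.subspace_scale[OF sp \<phi>_in[OF *(1)]] into[OF *(2)]]
        linL(3)[OF \<phi>_in[OF fs] \<phi>_in[OF *(1)] one] \<phi>_app[OF fs *(1)] by simp
    also have "fscale c (\<phi> gs) + free_lift V A g H = free_lift V A g (fscale c (word gs) + H)"
      using add[OF scT[OF wordT[OF *(1)]] *(2)] scale[OF wordT[OF *(1)]] lift_word[OF *(1)] by simp
    finally show "free_lift V A g (conc (word fs) (fscale c (word gs) + H)) =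
      mult A (\<phi> fs) (free_lift V A g (fscale c (word gs) + H))" .
  qed
  have mul: "free_lift V A g (conc F G) = mult A (free_lift V A g F) (free_lift V A g G)"
    if F: "F \<in> space (tensor_algebra V)" and G: "G \<in> space (tensor_algebra V)" for F G
    using F
  proof (rule ind)
    show "free_lift V A g (conc 0 G) = mult A (free_lift V A g 0) (free_lift V A g G)"
      using linear_on_zero[OF sp, of fscale "\<lambda>a. mult A a (free_lift V A g G)"] bil into[OF G]
      by (simp add: conc_zero zero bilinear_on_def)
  next
    fix c gs H
    assume *: "gs \<in> lists V" "H \<in> space (tensor_algebra V)"
      "free_lift V A g (conc H G) = mult A (free_lift V A g H) (free_lift V A g G)"
    have m: "conc H G \<in> space (tensor_algebra V)" "conc (word gs) G \<in> space (tensor_algebra V)"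
      using conc_closed[of _ V G] wordT[OF *(1)] *(2) G by auto
    have "free_lift V A g (conc (fscale c (word gs) + H) G)
        = fscale c (mult A (\<phi> gs) (free_lift V A g G)) + mult A (free_lift V A g H) (free_lift V A g G)"
      using add[OF scT[OF m(2)] m(1)] scale[OF m(2)] multw[OF *(1) G] *(3)
      by (simp add: conc_linear)
    also have "\<dots> = mult A (fscale c (\<phi> gs) + free_lift V A g H) (free_lift V A g G)"
      using linL(2)[OF into[OF G] fun_space.subspace_scale[OF sp \<phi>_in[OF *(1)]] into[OF *(2)]]
        linL(4)[OF into[OF G] \<phi>_in[OF *(1)] one] by simp
    also have "fscale c (\<phi> gs) + free_lift V A g H = free_lift V A g (fscale c (word gs) + H)"
      using add[OF scT[OF wordT[OF *(1)]] *(2)] scale[OF wordT[OF *(1)]] lift_word[OF *(1)] by simp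
    finally show "free_lift V A g (conc (fscale c (word gs) + H) G) =
      mult A (free_lift V A g (fscale c (word gs) + H)) (free_lift V A g G)" .
  qed
  show hom: "alg_hom (tensor_algebra V) A (free_lift V A g)"
    unfolding alg_hom_def
    using lin into mul lift_word[of "[]"] by (auto simp: \<phi>_def)
  show "free_lift V A g (word [f]) = g f" if "f \<in> V"
    using lift_word[of "[f]"] that unit gA by (simp add: \<phi>_def)
  show "L F = free_lift V A g F"
    if L: "alg_hom (tensor_algebra V) A L" "\<And>f. f \<in> V \<Longrightarrow> L (word [f]) = g f"
      and F: "F \<in> space (tensor_algebra V)"
  proof -
    have Llin: "linear_on (space (tensor_algebra V)) fscale L" and L1: "L (word []) = one A"
      and Lm: "\<And>F G. \<lbrakk>F \<in> space (tensor_algebra V); G \<in> space (tensor_algebra V)\<rbrakk>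
        \<Longrightarrow> L (conc F G) = mult A (L F) (L G)"
      using L(1) unfolding alg_hom_def by auto
    have Lw: "L (word fs) = \<phi> fs" if "fs \<in> lists V" for fs
      using that
    proof (induction fs)
      case Nil
      then show ?case using L1 by (simp add: \<phi>_def)
    next
      case (Cons f fs)
      have "L (word (f # fs)) = L (conc (word [f]) (word fs))" by (simp add: conc_word)
      also have "\<dots> = mult A (L (word [f])) (L (word fs))" using Cons by (intro Lm wordT) auto
      finally show ?case using Cons L(2) by (simp add: \<phi>_def)
    qed
    show ?thesis using F
    proof (rule ind)
      show "L 0 = free_lift V A g 0" using linear_on_zero[OF sub Llin] zero by simp
    next
      fix c fs G
      assume *: "fs \<in> lists V" "G \<in> space (tensor_algebra V)" "L G = free_lift V A g G"
      show "L (fscale c (word fs) + G) = free_lift V A g (fscale c (word fs) + G)"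
        using Llin scT[OF wordT[OF *(1)]] wordT[OF *(1)] *(2,3) Lw[OF *(1)] lift_word[OF *(1)]
          add scale unfolding linear_on_def by metis
    qed
  qed
qed

lemma tensor_mem: "\<lbrakk>f \<in> V; g \<in> W\<rbrakk> \<Longrightarrow> tensor f g \<in> tensor_space V W"
  unfolding tensor_space_def by (rule fun_space.span_base) blast

lemma subspace_tensor_space: "fun_space.subspace (tensor_space V W)"
  by (simp add: tensor_space_def)

lemma tensor_linear:
  "tensor (f + f') g = tensor f g + tensor f' g" "tensor f (g + g') = tensor f g + tensor f g'"
  "tensor (fscale c f) g = fscale c (tensor f g)" "tensor f (fscale c g) = fscale c (tensor f g)"
  by (auto simp: tensor_def fun_ops algebra_simps)

lemma tensor_induct:
  assumes V: "fun_space.subspace V" and t: "t \<in> tensor_space V W" and "Q 0"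
    and "\<And>f g t. \<lbrakk>f \<in> V; g \<in> W; t \<in> tensor_space V W; Q t\<rbrakk> \<Longrightarrow> Q (tensor f g + t)"
  shows "Q t"
proof -
  obtain ts where ts: "set ts \<subseteq> V \<times> W" "t = (\<Sum>(f, g)\<leftarrow>ts. tensor f g)"
    using tensor_space_rep[OF V t] by blast
  have "(\<Sum>(f, g)\<leftarrow>ts. tensor f g) \<in> tensor_space V W \<and> Q (\<Sum>(f, g)\<leftarrow>ts. tensor f g)"
    using ts(1)
  proof (induction ts)
    case Nil
    then show ?case using assms(3) fun_space.subspace_0[OF subspace_tensor_space] by simp
  next
    case (Cons t ts)
    then show ?case
      using assms(4) by (cases t) (auto intro!: fun_space.subspace_add[OF subspace_tensor_space] tensor_mem)
  qed
  then show ?thesis using ts by simp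
qed

lemma unital_algebra_alg_tensor:
  fixes A :: "('x, 'k::field, 'r) alg_scheme" and B :: "('y, 'k, 's) alg_scheme"
  assumes "unital_algebra A" "unital_algebra B"
  shows "unital_algebra (alg_tensor A B)"
    and "\<lbrakk>a \<in> space A; b \<in> space B; a' \<in> space A; b' \<in> space B\<rbrakk> \<Longrightarrow>
      mult (alg_tensor A B) (tensor a b) (tensor a' b') = tensor (mult A a a') (mult B b b')"
proof -
  let ?W = "tensor_space (space A) (space B)"
  define M where "M = mult (alg_tensor A B)"
  define L where "L a b = tensor_lift (space A) (space B) (\<lambda>a' b'. tensor (mult A a a') (mult B b b'))" for a b
  have M: "M t u = tensor_lift (space A) (space B) (\<lambda>a b. L a b u) t" for t u
    by (simp add: M_def L_def alg_tensor_def)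
  have A: "fun_space.subspace (space A)" "one A \<in> space A"
    "\<And>a b. \<lbrakk>a \<in> space A; b \<in> space A\<rbrakk> \<Longrightarrow> mult A a b \<in> space A"
    "bilinear_on (space A) (space A) fscale (mult A)"
    "\<And>a b c. \<lbrakk>a \<in> space A; b \<in> space A; c \<in> space A\<rbrakk> \<Longrightarrow> mult A (mult A a b) c = mult A a (mult A b c)"
    "\<And>a. a \<in> space A \<Longrightarrow> mult A (one A) a = a" "\<And>a. a \<in> space A \<Longrightarrow> mult A a (one A) = a"
    using assms(1) unfolding unital_algebra_def by blast+
  have B: "fun_space.subspace (space B)" "one B \<in> space B"
    "\<And>a b. \<lbrakk>a \<in> space B; b \<in> space B\<rbrakk> \<Longrightarrow> mult B a b \<in> space B"
    "bilinear_on (space B) (space B) fscale (mult B)"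
    "\<And>a b c. \<lbrakk>a \<in> space B; b \<in> space B; c \<in> space B\<rbrakk> \<Longrightarrow> mult B (mult B a b) c = mult B a (mult B b c)"
    "\<And>a. a \<in> space B \<Longrightarrow> mult B (one B) a = a" "\<And>a. a \<in> space B \<Longrightarrow> mult B a (one B) = a"
    using assms(2) unfolding unital_algebra_def by blast+
  note vs = fun_space.vector_space_axioms
  have bil: "bilinear_on (space A) (space B) fscale (\<lambda>a' b'. tensor (mult A a a') (mult B b b'))"
    if "a \<in> space A" "b \<in> space B" for a b
    using A(4) B(4) that unfolding bilinear_on_def linear_on_def by (simp add: tensor_linear)
  note LU = tensor_lift_universal[OF A(1) B(1) vs bil, folded L_def]
  have L_pure: "L a b (tensor a' b') = tensor (mult A a a') (mult B b b')"
    if "a \<in> space A" "b \<in> space B" "a' \<in> space A" "b' \<in> space B" for a b a' b'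
    using LU(2) that by blast
  have L_lin: "linear_on ?W fscale (L a b)" if "a \<in> space A" "b \<in> space B" for a b
    using LU(1) that by blast
  have L_bil: "bilinear_on (space A) (space B) fscale (\<lambda>a b. L a b u)" if "u \<in> ?W" for u
  proof (rule tensor_induct[OF A(1) that])
    have "L a b 0 = 0" if "a \<in> space A" "b \<in> space B" for a b
      using linear_on_zero[OF subspace_tensor_space L_lin] that .
    then show "bilinear_on (space A) (space B) fscale (\<lambda>a b. L a b 0)"
      using A(1) B(1) unfolding bilinear_on_def linear_on_def
      by (simp add: fun_space.subspace_add fun_space.subspace_scale)
  next
    fix f g t
    assume *: "f \<in> space A" "g \<in> space B" "t \<in> ?W" "bilinear_on (space A) (space B) fscale (\<lambda>a b. L a b t)"
    have "L a b (tensor f g + t) = tensor (mult A a f) (mult B b g) + L a b t"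
      if "a \<in> space A" "b \<in> space B" for a b
      using L_lin[OF that] L_pure[OF that *(1,2)] tensor_mem[OF *(1,2)] *(3)
      unfolding linear_on_def by simp
    then show "bilinear_on (space A) (space B) fscale (\<lambda>a b. L a b (tensor f g + t))"
      using A(1,4) B(1,4) *(1,2,4) unfolding bilinear_on_def linear_on_def
      by (simp add: fun_space.subspace_add fun_space.subspace_scale tensor_linear
          fun_space.scale_right_distrib ac_simps)
  qed
  note MU = tensor_lift_universal[OF A(1) B(1) vs L_bil, folded M]
  have M_left: "linear_on ?W fscale (\<lambda>t. M t u)" if "u \<in> ?W" for u
    using MU(1)[OF that] by (simp add: M)
  have M_pure: "M (tensor a b) u = L a b u" if "u \<in> ?W" "a \<in> space A" "b \<in> space B" for u a b
    using MU(2) that by blast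
  have M_right: "linear_on ?W fscale (M t)" if "t \<in> ?W" for t
  proof (rule tensor_induct[OF A(1) that])
    have "M 0 u = 0" if "u \<in> ?W" for u
      using linear_on_zero[OF subspace_tensor_space M_left[OF that]] .
    then show "linear_on ?W fscale (M 0)"
      unfolding linear_on_def
      by (simp add: fun_space.subspace_add[OF subspace_tensor_space] fun_space.subspace_scale[OF subspace_tensor_space])
  next
    fix f g t
    assume *: "f \<in> space A" "g \<in> space B" "t \<in> ?W" "linear_on ?W fscale (M t)"
    have "M (tensor f g + t) u = L f g u + M t u" if "u \<in> ?W" for u
      using M_left[OF that] M_pure[OF that *(1,2)] tensor_mem[OF *(1,2)] *(3)
      unfolding linear_on_def by simp
    then show "linear_on ?W fscale (M (tensor f g + t))"
      using L_lin[OF *(1,2)] *(4) unfolding linear_on_def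
      by (simp add: fun_space.subspace_add[OF subspace_tensor_space] fun_space.subspace_scale[OF subspace_tensor_space]
          fun_space.scale_right_distrib ac_simps)
  qed
  have pure: "M (tensor a b) (tensor a' b') = tensor (mult A a a') (mult B b b')"
    if "a \<in> space A" "b \<in> space B" "a' \<in> space A" "b' \<in> space B" for a b a' b'
    using M_pure[OF tensor_mem] L_pure that by simp
  then show "mult (alg_tensor A B) (tensor a b) (tensor a' b') = tensor (mult A a a') (mult B b b')"
    if "a \<in> space A" "b \<in> space B" "a' \<in> space A" "b' \<in> space B"
    using that by (simp add: M_def)
  have M0: "M 0 u = 0" "M u 0 = 0" if "u \<in> ?W" for u
    using linear_on_zero[OF subspace_tensor_space M_left[OF that]]
      linear_on_zero[OF subspace_tensor_space M_right[OF that]] by auto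
  have Madd: "M (t + t') u = M t u + M t' u" "M u (t + t') = M u t + M u t'"
    if "t \<in> ?W" "t' \<in> ?W" "u \<in> ?W" for t t' u
    using M_left[OF that(3)] M_right[OF that(3)] that(1,2) unfolding linear_on_def by auto
  have cl: "M t u \<in> ?W" if t: "t \<in> ?W" and u: "u \<in> ?W" for t u
  proof (rule tensor_induct[OF A(1) t])
    show "M 0 u \<in> ?W" using M0 u fun_space.subspace_0[OF subspace_tensor_space] by simp
  next
    fix f g t
    assume *: "f \<in> space A" "g \<in> space B" "t \<in> ?W" "M t u \<in> ?W"
    have "M (tensor f g) u \<in> ?W"
    proof (rule tensor_induct[OF A(1) u])
      show "M (tensor f g) 0 \<in> ?W"
        using M0 tensor_mem[OF *(1,2)] fun_space.subspace_0[OF subspace_tensor_space] by simp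
    next
      fix f' g' u
      assume "f' \<in> space A" "g' \<in> space B" "u \<in> ?W" "M (tensor f g) u \<in> ?W"
      then show "M (tensor f g) (tensor f' g' + u) \<in> ?W"
        using *(1,2) by (simp add: Madd pure tensor_mem A(3) B(3)
            fun_space.subspace_add[OF subspace_tensor_space])
    qed
    then show "M (tensor f g + t) u \<in> ?W"
      using * u by (simp add: Madd tensor_mem fun_space.subspace_add[OF subspace_tensor_space])
  qed
  have assoc: "M (M t u) v = M t (M u v)" if t: "t \<in> ?W" and u: "u \<in> ?W" and v: "v \<in> ?W" for t u v
  proof (rule tensor_induct[OF A(1) t])
    show "M (M 0 u) v = M 0 (M u v)" using u v by (simp add: M0 cl)
  next
    fix f g t
    assume *: "f \<in> space A" "g \<in> space B" "t \<in> ?W" "M (M t u) v = M t (M u v)"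
    have "M (M (tensor f g) u) v = M (tensor f g) (M u v)"
    proof (rule tensor_induct[OF A(1) u])
      show "M (M (tensor f g) 0) v = M (tensor f g) (M 0 v)"
        using tensor_mem[OF *(1,2)] v by (simp add: M0)
    next
      fix f' g' u
      assume **: "f' \<in> space A" "g' \<in> space B" "u \<in> ?W" "M (M (tensor f g) u) v = M (tensor f g) (M u v)"
      have "M (M (tensor f g) (tensor f' g')) v = M (tensor f g) (M (tensor f' g') v)"
      proof (rule tensor_induct[OF A(1) v])
        show "M (M (tensor f g) (tensor f' g')) 0 = M (tensor f g) (M (tensor f' g') 0)"
          using * ** by (simp add: M0 cl tensor_mem)
      next
        fix f'' g'' v
        assume "f'' \<in> space A" "g'' \<in> space B" "v \<in> ?W"
          "M (M (tensor f g) (tensor f' g')) v = M (tensor f g) (M (tensor f' g') v)"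
        then show "M (M (tensor f g) (tensor f' g')) (tensor f'' g'' + v) =
          M (tensor f g) (M (tensor f' g') (tensor f'' g'' + v))"
          using * ** by (simp add: Madd cl tensor_mem pure A(3,5) B(3,5))
      qed
      then show "M (M (tensor f g) (tensor f' g' + u)) v = M (tensor f g) (M (tensor f' g' + u) v)"
        using * ** v by (simp add: Madd cl tensor_mem)
    qed
    then show "M (M (tensor f g + t) u) v = M (tensor f g + t) (M u v)"
      using * u v by (simp add: Madd cl tensor_mem)
  qed
  have one: "tensor (one A) (one B) \<in> ?W" using A(2) B(2) tensor_mem by blast
  have unit: "M (tensor (one A) (one B)) t = t \<and> M t (tensor (one A) (one B)) = t" if t: "t \<in> ?W" for t
  proof (rule tensor_induct[OF A(1) t])
    show "M (tensor (one A) (one B)) 0 = 0 \<and> M 0 (tensor (one A) (one B)) = 0"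
      using one by (simp add: M0)
  next
    fix f g t
    assume "f \<in> space A" "g \<in> space B" "t \<in> ?W"
      "M (tensor (one A) (one B)) t = t \<and> M t (tensor (one A) (one B)) = t"
    then show "M (tensor (one A) (one B)) (tensor f g + t) = tensor f g + t \<and>
      M (tensor f g + t) (tensor (one A) (one B)) = tensor f g + t"
      using one A(2,6,7) B(2,6,7) by (simp add: Madd tensor_mem pure)
  qed
  have "bilinear_on ?W ?W fscale M" using M_left M_right by (simp add: bilinear_on_def)
  then show "unital_algebra (alg_tensor A B)"
    unfolding unital_algebra_def M_def[symmetric]
    using subspace_tensor_space cl assoc one unit by (simp add: alg_tensor_def)
qed


section \<open>Operads\<close>

text \<open>
  Non-symmetric operads over \<open>'k\<close>.  The ambient type \<open>'v\<close> is the direct sum of all the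
  components.  Composition \<open>ocomp P p [q\<^sub>1, \<dots>, q\<^sub>n]\<close> of \<open>p\<close> in the \<open>n\<close>-th component with
  arbitrary \<open>q\<^sub>1, \<dots>, q\<^sub>n\<close> is the multilinear extension of the composition of homogeneous elements;
  nothing is said about \<open>ocomp\<close> outside this range.
\<close>

record ('k, 'v) operad_data =
  oscale :: "'k \<Rightarrow> 'v \<Rightarrow> 'v"
  component :: "nat \<Rightarrow> 'v set"
  ocomp :: "'v \<Rightarrow> 'v list \<Rightarrow> 'v"
  ounit :: 'v

definition homogeneous_parts ::
  "('k, 'v::ab_group_add) operad_data \<Rightarrow> 'v \<Rightarrow> (nat \<Rightarrow> 'v) \<Rightarrow> bool" where
  "homogeneous_parts P x c \<longleftrightarrow>
     finite {n. c n \<noteq> 0} \<and> (\<forall>n. c n \<in> component P n) \<and> x = (\<Sum>n | c n \<noteq> 0. c n)"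

definition part ::
  "('k, 'v::ab_group_add) operad_data \<Rightarrow> nat \<Rightarrow> 'v \<Rightarrow> 'v" where
  "part P n x = (THE c. homogeneous_parts P x c) n"

locale operad = vector_space "oscale P"
  for P :: "('k::field, 'v::ab_group_add) operad_data" +
  assumes subspace_component: "\<And>n. subspace (component P n)"
    and direct_sum: "\<And>x. \<exists>!c. homogeneous_parts P x c"
    and ounit_component: "ounit P \<in> component P 1"
    and ocomp_component:
      "\<lbrakk>p \<in> component P (length qs); list_all2 (\<lambda>q m. q \<in> component P m) qs ms\<rbrakk> \<Longrightarrow>
         ocomp P p qs \<in> component P (sum_list ms)"
    and ocomp_add_left:
      "\<lbrakk>p \<in> component P (length qs); p' \<in> component P (length qs)\<rbrakk> \<Longrightarrow>
         ocomp P (p + p') qs = ocomp P p qs + ocomp P p' qs"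
    and ocomp_scale_left:
      "p \<in> component P (length qs) \<Longrightarrow> ocomp P (oscale P c p) qs = oscale P c (ocomp P p qs)"
    and ocomp_add_right:
      "p \<in> component P (Suc (length qs + length rs)) \<Longrightarrow>
         ocomp P p (qs @ (x + y) # rs) = ocomp P p (qs @ x # rs) + ocomp P p (qs @ y # rs)"
    and ocomp_scale_right:
      "p \<in> component P (Suc (length qs + length rs)) \<Longrightarrow>
         ocomp P p (qs @ oscale P c x # rs) = oscale P c (ocomp P p (qs @ x # rs))"
    and ocomp_ounit_left: "ocomp P (ounit P) [q] = q"
    and ocomp_ounit_right: "p \<in> component P n \<Longrightarrow> ocomp P p (replicate n (ounit P)) = p"
    and ocomp_assoc:
      "\<lbrakk>p \<in> component P (length qs); list_all2 (\<lambda>q rs. q \<in> component P (length rs)) qs rss\<rbrakk> \<Longrightarrow>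
         ocomp P (ocomp P p qs) (concat rss) = ocomp P p (map2 (ocomp P) qs rss)"

definition finite_components :: "('k::field, 'v::ab_group_add) operad_data \<Rightarrow> bool" where
  "finite_components P \<longleftrightarrow>
     (\<forall>n. \<exists>B. finite B \<and> component P n = module.span (oscale P) B)"


subsection \<open>The graded dual\<close>

text \<open>
  The dual of the \<open>n\<close>-th component consists of the linear forms on the operad vanishing on the other
  components.
\<close>

definition dual_component ::
  "('k::field, 'v::ab_group_add) operad_data \<Rightarrow> nat \<Rightarrow> ('v \<Rightarrow> 'k) set" where
  "dual_component P n =
     {f. Vector_Spaces.linear (oscale P) (*) f \<and> (\<forall>m. m \<noteq> n \<longrightarrow> (\<forall>x\<in>component P m. f x = 0))}"

definition graded_dual ::
  "('k::field, 'v::ab_group_add) operad_data \<Rightarrow> ('v \<Rightarrow> 'k) set" where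
  "graded_dual P = fun_space.span (\<Union>n\<in>{1..}. dual_component P n)"

definition graded_dual_plus ::
  "('k::field, 'v::ab_group_add) operad_data \<Rightarrow> ('v \<Rightarrow> 'k) set" where
  "graded_dual_plus P = fun_space.span (\<Union>n\<in>{2..}. dual_component P n)"

abbreviation dual_algebra ::
  "('k::field, 'v::ab_group_add) operad_data \<Rightarrow> ('v list, 'k) alg" where
  "dual_algebra P \<equiv> tensor_algebra (graded_dual P)"


subsection \<open>The two coproducts\<close>

text \<open>
  For \<open>X = q\<close> and \<open>Y = q\<^sub>1 \<dots> q\<^sub>p\<close>, only the part of \<open>q\<close> in the \<open>p\<close>-th component contributes.
\<close>

definition coprod_star_gen ::
  "('k::field, 'v::ab_group_add) operad_data \<Rightarrow> ('v \<Rightarrow> 'k) \<Rightarrow> 'v list \<times> 'v list \<Rightarrow> 'k" where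
  "coprod_star_gen P f =
     (\<lambda>(X, Y). case X of [q] \<Rightarrow> f (ocomp P (part P (length Y) q) Y) | _ \<Rightarrow> 0)"

definition coprod_star ::
  "('k::field, 'v::ab_group_add) operad_data \<Rightarrow>
     ('v list \<Rightarrow> 'k) \<Rightarrow> 'v list \<times> 'v list \<Rightarrow> 'k" where
  "coprod_star P =
     free_lift (graded_dual P) (alg_tensor (dual_algebra P) (dual_algebra P)) (coprod_star_gen P)"

text \<open>
  The arguments of a composition of arity \<open>n\<close> having the letters of \<open>ys\<close>, in order, at the
  (0-based) positions in \<open>S\<close>, and the unit elsewhere.
\<close>

definition insert_at ::
  "('k, 'v) operad_data \<Rightarrow> nat \<Rightarrow> nat set \<Rightarrow> 'v list \<Rightarrow> 'v list" where
  "insert_at P n S ys =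
     map (\<lambda>i. if i \<in> S then ys ! card {j \<in> S. j < i} else ounit P) [0..<n]"

fun bracket ::
  "('k, 'v::ab_group_add) operad_data \<Rightarrow> 'v list \<Rightarrow> 'v list \<Rightarrow> 'v" where
  "bracket P [] Y = (case Y of [y] \<Rightarrow> y | _ \<Rightarrow> 0)"
| "bracket P [p] Y =
     (\<Sum>n | part P n p \<noteq> 0. \<Sum>S | S \<subseteq> {..<n} \<and> card S = length Y.
        ocomp P (part P n p) (insert_at P n S Y))"
| "bracket P (p # p' # X) Y = 0"

definition coprod_prime_gen ::
  "('k::field, 'v::ab_group_add) operad_data \<Rightarrow> ('v \<Rightarrow> 'k) \<Rightarrow> 'v list \<times> 'v list \<Rightarrow> 'k" where
  "coprod_prime_gen P f = (\<lambda>(X, Y). f (bracket P X Y))"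

definition coprod_prime ::
  "('k::field, 'v::ab_group_add) operad_data \<Rightarrow>
     ('v list \<Rightarrow> 'k) \<Rightarrow> 'v list \<times> 'v list \<Rightarrow> 'k" where
  "coprod_prime P =
     free_lift (graded_dual P) (alg_tensor (dual_algebra P) (dual_algebra P)) (coprod_prime_gen P)"

definition D_star ::
  "('k::field, 'v::ab_group_add) operad_data \<Rightarrow> ('v list, 'k) bialg" where
  "D_star P =
     \<lparr>space = space (dual_algebra P), mult = mult (dual_algebra P), one = one (dual_algebra P),
      coprod = coprod_star P\<rparr>"

definition D_prime ::
  "('k::field, 'v::ab_group_add) operad_data \<Rightarrow> ('v list, 'k) bialg" where
  "D_prime P =
     \<lparr>space = space (dual_algebra P), mult = mult (dual_algebra P), one = one (dual_algebra P),
      coprod = coprod_prime P\<rparr>"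


subsection \<open>The isomorphism\<close>

text \<open>
  Below \<open>f\<close> runs through the whole graded dual; \<open>counit0\<close> vanishes on \<open>graded_dual_plus\<close>
  (lemma \<open>counit0_graded_dual_plus\<close>).

  The sign depends on the direction.  If the operad is spanned by its unit and \<open>x\<close> is the linear
  form with value 1 at the unit, then \<open>x\<close> is grouplike in \<open>D_star\<close> and \<open>1 + x\<close> is grouplike in
  \<open>D_prime\<close>.  So \<open>f \<mapsto> f + counit0 f\<close> goes from \<open>D_star\<close> to \<open>D_prime\<close>, and
  \<open>f \<mapsto> f - counit0 f\<close> goes back.
\<close>

definition counit0 :: "('k::field, 'v::ab_group_add) operad_data \<Rightarrow> ('v \<Rightarrow> 'k) \<Rightarrow> 'k" where
  "counit0 P f = f (ounit P)"

definition Psi ::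
  "('k::field, 'v::ab_group_add) operad_data \<Rightarrow> ('v list \<Rightarrow> 'k) \<Rightarrow> 'v list \<Rightarrow> 'k" where
  "Psi P = free_lift (graded_dual P) (dual_algebra P)
     (\<lambda>f. word [f] + fscale (counit0 P f) (word []))"

definition Psi_inv ::
  "('k::field, 'v::ab_group_add) operad_data \<Rightarrow> ('v list \<Rightarrow> 'k) \<Rightarrow> 'v list \<Rightarrow> 'k" where
  "Psi_inv P = free_lift (graded_dual P) (dual_algebra P)
     (\<lambda>f. word [f] - fscale (counit0 P f) (word []))"

lemma subspace_graded_dual: "fun_space.subspace (graded_dual P)"
  by (simp add: graded_dual_def)

lemma word_single_linear:
  "word [f + g] = word [f] + word [g]" "word [fscale c f] = fscale c (word [f])"
proof -
  have "word [f + g] xs = (word [f] + word [g]) xs" "word [fscale c f] xs = fscale c (word [f]) xs" for xs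
    by (cases xs; cases "tl xs"; simp add: fun_ops algebra_simps)+
  then show "word [f + g] = word [f] + word [g]" "word [fscale c f] = fscale c (word [f])"
    by auto
qed

lemma shift_hom:
  assumes "fun_space.subspace V" "\<And>f g. e (f + g) = e f + e g" "\<And>c f. e (fscale c f) = c * e f"
  defines "g \<equiv> \<lambda>f. word [f] + fscale (e f) (word [])"
  shows "alg_hom (tensor_algebra V) (tensor_algebra V) (free_lift V (tensor_algebra V) g)"
    and "f \<in> V \<Longrightarrow> free_lift V (tensor_algebra V) g (word [f]) = word [f] + fscale (e f) (word [])"
proof -
  have lin: "linear_on V fscale g"
    unfolding linear_on_def g_def
    by (simp add: word_single_linear assms(2,3) fun_space.scale_left_distrib
        fun_space.scale_right_distrib ac_simps)
  have im: "g ` V \<subseteq> space (tensor_algebra V)"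
    unfolding g_def
    by (auto intro!: fun_space.span_add fun_space.span_scale intro: fun_space.span_base)
  note U = free_lift_universal[OF assms(1) unital_algebra_tensor_algebra lin im]
  show "alg_hom (tensor_algebra V) (tensor_algebra V) (free_lift V (tensor_algebra V) g)" by (rule U(1))
  show "f \<in> V \<Longrightarrow> free_lift V (tensor_algebra V) g (word [f]) = word [f] + fscale (e f) (word [])"
    using U(2) by (simp add: g_def)
qed

lemma Psi_generators:
  shows "alg_hom (dual_algebra P) (dual_algebra P) (Psi P)"
    and "f \<in> graded_dual P \<Longrightarrow> Psi P (word [f]) = word [f] + fscale (counit0 P f) (word [])"
  unfolding Psi_def
  by (rule shift_hom[OF subspace_graded_dual]; simp add: counit0_def fun_ops)+

lemma Psi_inv_generators:
  shows "alg_hom (dual_algebra P) (dual_algebra P) (Psi_inv P)"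
    and "f \<in> graded_dual P \<Longrightarrow> Psi_inv P (word [f]) = word [f] - fscale (counit0 P f) (word [])"
proof -
  have eq: "Psi_inv P = free_lift (graded_dual P) (dual_algebra P)
      (\<lambda>f. word [f] + fscale (- counit0 P f) (word []))"
    by (simp add: Psi_inv_def fun_space.scale_minus_left)
  show "alg_hom (dual_algebra P) (dual_algebra P) (Psi_inv P)"
    unfolding eq by (rule shift_hom[OF subspace_graded_dual]) (simp_all add: counit0_def fun_ops)
  have "f \<in> graded_dual P \<Longrightarrow> Psi_inv P (word [f]) = word [f] + fscale (- counit0 P f) (word [])"
    unfolding eq by (rule shift_hom[OF subspace_graded_dual]) (simp_all add: counit0_def fun_ops)
  then show "f \<in> graded_dual P \<Longrightarrow> Psi_inv P (word [f]) = word [f] - fscale (counit0 P f) (word [])"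
    by (simp add: fun_space.scale_minus_left)
qed

lemma (in operad) counit0_graded_dual_plus:
  assumes "f \<in> graded_dual_plus P"
  shows "counit0 P f = 0"
  using assms unfolding graded_dual_plus_def
proof (induction rule: fun_space.span_induct_alt)
  case base
  then show ?case by (simp add: counit0_def zero_fun_apply)
next
  case (step c g h)
  then obtain n where "n \<ge> 2" "g \<in> dual_component P n" by auto
  moreover have "1 \<noteq> n" using \<open>n \<ge> 2\<close> by simp
  ultimately have "g (ounit P) = 0" using ounit_component unfolding dual_component_def by blast
  then show ?case using step by (simp add: counit0_def fun_ops)
qed

lemma Psi_on_components:
  shows "f \<in> dual_component P 1 \<Longrightarrow> Psi P (word [f]) = word [f] + fscale (counit0 P f) (word [])"
    and "f \<in> dual_component P 1 \<Longrightarrow> Psi_inv P (word [f]) = word [f] - fscale (counit0 P f) (word [])"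
proof -
  assume "f \<in> dual_component P 1"
  then have "f \<in> graded_dual P"
    unfolding graded_dual_def by (intro fun_space.span_base) auto
  then show "Psi P (word [f]) = word [f] + fscale (counit0 P f) (word [])"
    "Psi_inv P (word [f]) = word [f] - fscale (counit0 P f) (word [])"
    using Psi_generators(2) Psi_inv_generators(2) by blast+
qed

lemma (in operad) Psi_on_graded_dual_plus:
  assumes "f \<in> graded_dual_plus P"
  shows "Psi P (word [f]) = word [f]" "Psi_inv P (word [f]) = word [f]"
proof -
  have "graded_dual_plus P \<subseteq> graded_dual P"
    unfolding graded_dual_plus_def graded_dual_def by (intro fun_space.span_mono UN_mono) auto
  then show "Psi P (word [f]) = word [f]" "Psi_inv P (word [f]) = word [f]"
    using assms Psi_generators(2)[of f P] Psi_inv_generators(2)[of f P] counit0_graded_dual_plus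
    by auto
qed

end

theory Submission
  imports Defs
begin

text \<open>
  An element of the tensor algebra is a function on words, so \<open>\<Delta>\<^sub>*\<close> has the closed form
  \<open>\<Delta>\<^sub>*(F)(x\<^sub>1 \<dots> x\<^sub>k, Y) = \<Sum> F(x\<^sub>1 \<circ> Y\<^sub>1 \<dots> x\<^sub>k \<circ> Y\<^sub>k)\<close>, summed over the factorizations
  \<open>Y = Y\<^sub>1 \<dots> Y\<^sub>k\<close>; its coassociativity is the associativity of the operad, checked on homogeneous
  words.  Dually, \<open>\<Psi>\<close> sends \<open>F\<close> to \<open>X \<mapsto> \<Sum> F(X')\<close>, where \<open>X'\<close> runs through the words obtained from
  \<open>X\<close> by inserting units.  As \<open>\<langle>-,-\<rangle>\<close> composes after such insertions, this gives
  \<open>(\<Psi> \<otimes> \<Psi>)(\<Delta>\<^sub>*(f)) = \<Delta>'\<^sub>*(f) + \<epsilon>\<^sub>0(f) 1 \<otimes> 1 = \<Delta>'\<^sub>*(\<Psi>(f))\<close> on generators, hence everywhere.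
  The counit is easy for \<open>\<Delta>'\<^sub>*\<close> (evaluation at the empty word) and coassociativity for \<open>\<Delta>\<^sub>*\<close>;
  each is carried over to the other side along \<open>\<Psi>\<close>.
\<close>

subsection \<open>Tensor products and tensor algebras\<close>

text \<open>A function on pairs of words need not be a finite sum of tensors, so the formulas for
  the two coproducts on generators do not by themselves land in the algebraic tensor product. For
  \<open>coprod_star_gen\<close> this is where the vanishing of arity 0 and the finite dimensions
  enter: a form on arity n sees at most n inputs, each of arity 1 to n, and there it expands along
  dual bases. For \<open>coprod_prime_gen\<close> there is no second argument of this kind: the
  comparison on generators exhibits it as an image under \<Psi> \<otimes> \<Psi> minus a multiple of
  1 \<otimes> 1. A fixed word has infinitely many extensions by units. Since a given F is sensitive
  to bounded lengths only, insertions are treated length by length and summed up to a bound that is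
  large enough.\<close>

lemma linear_on_add: "\<lbrakk>linear_on V s \<phi>; a \<in> V; b \<in> V\<rbrakk> \<Longrightarrow> \<phi> (a + b) = \<phi> a + \<phi> b"
  by (simp add: linear_on_def)

lemma linear_on_scale: "\<lbrakk>linear_on V s \<phi>; a \<in> V\<rbrakk> \<Longrightarrow> \<phi> (fscale c a) = s c (\<phi> a)"
  by (simp add: linear_on_def)

lemma tensor_zero [simp]: "tensor f 0 = 0"
  by (auto simp: tensor_def fun_ops)

lemma tensor_apply [simp]: "tensor f g (x, y) = f x * g y"
  by (simp add: tensor_def)

lemmas tensor_space_induct [consumes 2, case_names zero add] = tensor_induct

lemma tensor_space_linear_eq:
  assumes V: "fun_space.subspace V"
    and "linear_on (tensor_space V W) s \<phi>" "linear_on (tensor_space V W) s \<psi>"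
    and "\<And>f g. \<lbrakk>f \<in> V; g \<in> W\<rbrakk> \<Longrightarrow> \<phi> (tensor f g) = \<psi> (tensor f g)"
    and t: "t \<in> tensor_space V W"
  shows "\<phi> t = \<psi> t"
  using V t
proof (induction rule: tensor_space_induct)
  case zero
  then show ?case
    using linear_on_zero[OF subspace_tensor_space] assms(2,3) by metis
next
  case (add f g t)
  then show ?case
    using assms(2-4) by (simp add: linear_on_add tensor_mem)
qed

lemma tensor_map_linear:
  assumes "fun_space.subspace V" "fun_space.subspace W"
    and "linear_on V fscale \<phi>" "linear_on W fscale \<psi>"
  shows "linear_on (tensor_space V W) fscale (tensor_map V W \<phi> \<psi>)"
    and "\<lbrakk>f \<in> V; g \<in> W\<rbrakk> \<Longrightarrow> tensor_map V W \<phi> \<psi> (tensor f g) = tensor (\<phi> f) (\<psi> g)"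
proof -
  have bil: "bilinear_on V W fscale (\<lambda>f g. tensor (\<phi> f) (\<psi> g))"
    using assms(3,4) by (simp add: bilinear_on_def linear_on_def tensor_linear)
  note U = tensor_lift_universal[OF assms(1,2) fun_space.vector_space_axioms bil,
      folded tensor_map_def]
  show "linear_on (tensor_space V W) fscale (tensor_map V W \<phi> \<psi>)" by (rule U(1))
  show "\<lbrakk>f \<in> V; g \<in> W\<rbrakk> \<Longrightarrow> tensor_map V W \<phi> \<psi> (tensor f g) = tensor (\<phi> f) (\<psi> g)"
    by (rule U(2))
qed

lemma tensor_map_zero:
  assumes "fun_space.subspace V" "fun_space.subspace W"
    and "linear_on V fscale \<phi>" "linear_on W fscale \<psi>"
  shows "tensor_map V W \<phi> \<psi> 0 = 0"
  by (rule linear_on_zero[OF subspace_tensor_space tensor_map_linear(1)[OF assms]])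

lemma tensor_map_add_pure:
  assumes "fun_space.subspace V" "fun_space.subspace W"
    and "linear_on V fscale \<phi>" "linear_on W fscale \<psi>"
    and "f \<in> V" "g \<in> W" "t \<in> tensor_space V W"
  shows "tensor_map V W \<phi> \<psi> (tensor f g + t) = tensor (\<phi> f) (\<psi> g) + tensor_map V W \<phi> \<psi> t"
  using tensor_map_linear[OF assms(1-4)] assms(5-7) by (simp add: linear_on_add tensor_mem)

lemma tensor_map_closed:
  assumes "fun_space.subspace V" "fun_space.subspace W"
    and "linear_on V fscale \<phi>" "linear_on W fscale \<psi>" "\<phi> ` V \<subseteq> V'" "\<psi> ` W \<subseteq> W'"
    and t: "t \<in> tensor_space V W"
  shows "tensor_map V W \<phi> \<psi> t \<in> tensor_space V' W'"
  using assms(1) t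
proof (induction rule: tensor_space_induct)
  case zero
  then show ?case
    using tensor_map_zero[OF assms(1-4)] fun_space.subspace_0[OF subspace_tensor_space] by simp
next
  case (add f g t)
  then have "tensor (\<phi> f) (\<psi> g) \<in> tensor_space V' W'" using assms(5,6) by (intro tensor_mem) auto
  then show ?case
    using add tensor_map_add_pure[OF assms(1-4)] fun_space.subspace_add[OF subspace_tensor_space]
    by simp
qed

lemma linear_on_comp:
  assumes "linear_on V fscale \<phi>" "\<phi> ` V \<subseteq> W" "linear_on W s \<psi>"
  shows "linear_on V s (\<lambda>f. \<psi> (\<phi> f))"
  using assms by (auto simp: linear_on_def image_subset_iff)

lemma linear_on_id: "linear_on V fscale id"
  by (simp add: linear_on_def)

lemma tensor_map_comp:
  assumes "fun_space.subspace V" "fun_space.subspace W" "fun_space.subspace V'" "fun_space.subspace W'"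
    and "linear_on V fscale \<phi>" "linear_on W fscale \<psi>" "\<phi> ` V \<subseteq> V'" "\<psi> ` W \<subseteq> W'"
    and "linear_on V' fscale \<phi>'" "linear_on W' fscale \<psi>'"
    and t: "t \<in> tensor_space V W"
  shows "tensor_map V' W' \<phi>' \<psi>' (tensor_map V W \<phi> \<psi> t) =
    tensor_map V W (\<lambda>f. \<phi>' (\<phi> f)) (\<lambda>g. \<psi>' (\<psi> g)) t"
  using assms(1) _ _ _ t
proof (rule tensor_space_linear_eq)
  note c = linear_on_comp[OF assms(5,7,9)] linear_on_comp[OF assms(6,8,10)]
  note l = tensor_map_linear[OF assms(1,2,5,6)] tensor_map_linear[OF assms(3,4,9,10)]
    tensor_map_linear[OF assms(1,2) c]
  show "linear_on (tensor_space V W) fscale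
      (\<lambda>t. tensor_map V' W' \<phi>' \<psi>' (tensor_map V W \<phi> \<psi> t))"
    using tensor_map_closed[OF assms(1,2,5-8)] by (intro linear_on_comp[OF l(1) _ l(3)]) blast
  show "linear_on (tensor_space V W) fscale
      (tensor_map V W (\<lambda>f. \<phi>' (\<phi> f)) (\<lambda>g. \<psi>' (\<psi> g)))"
    by (rule l(5))
  fix f g assume "f \<in> V" "g \<in> W"
  then show "tensor_map V' W' \<phi>' \<psi>' (tensor_map V W \<phi> \<psi> (tensor f g)) =
      tensor_map V W (\<lambda>f. \<phi>' (\<phi> f)) (\<lambda>g. \<psi>' (\<psi> g)) (tensor f g)"
    using l assms(7,8) by (simp add: image_subset_iff)
qed

lemma tensor_map_cong:
  assumes "fun_space.subspace V" "fun_space.subspace W"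
    and "linear_on V fscale \<phi>" "linear_on W fscale \<psi>"
    and "\<And>f. f \<in> V \<Longrightarrow> \<phi>' f = \<phi> f" "\<And>g. g \<in> W \<Longrightarrow> \<psi>' g = \<psi> g"
    and t: "t \<in> tensor_space V W"
  shows "tensor_map V W \<phi>' \<psi>' t = tensor_map V W \<phi> \<psi> t"
proof -
  have "linear_on V fscale \<phi>'" "linear_on W fscale \<psi>'"
    using assms(1-6) by (auto simp: linear_on_def fun_space.subspace_add fun_space.subspace_scale)
  note l = tensor_map_linear[OF assms(1-4)] tensor_map_linear[OF assms(1,2) this]
  show ?thesis
    using assms(1) l(3,1) _ t by (rule tensor_space_linear_eq) (simp add: l assms(5,6))
qed

lemma tensor_map_id:
  assumes "fun_space.subspace V" "fun_space.subspace W" "t \<in> tensor_space V W"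
  shows "tensor_map V W id id t = t"
proof -
  note l = tensor_map_linear[OF assms(1,2) linear_on_id linear_on_id]
  have "tensor_map V W id id t = id t"
    using assms(1) l(1) linear_on_id _ assms(3) by (rule tensor_space_linear_eq) (simp add: l)
  then show ?thesis by simp
qed

text \<open>The two bracketings of a triple tensor product are functions on differently nested
  pairs, so the associator is a change of indices and the equality has to be pointwise. It serves to
  compare both sides of coassociativity after a map has been applied to all three factors.\<close>

lemma tensor_map_assoc:
  fixes U :: "('a \<Rightarrow> 'k::field) set" and V :: "('b \<Rightarrow> 'k) set" and W :: "('c \<Rightarrow> 'k) set"
    and \<phi> :: "('a \<Rightarrow> 'k) \<Rightarrow> ('a' \<Rightarrow> 'k)" and \<psi> :: "('b \<Rightarrow> 'k) \<Rightarrow> ('b' \<Rightarrow> 'k)"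
    and \<chi> :: "('c \<Rightarrow> 'k) \<Rightarrow> ('c' \<Rightarrow> 'k)"
  assumes "fun_space.subspace U" "fun_space.subspace V" "fun_space.subspace W"
    and "linear_on U fscale \<phi>" "linear_on V fscale \<psi>" "linear_on W fscale \<chi>"
    and s: "s \<in> tensor_space U (tensor_space V W)"
    and eq: "\<And>x y z. t ((x, y), z) = s (x, (y, z))"
  shows "tensor_map (tensor_space U V) W (tensor_map U V \<phi> \<psi>) \<chi> t ((x, y), z) =
    tensor_map U (tensor_space V W) \<phi> (tensor_map V W \<psi> \<chi>) s (x, (y, z))"
proof -
  define \<alpha> :: "('a \<times> ('b \<times> 'c) \<Rightarrow> 'k) \<Rightarrow> ('a \<times> 'b) \<times> 'c \<Rightarrow> 'k"
    where "\<alpha> s = (\<lambda>((x, y), z). s (x, (y, z)))" for s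
  define \<alpha>' :: "('a' \<times> ('b' \<times> 'c') \<Rightarrow> 'k) \<Rightarrow> ('a' \<times> 'b') \<times> 'c' \<Rightarrow> 'k"
    where "\<alpha>' s = (\<lambda>((x, y), z). s (x, (y, z)))" for s
  have \<alpha>: "\<alpha> 0 = 0" "\<alpha> (a + b) = \<alpha> a + \<alpha> b" "\<alpha> (tensor f (tensor g h)) = tensor (tensor f g) h"
    for a b f g h by (auto simp: \<alpha>_def fun_ops)
  have \<alpha>': "\<alpha>' 0 = 0" "\<alpha>' (a + b) = \<alpha>' a + \<alpha>' b" "\<alpha>' (tensor f (tensor g h)) = tensor (tensor f g) h"
    for a b f g h by (auto simp: \<alpha>'_def fun_ops)
  let ?L = "tensor_map (tensor_space U V) W (tensor_map U V \<phi> \<psi>) \<chi>"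
  let ?R = "tensor_map U (tensor_space V W) \<phi> (tensor_map V W \<psi> \<chi>)"
  note uv = tensor_map_linear[OF assms(1,2,4,5)] and vw = tensor_map_linear[OF assms(2,3,5,6)]
  note lL = subspace_tensor_space[of U V] assms(3) uv(1) assms(6)
  note lR = assms(1) subspace_tensor_space[of V W] assms(4) vw(1)
  \<comment> \<open>Membership travels along with the equation, because \<open>?L\<close> is
    additive only on its tensor space.\<close>
  let ?Q = "\<lambda>s. \<alpha> s \<in> tensor_space (tensor_space U V) W \<and> ?L (\<alpha> s) = \<alpha>' (?R s)"
  have "?Q s"
    using assms(1) s
  proof (induction rule: tensor_space_induct)
    case zero
    then show ?case
      by (simp add: \<alpha> \<alpha>' tensor_map_zero[OF lL] tensor_map_zero[OF lR]
          fun_space.subspace_0[OF subspace_tensor_space])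
  next
    case (add f u s)
    \<comment> \<open>The right factor \<open>u\<close> is itself a sum of tensors, hence a second
      induction with \<open>f\<close> fixed.\<close>
    have "?Q (tensor f u)"
      using assms(2) add(2)
    proof (induction rule: tensor_space_induct)
      case zero
      then show ?case
        by (simp add: \<alpha> \<alpha>' tensor_map_zero[OF lL] tensor_map_zero[OF lR]
            fun_space.subspace_0[OF subspace_tensor_space])
    next
      case (add g h u)
      note m = tensor_mem[OF \<open>f \<in> U\<close> tensor_mem[OF add(1,2)]] tensor_mem[OF \<open>f \<in> U\<close> add(3)]
      have p: "tensor (tensor f g) h \<in> tensor_space (tensor_space U V) W"
        by (intro tensor_mem \<open>f \<in> U\<close> add)
      have q: "tensor f (tensor g h + u) = tensor f (tensor g h) + tensor f u"
        by (simp add: tensor_linear)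
      have "?L (\<alpha> (tensor f (tensor g h + u))) = tensor (tensor (\<phi> f) (\<psi> g)) (\<chi> h) + ?L (\<alpha> (tensor f u))"
        unfolding q \<alpha> using add \<open>f \<in> U\<close> uv(2) tensor_map_add_pure[OF lL]
        by (simp add: tensor_mem)
      moreover have "?R (tensor f (tensor g h + u)) = tensor (\<phi> f) (tensor (\<psi> g) (\<chi> h)) + ?R (tensor f u)"
        unfolding q using add \<open>f \<in> U\<close> vw(2) m tensor_map_add_pure[OF lR]
        by (simp add: tensor_mem)
      ultimately show ?case
        using add(4) p unfolding q
        by (simp add: \<alpha> \<alpha>' fun_space.subspace_add[OF subspace_tensor_space])
    qed
    moreover have "?L (\<alpha> (tensor f u) + \<alpha> s) = ?L (\<alpha> (tensor f u)) + ?L (\<alpha> s)"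
      using calculation add by (intro linear_on_add[OF tensor_map_linear(1)[OF lL]]) auto
    moreover have "?R (tensor f u + s) = ?R (tensor f u) + ?R s"
      using add by (intro linear_on_add[OF tensor_map_linear(1)[OF lR]] tensor_mem) auto
    ultimately show ?case
      using add by (simp add: \<alpha> \<alpha>' fun_space.subspace_add[OF subspace_tensor_space])
  qed
  moreover have "t = \<alpha> s" using eq by (auto simp: \<alpha>_def)
  ultimately show ?thesis by (simp add: \<alpha>'_def)
qed


section \<open>Algebra morphisms between tensor products\<close>

lemma unital_algebraD:
  assumes "unital_algebra A"
  shows "fun_space.subspace (space A)" "one A \<in> space A"
    "\<lbrakk>a \<in> space A; b \<in> space A\<rbrakk> \<Longrightarrow> mult A a b \<in> space A"
    "a \<in> space A \<Longrightarrow> linear_on (space A) fscale (mult A a)"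
    "b \<in> space A \<Longrightarrow> linear_on (space A) fscale (\<lambda>a. mult A a b)"
  using assms by (simp_all add: unital_algebra_def bilinear_on_def)

lemma alg_homD:
  assumes "alg_hom A B \<phi>"
  shows "linear_on (space A) fscale \<phi>" "\<phi> ` space A \<subseteq> space B"
    "a \<in> space A \<Longrightarrow> \<phi> a \<in> space B" "\<phi> (one A) = one B"
    "\<lbrakk>a \<in> space A; b \<in> space A\<rbrakk> \<Longrightarrow> \<phi> (mult A a b) = mult B (\<phi> a) (\<phi> b)"
  using assms by (auto simp: alg_hom_def)

lemma alg_hom_comp:
  assumes "alg_hom A B \<phi>" "alg_hom B C \<psi>"
  shows "alg_hom A C (\<lambda>a. \<psi> (\<phi> a))"
proof -
  note \<phi> = alg_homD[OF assms(1)] and \<psi> = alg_homD[OF assms(2)]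
  show ?thesis
    unfolding alg_hom_def using linear_on_comp[OF \<phi>(1,2) \<psi>(1)] \<phi>(3-) \<psi>(3-) by auto
qed

lemma alg_tensor_simps [simp]:
  "space (alg_tensor A B) = tensor_space (space A) (space B)"
  "one (alg_tensor A B) = tensor (one A) (one B)"
  by (simp_all add: alg_tensor_def)

text \<open>Multiplicativity compares two bilinear maps, so it can be tested on pure tensors, one
  argument at a time.\<close>

lemma alg_hom_tensor_map:
  assumes A: "unital_algebra A" "unital_algebra B" "unital_algebra A'" "unital_algebra B'"
    and \<phi>: "alg_hom A A' \<phi>" and \<psi>: "alg_hom B B' \<psi>"
  shows "alg_hom (alg_tensor A B) (alg_tensor A' B') (tensor_map (space A) (space B) \<phi> \<psi>)"
proof -
  let ?M = "tensor_map (space A) (space B) \<phi> \<psi>"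
  let ?W = "tensor_space (space A) (space B)"
  note sub = unital_algebraD(1)[OF A(1)] unital_algebraD(1)[OF A(2)]
  note lin = alg_homD(1)[OF \<phi>] alg_homD(1)[OF \<psi>]
  note M = tensor_map_linear[OF sub lin]
  note cl = tensor_map_closed[OF sub lin alg_homD(2)[OF \<phi>] alg_homD(2)[OF \<psi>]]
  note UT = unital_algebra_alg_tensor[OF A(1,2)] and UT' = unital_algebra_alg_tensor[OF A(3,4)]
  note D = unital_algebraD[OF UT(1), simplified] and D' = unital_algebraD[OF UT'(1), simplified]
  have im: "?M ` ?W \<subseteq> tensor_space (space A') (space B')" using cl by blast
  have mul: "?M (mult (alg_tensor A B) t u) = mult (alg_tensor A' B') (?M t) (?M u)"
    if t: "t \<in> ?W" and u: "u \<in> ?W" for t u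
  proof -
    have pure: "?M (mult (alg_tensor A B) (tensor a b) u) = mult (alg_tensor A' B') (?M (tensor a b)) (?M u)"
      if ab: "a \<in> space A" "b \<in> space B" for a b
      using sub(1) _ _ _ u
    proof (rule tensor_space_linear_eq)
      show "linear_on ?W fscale (\<lambda>u. ?M (mult (alg_tensor A B) (tensor a b) u))"
        using D(3,4) ab by (intro linear_on_comp[OF _ _ M(1)]) (auto simp: tensor_mem)
      show "linear_on ?W fscale (\<lambda>u. mult (alg_tensor A' B') (?M (tensor a b)) (?M u))"
        using D'(4) ab cl by (intro linear_on_comp[OF M(1) im]) (auto simp: tensor_mem)
      fix a' b' assume "a' \<in> space A" "b' \<in> space B"
      then show "?M (mult (alg_tensor A B) (tensor a b) (tensor a' b')) =
        mult (alg_tensor A' B') (?M (tensor a b)) (?M (tensor a' b'))"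
        using ab unital_algebraD(3)[OF A(1)] unital_algebraD(3)[OF A(2)]
          alg_homD[OF \<phi>] alg_homD[OF \<psi>]
        by (simp add: UT(2) UT'(2) M(2))
    qed
    show ?thesis
      using sub(1) _ _ pure t
    proof (rule tensor_space_linear_eq)
      show "linear_on ?W fscale (\<lambda>t. ?M (mult (alg_tensor A B) t u))"
        using D(3,5) u by (intro linear_on_comp[OF _ _ M(1)]) auto
      show "linear_on ?W fscale (\<lambda>t. mult (alg_tensor A' B') (?M t) (?M u))"
        using D'(5)[OF cl[OF u]] by (intro linear_on_comp[OF M(1) im])
    qed
  qed
  show ?thesis
    unfolding alg_hom_def using M(1) im mul unital_algebraD(2)[OF A(1)] unital_algebraD(2)[OF A(2)]
      alg_homD(4)[OF \<phi>] alg_homD(4)[OF \<psi>] by (simp add: M(2))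
qed

section \<open>Maps out of the tensor algebra\<close>

lemma word_mem: "fs \<in> lists V \<Longrightarrow> word fs \<in> space (tensor_algebra V)"
  by (simp add: fun_space.span_base)

lemma span_words_induct [consumes 1, case_names zero step]:
  assumes "F \<in> space (tensor_algebra V)" and "Q 0"
    and "\<And>c fs G. \<lbrakk>fs \<in> lists V; G \<in> space (tensor_algebra V); Q G\<rbrakk> \<Longrightarrow> Q (fscale c (word fs) + G)"
  shows "Q F"
proof -
  have "F \<in> space (tensor_algebra V) \<and> Q F"
    using assms(1) unfolding tensor_algebra_simps
  proof (induction rule: fun_space.span_induct_alt)
    case base
    then show ?case using assms(2) by (simp add: fun_space.span_zero)
  next
    case (step c u v)
    then obtain fs where fs: "u = word fs" "fs \<in> lists V" by blast
    then have "u \<in> fun_space.span (word ` lists V)" by (simp add: fun_space.span_base)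
    then show ?case using step assms(3)[OF fs(2), of v c] fs
      by (simp add: fun_space.span_add fun_space.span_scale)
  qed
  then show ?thesis by simp
qed

lemma tensor_algebra_linear_eq:
  assumes "linear_on (space (tensor_algebra V)) s \<phi>" "linear_on (space (tensor_algebra V)) s \<psi>"
    and "\<And>fs. fs \<in> lists V \<Longrightarrow> \<phi> (word fs) = \<psi> (word fs)"
    and "F \<in> space (tensor_algebra V)"
  shows "\<phi> F = \<psi> F"
  using assms(4)
proof (induction rule: span_words_induct)
  case zero
  have "fun_space.subspace (space (tensor_algebra V))" by simp
  then show ?case using linear_on_zero assms(1,2) by metis
next
  case (step c fs G)
  have "fscale c (word fs) \<in> space (tensor_algebra V)"
    using word_mem[OF step(1)] by (simp add: fun_space.span_scale)
  then show ?case
    using step assms(1-3) word_mem[OF step(1)]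
    by (simp add: linear_on_add linear_on_scale del: tensor_algebra_simps)
qed

lemma alg_hom_word_Cons:
  assumes "alg_hom (tensor_algebra V) A \<phi>" "f \<in> V" "fs \<in> lists V"
  shows "\<phi> (word (f # fs)) = mult A (\<phi> (word [f])) (\<phi> (word fs))"
proof -
  have "\<phi> (mult (tensor_algebra V) (word [f]) (word fs)) = mult A (\<phi> (word [f])) (\<phi> (word fs))"
    using assms(2,3) by (intro alg_homD(5)[OF assms(1)] word_mem) auto
  then show ?thesis by (simp add: conc_word)
qed

lemma tensor_algebra_hom_eq:
  assumes "alg_hom (tensor_algebra V) A \<phi>" "alg_hom (tensor_algebra V) A \<psi>"
    and "\<And>f. f \<in> V \<Longrightarrow> \<phi> (word [f]) = \<psi> (word [f])"
    and "F \<in> space (tensor_algebra V)"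
  shows "\<phi> F = \<psi> F"
  using alg_homD(1)[OF assms(1)] alg_homD(1)[OF assms(2)] _ assms(4)
proof (rule tensor_algebra_linear_eq)
  fix fs assume "fs \<in> lists V"
  then show "\<phi> (word fs) = \<psi> (word fs)"
  proof (induction fs)
    case Nil
    then show ?case using alg_homD(4)[OF assms(1)] alg_homD(4)[OF assms(2)] by simp
  next
    case (Cons f fs)
    then have "f \<in> V" "fs \<in> lists V" "\<phi> (word fs) = \<psi> (word fs)" by auto
    then show ?case
      unfolding alg_hom_word_Cons[OF assms(1) \<open>f \<in> V\<close> \<open>fs \<in> lists V\<close>]
        alg_hom_word_Cons[OF assms(2) \<open>f \<in> V\<close> \<open>fs \<in> lists V\<close>]
      using assms(3) by metis
  qed
qed

text \<open>A one-letter word on the left can only consume the first letter, so a single term of the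
  convolution survives. This turns products of generators into recursions on words.\<close>

lemma conc_Cons:
  "conc (word [f]) F [] = 0" "conc (word [f]) F (x # xs) = f x * F xs"
proof -
  show "conc (word [f]) F [] = 0" by (simp add: conc_def)
  have "conc (word [f]) F (x # xs) = (\<Sum>i\<le>length xs. if i = 0 then f x * F xs else 0)"
  proof -
    have "(\<Sum>i\<le>length xs. word [f] (take (Suc i) (x # xs)) * F (drop (Suc i) (x # xs)))
        = (\<Sum>i\<le>length xs. if i = 0 then f x * F xs else 0)"
      by (intro sum.cong) (auto simp: word_def)
    then show ?thesis unfolding conc_def length_Cons sum.atMost_Suc_shift by simp
  qed
  then show "conc (word [f]) F (x # xs) = f x * F xs" by simp
qed

text \<open>The product is defined by two nested lifts, which cannot be evaluated directly. On pure
  tensors it cuts each of the two words once, and bilinearity extends this. Coproducts of products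
  are evaluated through this formula.\<close>

lemma mult_alg_tensor_apply:
  fixes V :: "('x \<Rightarrow> 'k::field) set"
  defines "A \<equiv> tensor_algebra V"
  assumes t: "t \<in> space (alg_tensor A A)" and u: "u \<in> space (alg_tensor A A)"
  shows "mult (alg_tensor A A) t u (X, Y) =
    (\<Sum>i\<le>length X. \<Sum>j\<le>length Y. t (take i X, take j Y) * u (drop i X, drop j Y))"
proof -
  define C where "C t u = (\<lambda>(X, Y).
    \<Sum>i\<le>length X. \<Sum>j\<le>length Y. t (take i X, take j Y) * u (drop i X, drop j Y))"
    for t u :: "'x list \<times> 'x list \<Rightarrow> 'k"
  have UA: "unital_algebra A" unfolding A_def by (rule unital_algebra_tensor_algebra)
  note UT = unital_algebra_alg_tensor[OF UA UA]
  note sub = unital_algebraD(1)[OF UA]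
  let ?W = "tensor_space (space A) (space A)"
  have lin: "linear_on ?W fscale (C t)" "linear_on ?W fscale (\<lambda>t. C t u)" for t u
    by (auto simp: linear_on_def C_def fun_ops sum_distrib_left sum.distrib distrib_left distrib_right
        ac_simps)
  have t: "t \<in> ?W" and u: "u \<in> ?W" using t u by simp_all
  have pure: "mult (alg_tensor A A) (tensor a b) u = C (tensor a b) u" if "a \<in> space A" "b \<in> space A" for a b
    using sub _ lin(1) _ u
  proof (rule tensor_space_linear_eq)
    show "linear_on ?W fscale (mult (alg_tensor A A) (tensor a b))"
      using unital_algebraD(4)[OF UT(1)] that by (simp add: tensor_mem)
    fix a' b' assume "a' \<in> space A" "b' \<in> space A"
    then have "mult (alg_tensor A A) (tensor a b) (tensor a' b') = tensor (conc a a') (conc b b')"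
      using UT(2) that by (simp add: A_def)
    also have "\<dots> = C (tensor a b) (tensor a' b')"
      by (auto simp: C_def conc_def fun_ops sum_product ac_simps)
    finally show "mult (alg_tensor A A) (tensor a b) (tensor a' b') = C (tensor a b) (tensor a' b')" .
  qed
  have "mult (alg_tensor A A) t u = C t u"
    using sub _ lin(2) pure t
  proof (rule tensor_space_linear_eq)
    show "linear_on ?W fscale (\<lambda>t. mult (alg_tensor A A) t u)"
      using unital_algebraD(5)[OF UT(1)] u by simp
  qed
  then show ?thesis by (simp add: C_def)
qed

subsection \<open>Transport of bialgebra structures\<close>

lemma counit_lift:
  assumes V: "fun_space.subspace V" and \<epsilon>: "linear_on V (*) \<epsilon>"
  shows "linear_on (tensor_space V V) fscale (tensor_lift V V (\<lambda>b c. fscale (\<epsilon> b) c))"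
    and "linear_on (tensor_space V V) fscale (tensor_lift V V (\<lambda>b c. fscale (\<epsilon> c) b))"
    and "\<lbrakk>f \<in> V; g \<in> V\<rbrakk> \<Longrightarrow> tensor_lift V V (\<lambda>b c. fscale (\<epsilon> b) c) (tensor f g) = fscale (\<epsilon> f) g"
    and "\<lbrakk>f \<in> V; g \<in> V\<rbrakk> \<Longrightarrow> tensor_lift V V (\<lambda>b c. fscale (\<epsilon> c) b) (tensor f g) = fscale (\<epsilon> g) f"
proof -
  have "bilinear_on V V fscale (\<lambda>b c. fscale (\<epsilon> b) c)" "bilinear_on V V fscale (\<lambda>b c. fscale (\<epsilon> c) b)"
    using \<epsilon> by (auto simp: bilinear_on_def linear_on_def fun_ops algebra_simps)
  note U = tensor_lift_universal[OF V V fun_space.vector_space_axioms this(1)]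
    tensor_lift_universal[OF V V fun_space.vector_space_axioms this(2)]
  show "linear_on (tensor_space V V) fscale (tensor_lift V V (\<lambda>b c. fscale (\<epsilon> b) c))"
    "linear_on (tensor_space V V) fscale (tensor_lift V V (\<lambda>b c. fscale (\<epsilon> c) b))"
    "\<lbrakk>f \<in> V; g \<in> V\<rbrakk> \<Longrightarrow> tensor_lift V V (\<lambda>b c. fscale (\<epsilon> b) c) (tensor f g) = fscale (\<epsilon> f) g"
    "\<lbrakk>f \<in> V; g \<in> V\<rbrakk> \<Longrightarrow> tensor_lift V V (\<lambda>b c. fscale (\<epsilon> c) b) (tensor f g) = fscale (\<epsilon> g) f"
    by (rule U(1), rule U(4), rule U(2), assumption+, rule U(5))
qed

lemma counit_lift_closed:
  assumes V: "fun_space.subspace V" and \<epsilon>: "linear_on V (*) \<epsilon>" and t: "t \<in> tensor_space V V"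
  shows "tensor_lift V V (\<lambda>b c. fscale (\<epsilon> b) c) t \<in> V" "tensor_lift V V (\<lambda>b c. fscale (\<epsilon> c) b) t \<in> V"
proof -
  note L = counit_lift[OF V \<epsilon>]
  have "tensor_lift V V (\<lambda>b c. fscale (\<epsilon> b) c) t \<in> V \<and> tensor_lift V V (\<lambda>b c. fscale (\<epsilon> c) b) t \<in> V"
    using V t
  proof (induction rule: tensor_space_induct)
    case zero
    then show ?case
      using linear_on_zero[OF subspace_tensor_space L(1)] linear_on_zero[OF subspace_tensor_space L(2)]
        fun_space.subspace_0[OF V] by simp
  next
    case (add f g t)
    then show ?case
      using V by (simp add: linear_on_add[OF L(1)] linear_on_add[OF L(2)] L(3,4) tensor_mem
          fun_space.subspace_add fun_space.subspace_scale)
  qed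
  then show "tensor_lift V V (\<lambda>b c. fscale (\<epsilon> b) c) t \<in> V" "tensor_lift V V (\<lambda>b c. fscale (\<epsilon> c) b) t \<in> V"
    by auto
qed

text \<open>Apply \<open>\<epsilon>\<close> to the left leg and \<open>\<eta>\<close> to the right
  leg of the coproduct of \<open>a\<close>: contracting the left leg first gives
  \<open>\<eta> a\<close>, the right leg first gives \<open>\<epsilon> a\<close>. As
  \<open>bialgebra_hom\<close> quantifies over all counits, this reduces its last clause to one
  choice of them.\<close>

lemma is_counit_unique:
  assumes B: "fun_space.subspace (space B)" and \<Delta>: "\<And>a. a \<in> space B \<Longrightarrow> coprod B a \<in> tensor_space (space B) (space B)"
    and \<epsilon>: "is_counit B \<epsilon>" and \<eta>: "is_counit B \<eta>" and a: "a \<in> space B"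
  shows "\<epsilon> a = \<eta> a"
proof -
  let ?V = "space B"
  have lin: "linear_on ?V (*) \<epsilon>" "linear_on ?V (*) \<eta>" using \<epsilon> \<eta> by (auto simp: is_counit_def)
  note E = counit_lift[OF B lin(1)] counit_lift_closed[OF B lin(1)]
  note H = counit_lift[OF B lin(2)] counit_lift_closed[OF B lin(2)]
  have "\<eta> (tensor_lift ?V ?V (\<lambda>b c. fscale (\<epsilon> b) c) (coprod B a)) =
    \<epsilon> (tensor_lift ?V ?V (\<lambda>b c. fscale (\<eta> c) b) (coprod B a))"
    using B _ _ _ \<Delta>[OF a]
  proof (rule tensor_space_linear_eq)
    show "linear_on (tensor_space ?V ?V) (*) (\<lambda>t. \<eta> (tensor_lift ?V ?V (\<lambda>b c. fscale (\<epsilon> b) c) t))"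
      by (rule linear_on_comp[OF E(1) _ lin(2)]) (use E(5) in blast)
    show "linear_on (tensor_space ?V ?V) (*) (\<lambda>t. \<epsilon> (tensor_lift ?V ?V (\<lambda>b c. fscale (\<eta> c) b) t))"
      by (rule linear_on_comp[OF H(2) _ lin(1)]) (use H(6) in blast)
    fix f g assume "f \<in> ?V" "g \<in> ?V"
    then show "\<eta> (tensor_lift ?V ?V (\<lambda>b c. fscale (\<epsilon> b) c) (tensor f g)) =
      \<epsilon> (tensor_lift ?V ?V (\<lambda>b c. fscale (\<eta> c) b) (tensor f g))"
      using linear_on_scale[OF lin(1)] linear_on_scale[OF lin(2)] by (simp add: E(3) H(4))
  qed
  then show ?thesis using \<epsilon> \<eta> a by (simp add: is_counit_def)
qed

text \<open>Coassociativity of \<open>B\<close> at \<open>\<phi> a\<close> is the threefold tensor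
  power of \<open>\<phi>\<close> applied to that of \<open>A\<close>. The counit law of
  \<open>A\<close> for \<open>\<epsilon>\<close> after \<open>\<phi>\<close> is checked behind the
  injective map \<open>\<phi>\<close>. Compatibility of \<open>\<psi>\<close> with the coproducts is
  then formal.\<close>

lemma bialgebra_iso_transport:
  fixes A :: "('x, 'k::field, 'r) bialg_scheme" and B :: "('y, 'k, 's) bialg_scheme"
  assumes A: "unital_algebra A" and B: "unital_algebra B"
    and \<phi>: "alg_hom A B \<phi>" and \<psi>: "alg_hom B A \<psi>"
    and \<psi>\<phi>: "\<And>a. a \<in> space A \<Longrightarrow> \<psi> (\<phi> a) = a" and \<phi>\<psi>: "\<And>b. b \<in> space B \<Longrightarrow> \<phi> (\<psi> b) = b"
    and \<Delta>A: "alg_hom A (alg_tensor A A) (coprod A)" and \<Delta>B: "alg_hom B (alg_tensor B B) (coprod B)"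
    and \<Delta>: "\<And>a. a \<in> space A \<Longrightarrow> coprod B (\<phi> a) = tensor_map (space A) (space A) \<phi> \<phi> (coprod A a)"
    and coassoc: "\<And>a x y z. a \<in> space A \<Longrightarrow>
      tensor_map (space A) (space A) (coprod A) id (coprod A a) ((x, y), z) =
      tensor_map (space A) (space A) id (coprod A) (coprod A a) (x, (y, z))"
    and \<epsilon>: "is_counit B \<epsilon>"
  shows "bialgebra_iso A B \<phi>" "bialgebra_iso B A \<psi>"
proof -
  let ?A = "space A" and ?B = "space B"
  let ?AA = "tensor_space ?A ?A" and ?BB = "tensor_space ?B ?B"
  let ?\<phi>\<phi> = "tensor_map ?A ?A \<phi> \<phi>"
  note sA = unital_algebraD(1)[OF A] and sB = unital_algebraD(1)[OF B]
  note h\<phi> = alg_homD[OF \<phi>] and h\<psi> = alg_homD[OF \<psi>]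
  note hA = alg_homD[OF \<Delta>A, simplified] and hB = alg_homD[OF \<Delta>B, simplified]
  note sAA = subspace_tensor_space[of ?A ?A]
  have \<psi>B: "\<And>b. b \<in> ?B \<Longrightarrow> \<psi> b \<in> ?A" using h\<psi>(3) .
  have l\<phi>\<phi>: "linear_on ?AA fscale ?\<phi>\<phi>" by (rule tensor_map_linear(1)[OF sA sA h\<phi>(1) h\<phi>(1)])
  have coassocB: "tensor_map ?B ?B (coprod B) id (coprod B b) ((x, y), z) =
      tensor_map ?B ?B id (coprod B) (coprod B b) (x, (y, z))" if b: "b \<in> ?B" for b x y z
  proof -
    define a where "a = \<psi> b"
    have a: "a \<in> ?A" and ba: "b = \<phi> a" using b by (auto simp: a_def \<psi>B \<phi>\<psi>)
    note t = hA(3)[OF a]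
    have i1: "id ` ?A \<subseteq> ?A" by simp
    \<comment> \<open>Functoriality in both directions: \<open>cB1\<close> and \<open>cB2\<close>
      merge \<open>\<phi> \<otimes> \<phi>\<close> with the coproduct of \<open>B\<close>, while
      \<open>cA1\<close> and \<open>cA2\<close>, read backwards, split off the coproduct of
      \<open>A\<close>.\<close>
    note cB1 = tensor_map_comp[OF sA sA sB sB h\<phi>(1,1,2,2) hB(1) linear_on_id t]
      and cB2 = tensor_map_comp[OF sA sA sB sB h\<phi>(1,1,2,2) linear_on_id hB(1) t]
      and cA1 = tensor_map_comp[OF sA sA sAA sA hA(1) linear_on_id hA(2) i1 l\<phi>\<phi> h\<phi>(1) t]
      and cA2 = tensor_map_comp[OF sA sA sA sAA linear_on_id hA(1) i1 hA(2) h\<phi>(1) l\<phi>\<phi> t]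
    note lc = linear_on_comp[OF hA(1,2) l\<phi>\<phi>]
    have "tensor_map ?B ?B (coprod B) id (coprod B b) = tensor_map ?A ?A (\<lambda>f. coprod B (\<phi> f)) \<phi> (coprod A a)"
      using cB1 by (simp add: ba \<Delta>[OF a])
    also have "\<dots> = tensor_map ?A ?A (\<lambda>f. ?\<phi>\<phi> (coprod A f)) \<phi> (coprod A a)"
      by (rule tensor_map_cong[OF sA sA lc h\<phi>(1) \<Delta> refl t])
    also have "\<dots> = tensor_map ?AA ?A ?\<phi>\<phi> \<phi> (tensor_map ?A ?A (coprod A) id (coprod A a))"
      using cA1 by simp
    finally have L: "tensor_map ?B ?B (coprod B) id (coprod B b) =
      tensor_map ?AA ?A ?\<phi>\<phi> \<phi> (tensor_map ?A ?A (coprod A) id (coprod A a))" .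
    have "tensor_map ?B ?B id (coprod B) (coprod B b) = tensor_map ?A ?A \<phi> (\<lambda>f. coprod B (\<phi> f)) (coprod A a)"
      using cB2 by (simp add: ba \<Delta>[OF a])
    also have "\<dots> = tensor_map ?A ?A \<phi> (\<lambda>f. ?\<phi>\<phi> (coprod A f)) (coprod A a)"
      by (rule tensor_map_cong[OF sA sA h\<phi>(1) lc refl \<Delta> t])
    also have "\<dots> = tensor_map ?A ?AA \<phi> ?\<phi>\<phi> (tensor_map ?A ?A id (coprod A) (coprod A a))"
      using cA2 by simp
    finally have R: "tensor_map ?B ?B id (coprod B) (coprod B b) =
      tensor_map ?A ?AA \<phi> ?\<phi>\<phi> (tensor_map ?A ?A id (coprod A) (coprod A a))" .
    have "tensor_map ?A ?A id (coprod A) (coprod A a) \<in> tensor_space ?A ?AA"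
      by (rule tensor_map_closed[OF sA sA linear_on_id hA(1) i1 hA(2) t])
    then show ?thesis
      unfolding L R by (rule tensor_map_assoc[OF sA sA sA h\<phi>(1,1,1)]) (rule coassoc[OF a])
  qed
  have \<epsilon>D: "linear_on ?B (*) \<epsilon>" "\<epsilon> (one B) = 1"
    "\<And>a b. \<lbrakk>a \<in> ?B; b \<in> ?B\<rbrakk> \<Longrightarrow> \<epsilon> (mult B a b) = \<epsilon> a * \<epsilon> b"
    "\<And>b. b \<in> ?B \<Longrightarrow> tensor_lift ?B ?B (\<lambda>b c. fscale (\<epsilon> b) c) (coprod B b) = b"
    "\<And>b. b \<in> ?B \<Longrightarrow> tensor_lift ?B ?B (\<lambda>b c. fscale (\<epsilon> c) b) (coprod B b) = b"
    using \<epsilon> unfolding is_counit_def by blast+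
  have counit: "is_counit A (\<lambda>a. \<epsilon> (\<phi> a))"
    unfolding is_counit_def
  proof (intro conjI ballI)
    show lin: "linear_on ?A (*) (\<lambda>a. \<epsilon> (\<phi> a))" by (rule linear_on_comp[OF h\<phi>(1,2) \<epsilon>D(1)])
    show "\<epsilon> (\<phi> (one A)) = 1" using h\<phi>(4) \<epsilon>D(2) by simp
    show "\<epsilon> (\<phi> (mult A a b)) = \<epsilon> (\<phi> a) * \<epsilon> (\<phi> b)" if "a \<in> ?A" "b \<in> ?A" for a b
      using that h\<phi>(3,5) \<epsilon>D(3) by simp
    note LA = counit_lift[OF sA lin] counit_lift_closed[OF sA lin]
    note LB = counit_lift[OF sB \<epsilon>D(1)]
    note cl = tensor_map_closed[OF sA sA h\<phi>(1,1,2,2)]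
    have im: "?\<phi>\<phi> ` ?AA \<subseteq> ?BB" using cl by blast
    fix a assume a: "a \<in> ?A"
    have "\<phi> (tensor_lift ?A ?A (\<lambda>b c. fscale (\<epsilon> (\<phi> b)) c) (coprod A a)) =
      tensor_lift ?B ?B (\<lambda>b c. fscale (\<epsilon> b) c) (?\<phi>\<phi> (coprod A a))"
      using sA _ _ _ hA(3)[OF a]
    proof (rule tensor_space_linear_eq)
      show "linear_on ?AA fscale (\<lambda>t. \<phi> (tensor_lift ?A ?A (\<lambda>b c. fscale (\<epsilon> (\<phi> b)) c) t))"
        by (rule linear_on_comp[OF LA(1) _ h\<phi>(1)]) (use LA(5) in blast)
      show "linear_on ?AA fscale (\<lambda>t. tensor_lift ?B ?B (\<lambda>b c. fscale (\<epsilon> b) c) (?\<phi>\<phi> t))"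
        by (rule linear_on_comp[OF l\<phi>\<phi> im LB(1)])
      fix f g assume "f \<in> ?A" "g \<in> ?A"
      then show "\<phi> (tensor_lift ?A ?A (\<lambda>b c. fscale (\<epsilon> (\<phi> b)) c) (tensor f g)) =
        tensor_lift ?B ?B (\<lambda>b c. fscale (\<epsilon> b) c) (?\<phi>\<phi> (tensor f g))"
        using h\<phi>(3) by (simp add: LA(3) LB(3) tensor_map_linear(2)[OF sA sA h\<phi>(1,1)] linear_on_scale[OF h\<phi>(1)])
    qed
    then have "\<phi> (tensor_lift ?A ?A (\<lambda>b c. fscale (\<epsilon> (\<phi> b)) c) (coprod A a)) = \<phi> a"
      using \<Delta>[OF a] \<epsilon>D(4)[OF h\<phi>(3)[OF a]] by simp
    \<comment> \<open>Only the equality after \<open>\<phi>\<close> is known; \<open>\<psi>\<close>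
      cancels it because the contraction stays in \<open>space A\<close>.\<close>
    then show "tensor_lift ?A ?A (\<lambda>b c. fscale (\<epsilon> (\<phi> b)) c) (coprod A a) = a"
      using \<psi>\<phi> LA(5)[OF hA(3)[OF a]] a by metis
    have "\<phi> (tensor_lift ?A ?A (\<lambda>b c. fscale (\<epsilon> (\<phi> c)) b) (coprod A a)) =
      tensor_lift ?B ?B (\<lambda>b c. fscale (\<epsilon> c) b) (?\<phi>\<phi> (coprod A a))"
      using sA _ _ _ hA(3)[OF a]
    proof (rule tensor_space_linear_eq)
      show "linear_on ?AA fscale (\<lambda>t. \<phi> (tensor_lift ?A ?A (\<lambda>b c. fscale (\<epsilon> (\<phi> c)) b) t))"
        by (rule linear_on_comp[OF LA(2) _ h\<phi>(1)]) (use LA(6) in blast)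
      show "linear_on ?AA fscale (\<lambda>t. tensor_lift ?B ?B (\<lambda>b c. fscale (\<epsilon> c) b) (?\<phi>\<phi> t))"
        by (rule linear_on_comp[OF l\<phi>\<phi> im LB(2)])
      fix f g assume "f \<in> ?A" "g \<in> ?A"
      then show "\<phi> (tensor_lift ?A ?A (\<lambda>b c. fscale (\<epsilon> (\<phi> c)) b) (tensor f g)) =
        tensor_lift ?B ?B (\<lambda>b c. fscale (\<epsilon> c) b) (?\<phi>\<phi> (tensor f g))"
        using h\<phi>(3) by (simp add: LA(4) LB(4) tensor_map_linear(2)[OF sA sA h\<phi>(1,1)] linear_on_scale[OF h\<phi>(1)])
    qed
    then have "\<phi> (tensor_lift ?A ?A (\<lambda>b c. fscale (\<epsilon> (\<phi> c)) b) (coprod A a)) = \<phi> a"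
      using \<Delta>[OF a] \<epsilon>D(5)[OF h\<phi>(3)[OF a]] by simp
    then show "tensor_lift ?A ?A (\<lambda>b c. fscale (\<epsilon> (\<phi> c)) b) (coprod A a) = a"
      using \<psi>\<phi> LA(6)[OF hA(3)[OF a]] a by metis
  qed
  have bA: "bialgebra A" unfolding bialgebra_def using A \<Delta>A coassoc counit by blast
  have bB: "bialgebra B" unfolding bialgebra_def using B \<Delta>B coassocB \<epsilon> by blast
  have uA: "\<eta> a = \<epsilon> (\<phi> a)" if "is_counit A \<eta>" "a \<in> ?A" for \<eta> a
    using is_counit_unique[OF sA hA(3) that(1) counit that(2)] by simp
  have uB: "\<eta> b = \<epsilon> b" if "is_counit B \<eta>" "b \<in> ?B" for \<eta> b
    using is_counit_unique[OF sB hB(3) that(1) \<epsilon> that(2)] by simp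
  \<comment> \<open>Take the compatibility of \<open>\<phi>\<close> at \<open>\<psi> b\<close> and
    cancel \<open>\<psi>\<close> against \<open>\<phi>\<close> in both legs.\<close>
  have \<Delta>': "coprod A (\<psi> b) = tensor_map ?B ?B \<psi> \<psi> (coprod B b)" if b: "b \<in> ?B" for b
  proof -
    note a = \<psi>B[OF b]
    have "tensor_map ?B ?B \<psi> \<psi> (coprod B b) = tensor_map ?B ?B \<psi> \<psi> (?\<phi>\<phi> (coprod A (\<psi> b)))"
      using \<Delta>[OF a] b by (simp add: \<phi>\<psi>)
    also have "\<dots> = tensor_map ?A ?A (\<lambda>a. \<psi> (\<phi> a)) (\<lambda>a. \<psi> (\<phi> a)) (coprod A (\<psi> b))"
      by (rule tensor_map_comp[OF sA sA sB sB h\<phi>(1,1,2,2) h\<psi>(1,1) hA(3)[OF a]])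
    also have "\<dots> = tensor_map ?A ?A id id (coprod A (\<psi> b))"
      using \<psi>\<phi> by (intro tensor_map_cong[OF sA sA linear_on_id linear_on_id _ _ hA(3)[OF a]]) simp_all
    finally show ?thesis using tensor_map_id[OF sA sA hA(3)[OF a]] by simp
  qed
  have "bij_betw \<phi> ?A ?B"
    by (rule bij_betw_byWitness[where f' = \<psi>]) (use \<psi>\<phi> \<phi>\<psi> h\<phi>(2) h\<psi>(2) in auto)
  moreover have "bij_betw \<psi> ?B ?A"
    by (rule bij_betw_byWitness[where f' = \<phi>]) (use \<psi>\<phi> \<phi>\<psi> h\<phi>(2) h\<psi>(2) in auto)
  moreover have "\<eta>' (\<phi> a) = \<eta> a" if "is_counit A \<eta>" "is_counit B \<eta>'" "a \<in> ?A" for \<eta> \<eta>' a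
    using uA[OF that(1,3)] uB[OF that(2) h\<phi>(3)[OF that(3)]] by simp
  moreover have "\<eta> (\<psi> b) = \<eta>' b" if "is_counit A \<eta>" "is_counit B \<eta>'" "b \<in> ?B" for \<eta> \<eta>' b
    using uA[OF that(1) \<psi>B[OF that(3)]] uB[OF that(2,3)] \<phi>\<psi>[OF that(3)] by simp
  ultimately show "bialgebra_iso A B \<phi>" "bialgebra_iso B A \<psi>"
    unfolding bialgebra_iso_def bialgebra_hom_def using bA bB \<phi> \<psi> \<Delta> \<Delta>' by blast+
qed

subsection \<open>Iterated operadic composition\<close>

text \<open>Unlike \<open>Vector_Spaces.linear\<close>, this carries no vector space assumptions, so
  the calculus of forms is available outside the locale.\<close>

definition linear_form :: "('k::field, 'v::ab_group_add) operad_data \<Rightarrow> ('v \<Rightarrow> 'k) \<Rightarrow> bool" where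
  "linear_form P f \<longleftrightarrow> (\<forall>x y. f (x + y) = f x + f y) \<and> (\<forall>c x. f (oscale P c x) = c * f x)"

text \<open>Peeling off the first letter matches the recursion of \<open>word\<close> and of the
  sums over factorizations. Values of \<open>M\<close> on words of length other than
  \<open>n\<close> are unconstrained.\<close>

primrec multilinear_form ::
  "('k::field, 'v::ab_group_add) operad_data \<Rightarrow> nat \<Rightarrow> ('v list \<Rightarrow> 'k) \<Rightarrow> bool" where
  "multilinear_form P 0 M \<longleftrightarrow> True"
| "multilinear_form P (Suc n) M \<longleftrightarrow>
     (\<forall>W. length W = n \<longrightarrow> linear_form P (\<lambda>x. M (x # W))) \<and>
     (\<forall>x. multilinear_form P n (\<lambda>W. M (x # W)))"

abbreviation homogeneous :: "('k, 'v) operad_data \<Rightarrow> 'v list \<Rightarrow> nat list \<Rightarrow> bool" where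
  "homogeneous P \<equiv> list_all2 (\<lambda>q m. q \<in> component P m)"

lemma linear_formD:
  assumes "linear_form P f"
  shows "f (x + y) = f x + f y" "f (oscale P c x) = c * f x"
  using assms by (auto simp: linear_form_def)

lemma linear_form_0:
  assumes "linear_form P f"
  shows "f 0 = 0"
  using linear_formD(1)[OF assms, of 0 0] by (metis add_cancel_right_right)

lemma linear_form_sum:
  assumes "linear_form P f"
  shows "f (sum h A) = (\<Sum>i\<in>A. f (h i))"
  by (induction A rule: infinite_finite_induct)
    (simp_all add: linear_form_0[OF assms] linear_formD[OF assms])

lemma multilinear_form_zero:
  assumes "multilinear_form P (length W) M" "0 \<in> set W"
  shows "M W = 0"
  using assms
proof (induction W arbitrary: M)
  case (Cons x W)
  show ?case
  proof (cases "x = 0")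
    case True
    then show ?thesis using Cons.prems linear_form_0[of P "\<lambda>x. M (x # W)"] by simp
  next
    case False
    then show ?thesis using Cons.prems Cons.IH[of "\<lambda>W. M (x # W)"] by simp
  qed
qed simp

lemma multilinear_form_map:
  assumes "multilinear_form P n M"
    and "\<And>x y. L (x + y) = L x + L y" "\<And>c x. L (oscale P c x) = oscale P c (L x)"
  shows "multilinear_form P n (\<lambda>W. M (map L W))"
  using assms(1)
proof (induction n arbitrary: M)
  case (Suc n)
  have "multilinear_form P n (\<lambda>W. M (L x # map L W))" for x
    by (rule Suc.IH[of "\<lambda>W. M (L x # W)"]) (use Suc.prems in auto)
  then show ?case using Suc.prems by (auto simp: linear_form_def assms(2,3))
qed simp

text \<open>The length \<open>n\<close> is arbitrary because \<open>word fs\<close> is zero on words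
  of any length other than that of \<open>fs\<close>; coassociativity evaluates it at lengths
  unrelated to \<open>fs\<close>.\<close>

lemma multilinear_form_word:
  assumes "\<forall>f\<in>set fs. linear_form P f"
  shows "multilinear_form P n (word fs)"
  using assms
proof (induction n arbitrary: fs)
  case (Suc n)
  have scale: "multilinear_form P n (\<lambda>W. c * word gs W)" if "\<forall>f\<in>set gs. linear_form P f" for c gs
  proof -
    have "multilinear_form P m (\<lambda>W. c * M W)" if "multilinear_form P m M" for m M
      using that
    proof (induction m arbitrary: M)
      case (Suc m)
      then show ?case by (auto simp: linear_form_def algebra_simps)
    qed simp
    then show ?thesis using Suc.IH[OF that] by blast
  qed
  show ?case
  proof (cases fs)
    case Nil
    have "multilinear_form P m (\<lambda>W. 0)" for m
      by (induction m) (auto simp: linear_form_def)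
    then show ?thesis using Nil by (simp add: linear_form_def)
  next
    case (Cons f gs)
    then show ?thesis using Suc.prems scale[of gs] by (auto simp: linear_form_def algebra_simps)
  qed
qed simp

lemma linear_form_graded_dual:
  assumes "f \<in> graded_dual P"
  shows "linear_form P f"
  using assms unfolding graded_dual_def
proof (induction rule: fun_space.span_induct_alt)
  case base
  then show ?case by (simp add: linear_form_def zero_fun_apply)
next
  case (step c g h)
  then obtain n where "g \<in> dual_component P n" by blast
  then have "Vector_Spaces.linear (oscale P) (*) g" by (simp add: dual_component_def)
  then have "linear_form P g" by (simp add: Vector_Spaces.linear_iff linear_form_def)
  then show ?case
    using step.IH by (simp add: linear_form_def fun_ops algebra_simps)
qed

section \<open>Grafting a word onto a word\<close>

definition graft ::
  "('k::field, 'v::ab_group_add) operad_data \<Rightarrow> 'v \<Rightarrow> 'v list \<Rightarrow> 'v" where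
  "graft P x Y = ocomp P (part P (length Y) x) Y"

text \<open>
  The sum of \<open>F (x\<^sub>1 \<circ> Y\<^sub>1 \<dots> x\<^sub>k \<circ> Y\<^sub>k)\<close> over all factorizations \<open>Y = Y\<^sub>1 \<dots> Y\<^sub>k\<close>,
  where \<open>X = x\<^sub>1 \<dots> x\<^sub>k\<close>.
\<close>

primrec graft_sum ::
  "('k::field, 'v::ab_group_add) operad_data \<Rightarrow> 'v list \<Rightarrow> 'v list \<Rightarrow> ('v list \<Rightarrow> 'k) \<Rightarrow> 'k" where
  "graft_sum P [] Y F = (if Y = [] then F [] else 0)"
| "graft_sum P (x # X) Y F =
     (\<Sum>j\<le>length Y. graft_sum P X (drop j Y) (\<lambda>W. F (graft P x (take j Y) # W)))"

lemma graft_sum_cong: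
  assumes "\<And>W. length W = length X \<Longrightarrow> F W = G W"
  shows "graft_sum P X Y F = graft_sum P X Y G"
  using assms
proof (induction X arbitrary: Y F G)
  case (Cons x X)
  then show ?case
    unfolding graft_sum.simps by (intro sum.cong refl Cons.IH) simp
qed simp

lemma graft_sum_add:
  "graft_sum P X Y (\<lambda>W. F W + G W) = graft_sum P X Y F + graft_sum P X Y G"
  by (induction X arbitrary: Y F G) (simp_all add: sum.distrib)

lemma graft_sum_mult:
  "graft_sum P X Y (\<lambda>W. c * F W) = c * graft_sum P X Y F"
  "graft_sum P X Y (\<lambda>W. F W * c) = graft_sum P X Y F * c"
proof -
  show "graft_sum P X Y (\<lambda>W. c * F W) = c * graft_sum P X Y F"
    by (induction X arbitrary: Y F) (simp_all add: sum_distrib_left)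
  then show "graft_sum P X Y (\<lambda>W. F W * c) = graft_sum P X Y F * c"
    by (simp add: mult.commute)
qed

lemma graft_sum_zero [simp]: "graft_sum P X Y (\<lambda>W. 0) = 0"
  by (induction X arbitrary: Y) simp_all

lemma graft_sum_sum:
  "graft_sum P X Y (\<lambda>W. \<Sum>i\<in>A. F i W) = (\<Sum>i\<in>A. graft_sum P X Y (F i))"
  by (induction A rule: infinite_finite_induct) (simp_all add: graft_sum_add)

lemma graft_sum_swap:
  "graft_sum P X Y (\<lambda>W. graft_sum P X' Y' (H W)) =
   graft_sum P X' Y' (\<lambda>W'. graft_sum P X Y (\<lambda>W. H W W'))"
  by (induction X arbitrary: Y H) (simp_all add: graft_sum_sum)

lemma sum_triangle_swap:
  fixes h :: "nat \<Rightarrow> nat \<Rightarrow> 'b::comm_monoid_add"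
  shows "(\<Sum>i\<le>k. \<Sum>j\<le>i. h j (i - j)) = (\<Sum>j\<le>k. \<Sum>i\<le>k - j. h j i)"
  by (induction k) (simp_all add: Suc_diff_le sum.distrib add.assoc)

text \<open>A factorization of \<open>Y\<close> along \<open>X @ X'\<close> is a cut of
  \<open>Y\<close> together with a factorization of each piece. In the inductive step the same pairs
  of cut points are indexed in two ways: by the length for \<open>x\<close> and the length for the
  rest of \<open>X\<close>, or by the total length and the length for \<open>x\<close>.\<close>

lemma graft_sum_append:
  "graft_sum P (X @ X') Y F =
    (\<Sum>i\<le>length Y. graft_sum P X (take i Y) (\<lambda>A. graft_sum P X' (drop i Y) (\<lambda>B. F (A @ B))))"
proof (induction X arbitrary: Y F)
  case Nil
  have "(\<Sum>i\<le>length Y. graft_sum P [] (take i Y) (\<lambda>A. graft_sum P X' (drop i Y) (\<lambda>B. F (A @ B)))) =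
    (\<Sum>i\<le>length Y. if i = 0 then graft_sum P X' Y F else 0)"
    by (intro sum.cong) auto
  then show ?case by simp
next
  case (Cons x X)
  define h where "h j i = graft_sum P X (take i (drop j Y))
    (\<lambda>A. graft_sum P X' (drop (j + i) Y) (\<lambda>B. F (graft P x (take j Y) # A @ B)))" for j i
  have "graft_sum P ((x # X) @ X') Y F = (\<Sum>j\<le>length Y. \<Sum>i\<le>length Y - j. h j i)"
    by (simp add: Cons.IH h_def add.commute)
  also have "\<dots> = (\<Sum>i\<le>length Y. \<Sum>j\<le>i. h j (i - j))" by (simp add: sum_triangle_swap)
  also have "\<dots> = (\<Sum>i\<le>length Y.
      graft_sum P (x # X) (take i Y) (\<lambda>A. graft_sum P X' (drop i Y) (\<lambda>B. F (A @ B))))"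
    by (intro sum.cong refl) (simp add: h_def min_def drop_take)
  finally show ?case .
qed

context operad
begin

lemma linear_form_comp:
  assumes "linear_form P f" "\<And>x y. L (x + y) = L x + L y" "\<And>c x. L (oscale P c x) = oscale P c (L x)"
  shows "linear_form P (\<lambda>x. f (L x))"
  using assms by (simp add: linear_form_def)

lemma homogeneous_parts_part: "homogeneous_parts P x (\<lambda>n. part P n x)"
  unfolding part_def by (rule theI'[OF direct_sum])

lemma part_component: "part P n x \<in> component P n"
  and finite_parts: "finite {n. part P n x \<noteq> 0}"
  and sum_parts: "(\<Sum>n | part P n x \<noteq> 0. part P n x) = x"
  using homogeneous_parts_part[of x] by (auto simp: homogeneous_parts_def)

lemma part_eqI:
  assumes "finite A" "\<And>n. n \<notin> A \<Longrightarrow> c n = 0" "\<And>n. c n \<in> component P n" "x = sum c A"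
  shows "part P n x = c n"
proof -
  have "{n. c n \<noteq> 0} \<subseteq> A" using assms(2) by blast
  then have "homogeneous_parts P x c"
    unfolding homogeneous_parts_def using assms
    by (auto intro: finite_subset intro!: sum.mono_neutral_right)
  then have "c = (\<lambda>n. part P n x)" using direct_sum homogeneous_parts_part by blast
  then show ?thesis by simp
qed

lemma part_add: "part P n (x + y) = part P n x + part P n y"
proof (rule part_eqI)
  let ?A = "{n. part P n x \<noteq> 0} \<union> {n. part P n y \<noteq> 0}"
  show "finite ?A" using finite_parts by simp
  have "x = sum (\<lambda>n. part P n x) ?A" "y = sum (\<lambda>n. part P n y) ?A"
    using finite_parts
    by (subst sum_parts[symmetric], intro sum.mono_neutral_left; auto)+
  then show "x + y = (\<Sum>n\<in>?A. part P n x + part P n y)" by (simp add: sum.distrib)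
qed (auto simp: part_component subspace_add subspace_component)

lemma part_scale: "part P n (oscale P c x) = oscale P c (part P n x)"
proof (rule part_eqI[where c = "\<lambda>n. oscale P c (part P n x)"])
  show "oscale P c x = (\<Sum>n | part P n x \<noteq> 0. oscale P c (part P n x))"
    by (simp add: sum_parts flip: scale_sum_right)
qed (auto simp: part_component finite_parts subspace_scale subspace_component)

lemma part_homogeneous:
  assumes "x \<in> component P m"
  shows "part P n x = (if n = m then x else 0)"
  by (rule part_eqI[of "{m}"]) (auto simp: assms subspace_0 subspace_component)

lemma part_zero [simp]: "part P n 0 = 0"
  using part_homogeneous[of 0 n n] subspace_0 subspace_component by simp

lemma part_part: "part P n (part P m x) = (if n = m then part P m x else 0)"
  by (rule part_homogeneous[OF part_component])

lemma part_sum: "part P n (sum h A) = (\<Sum>i\<in>A. part P n (h i))"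
  by (induction A rule: infinite_finite_induct) (simp_all add: part_add)

lemma ocomp_zero_left: "ocomp P 0 qs = 0"
  using ocomp_add_left[of 0 qs 0] subspace_0 subspace_component by simp

lemma linear_form_eqI:
  assumes "linear_form P f" "linear_form P g" "\<And>n x. x \<in> component P n \<Longrightarrow> f x = g x"
  shows "f x = g x"
proof -
  have "(\<Sum>n | part P n x \<noteq> 0. f (part P n x)) = (\<Sum>n | part P n x \<noteq> 0. g (part P n x))"
    using assms(3)[OF part_component] by simp
  then show ?thesis
    unfolding linear_form_sum[OF assms(1), symmetric] linear_form_sum[OF assms(2), symmetric] sum_parts .
qed

text \<open>The components span, so homogeneous letters suffice. This gives access to
  \<open>ocomp_component\<close> and \<open>ocomp_assoc\<close>, which speak of homogeneous
  arguments only.\<close>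

lemma multilinear_form_eqI:
  assumes "multilinear_form P n M" "multilinear_form P n M'" "length W = n"
    and "\<And>W ms. \<lbrakk>length W = n; homogeneous P W ms\<rbrakk> \<Longrightarrow> M W = M' W"
  shows "M W = M' W"
  using assms
proof (induction n arbitrary: M M' W)
  case 0
  then show ?case by (metis length_0_conv list_all2_Nil)
next
  case (Suc n)
  obtain x V where W: "W = x # V" "length V = n" using Suc.prems(3) by (auto simp: length_Suc_conv)
  have "M (x # V) = M' (x # V)"
  proof (rule linear_form_eqI[where f = "\<lambda>x. M (x # V)" and g = "\<lambda>x. M' (x # V)"])
    show "linear_form P (\<lambda>x. M (x # V))" "linear_form P (\<lambda>x. M' (x # V))"
      using Suc.prems(1,2) W by auto
    fix m x assume x: "x \<in> component P m"
    show "M (x # V) = M' (x # V)"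
    proof (rule Suc.IH[where M = "\<lambda>V. M (x # V)" and M' = "\<lambda>V. M' (x # V)"])
      fix U ms assume "length U = n" "homogeneous P U ms"
      then show "M (x # U) = M' (x # U)" using x by (intro Suc.prems(4)[of _ "m # ms"]) auto
    qed (use Suc.prems W in auto)
  qed
  then show ?case using W by simp
qed

text \<open>The prefix \<open>us\<close> is there for the induction: a first argument that has been
  fixed moves into it.\<close>

lemma multilinear_form_ocomp:
  assumes "linear_form P f" "p \<in> component P (length us + n)"
  shows "multilinear_form P n (\<lambda>W. f (ocomp P p (us @ W)))"
  using assms(2)
proof (induction n arbitrary: us)
  case (Suc n)
  have "multilinear_form P n (\<lambda>W. f (ocomp P p (us @ x # W)))" for x
    using Suc.IH[of "us @ [x]"] Suc.prems by simp
  moreover have "linear_form P (\<lambda>x. f (ocomp P p (us @ x # W)))" if "length W = n" for W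
    using Suc.prems that
    by (intro linear_form_comp[OF assms(1), of "\<lambda>x. ocomp P p (us @ x # W)"])
      (simp_all add: ocomp_add_right ocomp_scale_right)
  ultimately show ?case by simp
qed simp

lemma graft_add: "graft P (x + y) Y = graft P x Y + graft P y Y"
  by (simp add: graft_def part_add ocomp_add_left part_component)

lemma graft_scale: "graft P (oscale P c x) Y = oscale P c (graft P x Y)"
  by (simp add: graft_def part_scale ocomp_scale_left part_component)

lemma graft_homogeneous:
  assumes "x \<in> component P n"
  shows "graft P x Y = (if length Y = n then ocomp P x Y else 0)"
  by (simp add: graft_def part_homogeneous[OF assms] ocomp_zero_left)

lemma multilinear_form_graft_sum:
  assumes "multilinear_form P n M"
  shows "multilinear_form P n (\<lambda>Y. graft_sum P Y Z M)"
  using assms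
proof (induction n arbitrary: Z M)
  case (Suc n)
  have sum: "multilinear_form P m (\<lambda>Y. \<Sum>j\<in>A. F j Y)" if "\<And>j. j \<in> A \<Longrightarrow> multilinear_form P m (F j)"
    for m F and A :: "nat set"
    using that by (induction m arbitrary: F) (auto simp: linear_form_def sum.distrib sum_distrib_left)
  have "multilinear_form P n (\<lambda>Y. graft_sum P (y # Y) Z M)" for y
    unfolding graft_sum.simps using Suc.prems by (intro sum Suc.IH) simp
  moreover have "linear_form P (\<lambda>y. graft_sum P (y # Y) Z M)" if "length Y = n" for Y
  proof -
    have lin: "linear_form P (\<lambda>x. M (x # W))" if "length W = n" for W using Suc.prems that by simp
    have "graft_sum P Y Z' (\<lambda>W. M (graft P (x + y) Z'' # W)) =
        graft_sum P Y Z' (\<lambda>W. M (graft P x Z'' # W) + M (graft P y Z'' # W))"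
      "graft_sum P Y Z' (\<lambda>W. M (graft P (oscale P c x) Z'' # W)) =
        graft_sum P Y Z' (\<lambda>W. c * M (graft P x Z'' # W))"
      for x y c Z' Z''
      using \<open>length Y = n\<close>
      by (intro graft_sum_cong; simp add: graft_add graft_scale linear_formD[OF lin])+
    then show ?thesis
      by (simp add: linear_form_def graft_sum_add graft_sum_mult sum.distrib sum_distrib_left)
  qed
  ultimately show ?case by simp
qed simp

text \<open>The arities \<open>ms\<close> force the lengths of the blocks: grafting a block of the
  wrong length gives zero, and a multilinear form kills a word with a zero letter. At most one
  factorization survives, and \<open>Zs\<close> is its list of blocks.\<close>

lemma graft_sum_homogeneous:
  assumes "multilinear_form P (length Y) M" "homogeneous P Y ms"
  shows "length Z \<noteq> sum_list ms \<Longrightarrow> graft_sum P Y Z M = 0"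
    and "length Z = sum_list ms \<Longrightarrow> \<exists>Zs. concat Zs = Z \<and> map length Zs = ms \<and>
      graft_sum P Y Z M = M (map2 (ocomp P) Y Zs)"
proof -
  have "if length Z = sum_list ms then \<exists>Zs. concat Zs = Z \<and> map length Zs = ms \<and>
      graft_sum P Y Z M = M (map2 (ocomp P) Y Zs) else graft_sum P Y Z M = 0"
    using assms
  proof (induction Y arbitrary: ms Z M)
    case Nil
    then show ?case by (auto intro: exI[of _ "[]"])
  next
    case (Cons y Y)
    obtain m ms' where ms: "ms = m # ms'" "y \<in> component P m" "homogeneous P Y ms'"
      using Cons.prems(2) by (auto simp: list_all2_Cons1)
    have zero: "M (0 # W) = 0" if "length W = length Y" for W
      using Cons.prems(1) that linear_form_0[of P "\<lambda>x. M (x # W)"] by simp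
    have "graft_sum P Y (drop j Z) (\<lambda>W. M (graft P y (take j Z) # W)) = (if j = m then
      graft_sum P Y (drop m Z) (\<lambda>W. M (ocomp P y (take m Z) # W)) else 0)" if "j \<le> length Z" for j
    proof (cases "j = m")
      case True
      then show ?thesis using that by (simp add: graft_homogeneous[OF ms(2)])
    next
      case False
      then have "graft_sum P Y (drop j Z) (\<lambda>W. M (graft P y (take j Z) # W)) =
        graft_sum P Y (drop j Z) (\<lambda>W. 0)"
        using that by (intro graft_sum_cong) (simp add: graft_homogeneous[OF ms(2)] zero)
      then show ?thesis using False by simp
    qed
    then have eq: "graft_sum P (y # Y) Z M = (if m \<le> length Z then
      graft_sum P Y (drop m Z) (\<lambda>W. M (ocomp P y (take m Z) # W)) else 0)"
      by simp
    have "multilinear_form P (length Y) (\<lambda>W. M (ocomp P y (take m Z) # W))"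
      using Cons.prems(1) by simp
    note IH = Cons.IH[OF this ms(3), of "drop m Z"]
    show ?case
    proof (cases "length Z = sum_list ms")
      case True
      then obtain Zs where "concat Zs = drop m Z" "map length Zs = ms'"
        "graft_sum P Y (drop m Z) (\<lambda>W. M (ocomp P y (take m Z) # W)) =
          M (ocomp P y (take m Z) # map2 (ocomp P) Y Zs)"
        using IH ms(1) by auto
      then show ?thesis
        using True ms(1) eq by (auto intro!: exI[of _ "take m Z # Zs"])
    next
      case False
      then have "\<not> m \<le> length Z \<or> length (drop m Z) \<noteq> sum_list ms'" using ms(1) by auto
      then show ?thesis using eq IH False by auto
    qed
  qed
  then show "length Z \<noteq> sum_list ms \<Longrightarrow> graft_sum P Y Z M = 0"
    and "length Z = sum_list ms \<Longrightarrow> \<exists>Zs. concat Zs = Z \<and> map length Zs = ms \<and>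
      graft_sum P Y Z M = M (map2 (ocomp P) Y Zs)" by auto
qed

text \<open>Associativity of the operad for arbitrary letters. With \<open>x\<close> replaced by its
  part of arity \<open>length Y\<close>, both sides are multilinear in \<open>Y\<close>. On
  homogeneous letters the composition on the left has arity \<open>sum_list ms\<close> and the sum
  on the right has at most one term. The form \<open>f\<close> is there because
  \<open>graft_sum\<close> has scalar values.\<close>

lemma graft_graft:
  assumes f: "linear_form P f"
  shows "f (graft P (graft P x Y) Z) = graft_sum P Y Z (\<lambda>W. f (graft P x W))"
proof -
  define p where "p = part P (length Y) x"
  have p: "p \<in> component P (length Y)" by (simp add: p_def part_component)
  have M: "multilinear_form P (length Y) (\<lambda>W. g (ocomp P p W))" if "linear_form P g" for g
    using multilinear_form_ocomp[OF that, of p "[]"] p by simp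
  have "f (graft P (ocomp P p Y) Z) = graft_sum P Y Z (\<lambda>W. f (ocomp P p W))"
  proof (rule multilinear_form_eqI[where M = "\<lambda>Y. f (graft P (ocomp P p Y) Z)"
        and M' = "\<lambda>Y. graft_sum P Y Z (\<lambda>W. f (ocomp P p W))"])
    show "multilinear_form P (length Y) (\<lambda>Y. f (graft P (ocomp P p Y) Z))"
      by (rule M[of "\<lambda>q. f (graft P q Z)"], rule linear_form_comp[OF f]) (simp_all add: graft_add graft_scale)
    show "multilinear_form P (length Y) (\<lambda>Y. graft_sum P Y Z (\<lambda>W. f (ocomp P p W)))"
      by (intro multilinear_form_graft_sum M f)
    fix U ms assume U: "length U = length Y" "homogeneous P U ms"
    note H = graft_sum_homogeneous[of U "\<lambda>W. f (ocomp P p W)", OF _ U(2), of Z]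
    have mU: "multilinear_form P (length U) (\<lambda>W. f (ocomp P p W))" using M[OF f] U(1) by simp
    have c: "ocomp P p U \<in> component P (sum_list ms)" using ocomp_component p U by simp
    show "f (graft P (ocomp P p U) Z) = graft_sum P U Z (\<lambda>W. f (ocomp P p W))"
    proof (cases "length Z = sum_list ms")
      case True
      then obtain Zs where Zs: "concat Zs = Z" "map length Zs = ms"
        "graft_sum P U Z (\<lambda>W. f (ocomp P p W)) = f (ocomp P p (map2 (ocomp P) U Zs))"
        using H(2)[OF mU] by blast
      \<comment> \<open>The blocks have exactly the arities of the letters, as
        \<open>ocomp_assoc\<close> demands.\<close>
      have "list_all2 (\<lambda>q rs. q \<in> component P (length rs)) U Zs"
        using U(2) Zs(2) by (auto simp: list_all2_conv_all_nth)
      then have "ocomp P (ocomp P p U) (concat Zs) = ocomp P p (map2 (ocomp P) U Zs)"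
        using p U(1) by (intro ocomp_assoc) simp_all
      then show ?thesis using True Zs by (simp add: graft_homogeneous[OF c])
    next
      case False
      then show ?thesis
        using H(1)[OF mU] linear_form_0[OF f] by (simp add: graft_homogeneous[OF c])
    qed
  qed simp
  also have "\<dots> = graft_sum P Y Z (\<lambda>W. f (graft P x W))"
    by (intro graft_sum_cong) (simp add: graft_def p_def)
  finally show ?thesis by (simp add: graft_def p_def)
qed

text \<open>Induction on \<open>X\<close>. The first letter \<open>x\<close> receives
  \<open>j\<close> letters of \<open>Y\<close>, and the composite receives \<open>i\<close> letters
  of \<open>Z\<close>; \<open>graft_graft\<close> regroups these and the induction hypothesis
  handles the rest of \<open>X\<close>. It remains to exchange independent sums and to glue the
  pieces of \<open>Y\<close> and \<open>Z\<close> together again.\<close>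

lemma graft_sum_assoc:
  assumes "multilinear_form P (length X) F"
  shows "graft_sum P X Y (\<lambda>W. graft_sum P W Z F) = graft_sum P Y Z (\<lambda>W. graft_sum P X W F)"
  using assms
proof (induction X arbitrary: Y Z F)
  case Nil
  \<comment> \<open>For nonempty \<open>Y\<close> the word \<open>W\<close>, being as long as
    \<open>Y\<close>, is not empty, so the right-hand side vanishes like the left one.\<close>
  have "graft_sum P Y Z (\<lambda>W. if W = [] then F [] else 0) = graft_sum P Y Z (\<lambda>W. 0)" if "Y \<noteq> []"
    using that by (intro graft_sum_cong) auto
  then show ?case by (cases Y) (auto simp del: graft_sum.simps(2))
next
  case (Cons x X)
  let ?G = "\<lambda>j i V. F (graft P (graft P x (take j Y)) (take i Z) # V)"
  have lin: "linear_form P (\<lambda>x. F (x # W))" if "length W = length X" for W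
    using Cons.prems that by simp
  have "graft_sum P (x # X) Y (\<lambda>W. graft_sum P W Z F) =
    (\<Sum>j\<le>length Y. \<Sum>i\<le>length Z. graft_sum P X (drop j Y) (\<lambda>W. graft_sum P W (drop i Z) (?G j i)))"
    by (simp add: graft_sum_sum)
  also have "\<dots> = (\<Sum>j\<le>length Y. \<Sum>i\<le>length Z.
      graft_sum P (drop j Y) (drop i Z) (\<lambda>W. graft_sum P X W (?G j i)))"
    using Cons.prems by (intro sum.cong refl Cons.IH) simp
  also have "\<dots> = (\<Sum>j\<le>length Y. \<Sum>i\<le>length Z. graft_sum P (drop j Y) (drop i Z) (\<lambda>B.
      graft_sum P X B (\<lambda>V. graft_sum P (take j Y) (take i Z) (\<lambda>A. F (graft P x A # V)))))"
    by (intro sum.cong refl graft_sum_cong graft_graft lin)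
  \<comment> \<open>The sum that produces \<open>A\<close> moves outside, the shape in which
    \<open>graft_sum_append\<close> can glue it to the sum that produces \<open>B\<close>.\<close>
  also have "\<dots> = (\<Sum>j\<le>length Y. \<Sum>i\<le>length Z. graft_sum P (take j Y) (take i Z) (\<lambda>A.
      graft_sum P (drop j Y) (drop i Z) (\<lambda>B. graft_sum P X B (\<lambda>V. F (graft P x A # V)))))"
  proof (intro sum.cong refl)
    fix i j
    have "graft_sum P (drop j Y) (drop i Z) (\<lambda>B. graft_sum P X B (\<lambda>V.
        graft_sum P (take j Y) (take i Z) (\<lambda>A. F (graft P x A # V)))) =
      graft_sum P (drop j Y) (drop i Z) (\<lambda>B. graft_sum P (take j Y) (take i Z) (\<lambda>A.
        graft_sum P X B (\<lambda>V. F (graft P x A # V))))"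
      by (intro graft_sum_cong graft_sum_swap)
    also have "\<dots> = graft_sum P (take j Y) (take i Z) (\<lambda>A. graft_sum P (drop j Y) (drop i Z) (\<lambda>B.
        graft_sum P X B (\<lambda>V. F (graft P x A # V))))"
      by (rule graft_sum_swap)
    finally show "graft_sum P (drop j Y) (drop i Z) (\<lambda>B. graft_sum P X B (\<lambda>V.
        graft_sum P (take j Y) (take i Z) (\<lambda>A. F (graft P x A # V)))) =
      graft_sum P (take j Y) (take i Z) (\<lambda>A. graft_sum P (drop j Y) (drop i Z) (\<lambda>B.
        graft_sum P X B (\<lambda>V. F (graft P x A # V))))" .
  qed
  \<comment> \<open>Each \<open>A\<close> has length \<open>j\<close>, so cutting
    \<open>A @ B\<close> at \<open>j\<close> recovers the two words.\<close>
  also have "\<dots> = (\<Sum>j\<le>length Y. graft_sum P (take j Y @ drop j Y) Z (\<lambda>W.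
      graft_sum P X (drop j W) (\<lambda>V. F (graft P x (take j W) # V))))"
    unfolding graft_sum_append by (intro sum.cong refl graft_sum_cong) (simp add: min_def)
  also have "\<dots> = graft_sum P Y Z (\<lambda>W. \<Sum>j\<le>length Y.
      graft_sum P X (drop j W) (\<lambda>V. F (graft P x (take j W) # V)))"
    by (simp add: graft_sum_sum)
  also have "\<dots> = graft_sum P Y Z (\<lambda>W. graft_sum P (x # X) W F)"
    by (intro graft_sum_cong) simp
  finally show ?case .
qed

end

subsection \<open>The coproduct dual to operadic composition\<close>

text \<open>Projection to the arities that a form on the \<open>n\<close>-th component can see among
  the inputs of a composition. It starts at arity 1, in line with \<open>graded_dual\<close>, and
  has finite rank when the components are finite-dimensional.\<close>

definition truncation :: "('k, 'v::ab_group_add) operad_data \<Rightarrow> nat \<Rightarrow> 'v \<Rightarrow> 'v" where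
  "truncation P n x = (\<Sum>m=1..n. part P m x)"

lemma sum_fun_apply: "(\<Sum>i\<in>A. h i) x = (\<Sum>i\<in>A. h i x)"
  by (induction A rule: infinite_finite_induct) (auto simp: fun_ops)

lemma graft_sum_linear:
  "graft_sum P X Y (F + G) = graft_sum P X Y F + graft_sum P X Y G"
  "graft_sum P X Y (fscale c F) = c * graft_sum P X Y F"
  by (simp_all add: plus_fun_def fscale_def graft_sum_add graft_sum_mult)

section \<open>Finite expansions along dual bases\<close>

context operad
begin

lemma dual_componentI:
  assumes "linear_form P f" "\<And>m x. \<lbrakk>m \<noteq> n; x \<in> component P m\<rbrakk> \<Longrightarrow> f x = 0"
  shows "f \<in> dual_component P n"
proof -
  have "vector_space ((*) :: 'k \<Rightarrow> 'k \<Rightarrow> 'k)" by unfold_locales (auto simp: algebra_simps)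
  then show ?thesis
    using assms vector_space_axioms
    by (simp add: dual_component_def Vector_Spaces.linear_iff linear_form_def)
qed

text \<open>The forms are the coordinates in a basis of the component, precomposed with
  \<open>part\<close> so that they vanish on the other arities. The basis is finite as an
  independent subset of the span of a finite set.\<close>

lemma dual_basis:
  assumes "finite_components P"
  shows "\<exists>B e. finite B \<and> (\<forall>b. e b \<in> dual_component P m) \<and>
    (\<forall>x. part P m x = (\<Sum>b\<in>B. oscale P (e b x) b))"
proof -
  obtain B0 where B0: "finite B0" "component P m = span B0"
    using assms unfolding finite_components_def by blast
  obtain B where B: "B \<subseteq> component P m" "independent B" "component P m \<subseteq> span B"
    by (rule maximal_independent_subset)
  have fin: "finite B" using independent_span_bound[OF B0(1) B(2)] B(1) B0(2) by simp
  have mem: "part P m x \<in> span B" for x using part_component B(3) by blast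
  define e where "e b x = representation B (part P m x) b" for b x
  have "e b \<in> dual_component P m" for b
  proof (rule dual_componentI)
    show "linear_form P (e b)"
      by (simp add: linear_form_def e_def part_add part_scale representation_add[OF B(2) mem mem]
          representation_scale[OF B(2) mem])
    show "e b x = 0" if "n \<noteq> m" "x \<in> component P n" for n x
      using that by (simp add: e_def part_homogeneous[OF that(2)] representation_zero)
  qed
  moreover have "part P m x = (\<Sum>b\<in>B. oscale P (e b x) b)" for x
  proof -
    have "(\<Sum>b | e b x \<noteq> 0. oscale P (e b x) b) = part P m x"
      unfolding e_def by (rule sum_nonzero_representation_eq[OF B(2) mem])
    moreover have "(\<Sum>b | e b x \<noteq> 0. oscale P (e b x) b) = (\<Sum>b\<in>B. oscale P (e b x) b)"
      using fin representation_ne_zero by (intro sum.mono_neutral_left) (auto simp: e_def)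
    ultimately show ?thesis by simp
  qed
  ultimately show ?thesis using fin by blast
qed

lemma dual_component_graded_dual: "\<lbrakk>f \<in> dual_component P n; 1 \<le> n\<rbrakk> \<Longrightarrow> f \<in> graded_dual P"
  unfolding graded_dual_def by (rule fun_space.span_base) auto

text \<open>Dual bases for the arities 1 to \<open>n\<close> put together, indexed by pairs of an
  arity and a basis vector. Finite-dimensionality enters the proof through this expansion.\<close>

lemma truncation_dual_basis:
  assumes "finite_components P"
  obtains I :: "(nat \<times> 'v) set" and e b where "finite I" "\<And>i. i \<in> I \<Longrightarrow> e i \<in> graded_dual P"
    "\<And>x. truncation P n x = (\<Sum>i\<in>I. oscale P (e i x) (b i))"
proof -
  obtain B e where *: "finite (B m)" "e m b \<in> dual_component P m"
    "part P m x = (\<Sum>b\<in>B m. oscale P (e m b x) b)" for m b x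
    using dual_basis[OF assms] by metis
  show ?thesis
  proof (rule that[of "Sigma {1..n} B" "\<lambda>(m, b). e m b" snd])
    show "finite (Sigma {1..n} B)" using *(1) by simp
    show "(case i of (m, b) \<Rightarrow> e m b) \<in> graded_dual P" if "i \<in> Sigma {1..n} B" for i
      using that dual_component_graded_dual[OF *(2)] by auto
    show "truncation P n x = (\<Sum>i\<in>Sigma {1..n} B. oscale P ((case i of (m, b) \<Rightarrow> e m b) x) (snd i))" for x
      unfolding truncation_def *(3) using *(1) by (subst sum.Sigma) (auto simp: case_prod_unfold)
  qed
qed

lemma truncation_linear:
  "truncation P n (x + y) = truncation P n x + truncation P n y"
  "truncation P n (oscale P c x) = oscale P c (truncation P n x)"
  by (simp_all add: truncation_def part_add part_scale sum.distrib scale_sum_right)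

lemma truncation_homogeneous:
  assumes "x \<in> component P m"
  shows "truncation P n x = (if m \<in> {1..n} then x else 0)"
  by (simp add: truncation_def part_homogeneous[OF assms])

text \<open>Expanding every letter along the dual bases turns a multilinear form into a finite
  combination of words in the \<open>e i\<close>. The recursion expands the first letter and leaves
  in \<open>?G i\<close> the form with \<open>b i\<close> plugged into that slot.\<close>

lemma truncated_form_mem:
  assumes e: "\<And>i. i \<in> I \<Longrightarrow> e i \<in> graded_dual P" and I: "finite I"
    and tr: "\<And>x. truncation P n x = (\<Sum>i\<in>I. oscale P (e i x) (b i))"
    and M: "multilinear_form P k M"
  shows "(\<lambda>Y. if length Y = k then M (map (truncation P n) Y) else 0) \<in> space (dual_algebra P)"
  using M
proof (induction k arbitrary: M)
  case 0
  have "(\<lambda>Y. if length Y = 0 then M (map (truncation P n) Y) else 0) = fscale (M []) (word [])"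
    by (auto simp: fun_ops word_def)
  then show ?case by (simp add: fun_space.span_scale fun_space.span_base)
next
  case (Suc k)
  let ?G = "\<lambda>i Y. if length Y = k then M (b i # map (truncation P n) Y) else 0"
  have "(\<lambda>Y. if length Y = Suc k then M (map (truncation P n) Y) else 0) =
    (\<Sum>i\<in>I. conc (word [e i]) (?G i))" (is "?L = ?R")
  proof
    fix Y
    show "?L Y = ?R Y"
    proof (cases Y)
      case Nil
      then show ?thesis by (simp add: sum_fun_apply conc_Cons)
    next
      case (Cons y Z)
      show ?thesis
      proof (cases "length Z = k")
        case True
        then have lin: "linear_form P (\<lambda>x. M (x # map (truncation P n) Z))" using Suc.prems by simp
        show ?thesis
          using Cons True
          by (simp add: sum_fun_apply conc_Cons tr[of y] linear_form_sum[OF lin] linear_formD(2)[OF lin])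
      qed (simp add: Cons sum_fun_apply conc_Cons)
    qed
  qed
  also have "\<dots> \<in> space (dual_algebra P)"
    unfolding tensor_algebra_simps
  proof (intro fun_space.span_sum conc_closed)
    fix i assume "i \<in> I"
    then show "word [e i] \<in> fun_space.span (word ` lists (graded_dual P))"
      using e by (intro fun_space.span_base) auto
    show "?G i \<in> fun_space.span (word ` lists (graded_dual P))"
      using Suc.IH[of "\<lambda>Y. M (b i # Y)"] Suc.prems by simp
  qed
  finally show ?case .
qed

text \<open>
  Since there is nothing in arity \<open>0\<close>, a form on the \<open>n\<close>-th component only sees inputs of arity
  at most \<open>n\<close>, and at most \<open>n\<close> of them.
\<close>

lemma dual_component_ocomp:
  assumes P0: "component P 0 = {0}" and f: "f \<in> dual_component P n" and p: "p \<in> component P (length Y)"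
  shows "f (ocomp P p (map (truncation P n) Y)) = f (ocomp P p Y)"
    and "n < length Y \<Longrightarrow> f (ocomp P p Y) = 0"
proof -
  have lin: "linear_form P f" using f by (simp add: dual_component_def Vector_Spaces.linear_iff linear_form_def)
  have M: "multilinear_form P (length Y) (\<lambda>Y. f (ocomp P p Y))"
    using multilinear_form_ocomp[OF lin, of p "[]"] p by simp
  note M' = multilinear_form_map[OF M, of "truncation P n", OF truncation_linear]
  have N: "multilinear_form P m (\<lambda>Y. 0)" for m
    by (induction m) (auto simp: linear_form_def)
  have vanish: "f (ocomp P p W) = 0" if "length W = length Y" "homogeneous P W ms" "n < sum_list ms" for W ms
    using f ocomp_component[of p W ms] that p by (auto simp: dual_component_def)
  have zero: "f (ocomp P p W) = 0" if "length W = length Y" "0 \<in> set W" for W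
    using multilinear_form_zero[of P W] M that by simp
  show "f (ocomp P p (map (truncation P n) Y)) = f (ocomp P p Y)"
    using M' M refl
  proof (rule multilinear_form_eqI)
    fix W ms assume W: "length W = length Y" "homogeneous P W ms"
    have lms: "length ms = length W" using W(2) by (simp add: list_all2_lengthD)
    have tr: "truncation P n (W ! i) = (if ms ! i \<in> {1..n} then W ! i else 0)" if "i < length W" for i
      using W(2) that by (intro truncation_homogeneous) (simp add: list_all2_conv_all_nth)
    \<comment> \<open>If some arity leaves the range 1 to \<open>n\<close>, both sides are zero: the
      truncated letter is zero, and the original letter is either zero (arity 0) or pushes the total
      arity beyond \<open>n\<close>.\<close>
    show "f (ocomp P p (map (truncation P n) W)) = f (ocomp P p W)"
    proof (cases "set ms \<subseteq> {1..n}")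
      case True
      then have "map (truncation P n) W = W" using tr lms
        by (intro nth_equalityI) (auto simp: subset_iff in_set_conv_nth)
      then show ?thesis by simp
    next
      case False
      then obtain i where i: "i < length W" "ms ! i \<notin> {1..n}" using lms by (metis in_set_conv_nth subsetI)
      then have "0 \<in> set (map (truncation P n) W)" using tr[OF i(1)] by force
      then have 1: "f (ocomp P p (map (truncation P n) W)) = 0" using zero W(1) by simp
      show ?thesis
      proof (cases "ms ! i = 0")
        case True
        then have "W ! i = 0" using W(2) i P0 by (auto simp: list_all2_conv_all_nth)
        then show ?thesis using 1 zero[OF W(1)] i(1) by (metis nth_mem)
      next
        case False
        then have "n < ms ! i" using i(2) by simp
        also have "\<dots> \<le> sum_list ms" using i(1) lms by (intro member_le_sum_list) auto
        finally show ?thesis using 1 vanish[OF W] by simp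
      qed
    qed
  qed
  assume n: "n < length Y"
  show "f (ocomp P p Y) = 0"
    using M N refl
  proof (rule multilinear_form_eqI)
    fix W ms assume W: "length W = length Y" "homogeneous P W ms"
    have lms: "length ms = length W" using W(2) by (simp add: list_all2_lengthD)
    show "f (ocomp P p W) = 0"
    proof (cases "0 \<in> set ms")
      case True
      then obtain i where i: "i < length W" "ms ! i = 0" using lms by (auto simp: in_set_conv_nth)
      then have "W ! i = 0" using W(2) P0 by (auto simp: list_all2_conv_all_nth)
      then show ?thesis using zero[OF W(1)] i(1) by (metis nth_mem)
    next
      case False
      \<comment> \<open>Without arity 0 each letter contributes at least 1, so the total arity is at
        least \<open>length Y\<close> and exceeds \<open>n\<close>.\<close>
      have "sum_list (map (\<lambda>_. 1) ms) \<le> sum_list (map id ms)"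
        using False by (intro sum_list_mono) (auto simp: Suc_le_eq intro: Nat.gr0I)
      then have "length ms \<le> sum_list ms" by (simp add: sum_list_triv)
      then show ?thesis using n lms W vanish by simp
    qed
  qed
qed

text \<open>Only words \<open>Y\<close> of length at most \<open>n\<close> count, and their letters
  may be truncated. Of \<open>q\<close> only the part of arity \<open>length Y\<close> matters, so
  \<open>q\<close> may be truncated as well. Expanding \<open>q\<close> along the dual bases then
  separates it from \<open>Y\<close> and leaves one tensor for each arity \<open>p\<close> and index
  \<open>i\<close>.\<close>

lemma coprod_star_gen_component:
  assumes P0: "component P 0 = {0}" and fin: "finite_components P" and f: "f \<in> dual_component P n"
  shows "coprod_star_gen P f \<in> space (alg_tensor (dual_algebra P) (dual_algebra P))"
proof -
  have lin: "linear_form P f" using f by (simp add: dual_component_def Vector_Spaces.linear_iff linear_form_def)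
  obtain I :: "(nat \<times> 'v) set" and e b where I: "finite I" "\<And>i. i \<in> I \<Longrightarrow> e i \<in> graded_dual P"
    and tr: "\<And>x. truncation P n x = (\<Sum>i\<in>I. oscale P (e i x) (b i))"
    using truncation_dual_basis[OF fin] by metis
  let ?G = "\<lambda>p i Y. if length Y = p then f (ocomp P (part P p (b i)) (map (truncation P n) Y)) else 0"
  have "coprod_star_gen P f = (\<Sum>p\<le>n. \<Sum>i\<in>I. tensor (word [e i]) (?G p i))" (is "_ = ?R")
  proof (intro ext)
    fix z :: "'v list \<times> 'v list"
    obtain X Y where z: "z = (X, Y)" by (cases z)
    show "coprod_star_gen P f z = ?R z"
    proof (cases "length X = 1")
      case False
      then show ?thesis by (cases X; cases "tl X") (auto simp: z sum_fun_apply coprod_star_gen_def word_def)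
    next
      case True
      then obtain q where X: "X = [q]" by (auto simp: length_Suc_conv)
      define k where "k = length Y"
      have part: "part P k (truncation P n q) = part P k q" if "k \<le> n"
      \<comment> \<open>Arity 0 is missing from \<open>truncation\<close>, but the component is zero
        there.\<close>
      proof (cases "k = 0")
        case True
        then show ?thesis using part_component[of 0] P0 by auto
      next
        case False
        then show ?thesis using that by (simp add: truncation_def part_sum part_part)
      qed
      have lin': "linear_form P (\<lambda>q. f (ocomp P (part P k q) (map (truncation P n) Y)))"
        by (rule linear_form_comp[OF lin])
          (simp_all add: k_def part_add part_scale part_component ocomp_add_left ocomp_scale_left)
      have "?R z = (if k \<le> n then \<Sum>i\<in>I. e i q * f (ocomp P (part P k (b i)) (map (truncation P n) Y)) else 0)"
        by (simp add: z X sum_fun_apply k_def sum.swap[of _ I] if_distrib cong: if_cong)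
      also have "\<dots> = (if k \<le> n then f (ocomp P (part P k (truncation P n q)) (map (truncation P n) Y)) else 0)"
        by (simp add: tr linear_form_sum[OF lin'] linear_formD(2)[OF lin'])
      also have "\<dots> = f (ocomp P (part P k q) Y)"
        using part dual_component_ocomp[OF P0 f, of "part P k q" Y]
        by (simp add: k_def part_component not_le)
      finally show ?thesis by (simp add: z X coprod_star_gen_def k_def)
    qed
  qed
  also have "\<dots> \<in> tensor_space (space (dual_algebra P)) (space (dual_algebra P))"
  proof (intro fun_space.subspace_sum[OF subspace_tensor_space] tensor_mem)
    fix p i assume "i \<in> I"
    then show "word [e i] \<in> space (dual_algebra P)" using I(2) by (intro word_mem) auto
    have "multilinear_form P p (\<lambda>Y. f (ocomp P (part P p (b i)) Y))"
      using multilinear_form_ocomp[OF lin, of "part P p (b i)" "[]"] part_component by simp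
    from truncated_form_mem[of I e n b, OF _ I(1) _ this] I(2) tr
    show "?G p i \<in> space (dual_algebra P)" by blast
  qed
  finally show ?thesis by simp
qed

lemma coprod_star_gen_mem:
  assumes P0: "component P 0 = {0}" and fin: "finite_components P" and f: "f \<in> graded_dual P"
  shows "coprod_star_gen P f \<in> space (alg_tensor (dual_algebra P) (dual_algebra P))"
  using f[unfolded graded_dual_def]
proof (induction rule: fun_space.span_induct_alt)
  case base
  have "coprod_star_gen P 0 = 0" by (auto simp: coprod_star_gen_def fun_ops split: list.split)
  then show ?case by (simp add: fun_space.subspace_0[OF subspace_tensor_space])
next
  case (step c g h)
  then obtain n where "g \<in> dual_component P n" by blast
  then have g: "coprod_star_gen P g \<in> space (alg_tensor (dual_algebra P) (dual_algebra P))"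
    by (rule coprod_star_gen_component[OF P0 fin])
  have "coprod_star_gen P (fscale c g + h) = fscale c (coprod_star_gen P g) + coprod_star_gen P h"
    by (auto simp: coprod_star_gen_def fun_ops split: list.split)
  then show ?case
    using g step.IH by (simp add: fun_space.subspace_add[OF subspace_tensor_space]
        fun_space.subspace_scale[OF subspace_tensor_space] del: tensor_algebra_simps)
qed

section \<open>Closed form and coassociativity of the first coproduct\<close>

lemma coprod_star_hom:
  assumes P0: "component P 0 = {0}" and fin: "finite_components P"
  shows "alg_hom (dual_algebra P) (alg_tensor (dual_algebra P) (dual_algebra P)) (coprod_star P)"
    and "f \<in> graded_dual P \<Longrightarrow> coprod_star P (word [f]) = coprod_star_gen P f"
proof -
  have lin: "linear_on (graded_dual P) fscale (coprod_star_gen P)"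
    by (auto simp: linear_on_def coprod_star_gen_def fun_ops split: list.split)
  have im: "coprod_star_gen P ` graded_dual P \<subseteq> space (alg_tensor (dual_algebra P) (dual_algebra P))"
    using coprod_star_gen_mem[OF P0 fin] by blast
  note U = free_lift_universal[OF subspace_graded_dual
      unital_algebra_alg_tensor(1)[OF unital_algebra_tensor_algebra unital_algebra_tensor_algebra]
      lin im, folded coprod_star_def]
  show "alg_hom (dual_algebra P) (alg_tensor (dual_algebra P) (dual_algebra P)) (coprod_star P)"
    by (rule U(1))
  show "f \<in> graded_dual P \<Longrightarrow> coprod_star P (word [f]) = coprod_star_gen P f"
    by (rule U(2))
qed

lemma coprod_star_gen_Cons:
  assumes "i \<le> length (x # X)"
  shows "coprod_star_gen P f (take i (x # X), Z) = (if i = 1 then f (graft P x Z) else 0)"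
proof (cases i)
  case (Suc j)
  then show ?thesis using assms by (cases j; cases X) (auto simp: coprod_star_gen_def graft_def)
qed (simp add: coprod_star_gen_def)

text \<open>The factor belonging to \<open>f\<close> is supported on one-letter words on the left,
  so it takes the first letter \<open>x\<close> of \<open>X\<close> together with a prefix of
  \<open>Y\<close>. This is the recursion of \<open>graft_sum\<close>.\<close>

lemma coprod_star_word:
  assumes P0: "component P 0 = {0}" and fin: "finite_components P" and fs: "fs \<in> lists (graded_dual P)"
  shows "coprod_star P (word fs) (X, Y) = graft_sum P X Y (word fs)"
  using fs
proof (induction fs arbitrary: X Y)
  case Nil
  have "coprod_star P (word []) = tensor (word []) (word [])"
    using alg_homD(4)[OF coprod_star_hom(1)[OF P0 fin]] by simp
  then show ?case by (cases X; cases Y) auto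
next
  case (Cons f fs)
  note hom = coprod_star_hom[OF P0 fin]
  have f: "linear_form P f" "f \<in> graded_dual P" "fs \<in> lists (graded_dual P)"
    using Cons.hyps by (auto intro: linear_form_graded_dual)
  have "coprod_star P (word (f # fs)) = mult (alg_tensor (dual_algebra P) (dual_algebra P))
      (coprod_star_gen P f) (coprod_star P (word fs))"
    using alg_hom_word_Cons[OF hom(1) f(2,3)] hom(2)[OF f(2)] by simp
  then have eq: "coprod_star P (word (f # fs)) (X, Y) = (\<Sum>i\<le>length X. \<Sum>j\<le>length Y.
      coprod_star_gen P f (take i X, take j Y) * graft_sum P (drop i X) (drop j Y) (word fs))"
    using mult_alg_tensor_apply[OF coprod_star_gen_mem[OF P0 fin f(2)] alg_homD(3)[OF hom(1) word_mem[OF f(3)]]]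
      Cons.IH by simp
  show ?case
  proof (cases X)
    case Nil
    then show ?thesis unfolding eq by (simp add: coprod_star_gen_def)
  next
    case (Cons x X')
    have "(\<Sum>i\<le>length X. \<Sum>j\<le>length Y. coprod_star_gen P f (take i X, take j Y) *
        graft_sum P (drop i X) (drop j Y) (word fs)) =
      (\<Sum>i\<le>length X. if i = 1 then \<Sum>j\<le>length Y. f (graft P x (take j Y)) *
        graft_sum P X' (drop j Y) (word fs) else 0)"
    proof (rule sum.cong[OF refl])
      fix i assume "i \<in> {..length X}"
      then have "i \<le> length (x # X')" using Cons by simp
      from coprod_star_gen_Cons[OF this]
      show "(\<Sum>j\<le>length Y. coprod_star_gen P f (take i X, take j Y) *
          graft_sum P (drop i X) (drop j Y) (word fs)) =
        (if i = 1 then \<Sum>j\<le>length Y. f (graft P x (take j Y)) * graft_sum P X' (drop j Y) (word fs) else 0)"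
        using Cons by (simp del: take_Suc_Cons)
    qed
    also have "\<dots> = (\<Sum>j\<le>length Y. f (graft P x (take j Y)) * graft_sum P X' (drop j Y) (word fs))"
      by (subst sum.delta) (auto simp: Cons)
    also have "\<dots> = graft_sum P X Y (word (f # fs))" by (simp add: Cons graft_sum_mult)
    finally show ?thesis unfolding eq .
  qed
qed

lemma coprod_star_apply:
  assumes P0: "component P 0 = {0}" and fin: "finite_components P" and F: "F \<in> space (dual_algebra P)"
  shows "coprod_star P F = (\<lambda>(X, Y). graft_sum P X Y F)"
  using alg_homD(1)[OF coprod_star_hom(1)[OF P0 fin]] _ _ F
proof (rule tensor_algebra_linear_eq)
  show "linear_on (space (dual_algebra P)) fscale (\<lambda>F. \<lambda>(X, Y). graft_sum P X Y F)"
    by (auto simp: linear_on_def graft_sum_linear graft_sum_add graft_sum_mult fun_ops)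
qed (auto simp: coprod_star_word[OF P0 fin] fun_eq_iff)

lemma coprod_star_coassoc:
  assumes P0: "component P 0 = {0}" and fin: "finite_components P" and F: "F \<in> space (dual_algebra P)"
  defines "T \<equiv> space (dual_algebra P)"
  shows "tensor_map T T (coprod_star P) id (coprod_star P F) ((X, Y), Z) =
    tensor_map T T id (coprod_star P) (coprod_star P F) (X, (Y, Z))"
proof -
  have sT: "fun_space.subspace T" by (simp add: T_def)
  have hom: "linear_on T fscale (coprod_star P)" "coprod_star P F \<in> tensor_space T T"
    using alg_homD(1,3)[OF coprod_star_hom(1)[OF P0 fin]] F unfolding T_def by auto
  note ap = coprod_star_apply[OF P0 fin, folded T_def]
  \<comment> \<open>A coproduct in one leg acts with the coordinate of the other leg frozen.\<close>
  have L: "tensor_map T T (coprod_star P) id t = (\<lambda>((X, Y), Z). graft_sum P X Y (\<lambda>W. t (W, Z)))"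
    and R: "tensor_map T T id (coprod_star P) t = (\<lambda>(X, (Y, Z)). graft_sum P Y Z (\<lambda>W. t (X, W)))"
    if t: "t \<in> tensor_space T T" for t
  proof -
    note l = tensor_map_linear[OF sT sT hom(1) linear_on_id] tensor_map_linear[OF sT sT linear_on_id hom(1)]
    show "tensor_map T T (coprod_star P) id t = (\<lambda>((X, Y), Z). graft_sum P X Y (\<lambda>W. t (W, Z)))"
      using sT l(1) _ _ t
    proof (rule tensor_space_linear_eq)
      show "linear_on (tensor_space T T) fscale (\<lambda>t. \<lambda>((X, Y), Z). graft_sum P X Y (\<lambda>W. t (W, Z)))"
        by (auto simp: linear_on_def graft_sum_linear graft_sum_add graft_sum_mult fun_ops)
    qed (auto simp: l ap graft_sum_mult)
    show "tensor_map T T id (coprod_star P) t = (\<lambda>(X, (Y, Z)). graft_sum P Y Z (\<lambda>W. t (X, W)))"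
      using sT l(3) _ _ t
    proof (rule tensor_space_linear_eq)
      show "linear_on (tensor_space T T) fscale (\<lambda>t. \<lambda>(X, (Y, Z)). graft_sum P Y Z (\<lambda>W. t (X, W)))"
        by (auto simp: linear_on_def graft_sum_linear graft_sum_add graft_sum_mult fun_ops)
    qed (auto simp: l ap graft_sum_mult)
  qed
  \<comment> \<open>By linearity in \<open>F\<close> it suffices to treat words of linear forms,
    which are multilinear in every length.\<close>
  have "graft_sum P X Y (\<lambda>W. graft_sum P W Z F) = graft_sum P Y Z (\<lambda>W. graft_sum P X W F)"
    using _ _ _ F
  proof (rule tensor_algebra_linear_eq)
    show "linear_on (space (dual_algebra P)) (*) (\<lambda>F. graft_sum P X Y (\<lambda>W. graft_sum P W Z F))"
      "linear_on (space (dual_algebra P)) (*) (\<lambda>F. graft_sum P Y Z (\<lambda>W. graft_sum P X W F))"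
      by (auto simp: linear_on_def graft_sum_linear graft_sum_add graft_sum_mult fun_ops)
    fix fs assume "fs \<in> lists (graded_dual P)"
    then show "graft_sum P X Y (\<lambda>W. graft_sum P W Z (word fs)) = graft_sum P Y Z (\<lambda>W. graft_sum P X W (word fs))"
      by (intro graft_sum_assoc multilinear_form_word) (auto intro: linear_form_graded_dual)
  qed
  then show ?thesis
    unfolding L[OF hom(2)] R[OF hom(2)] unfolding coprod_star_apply[OF P0 fin F] by simp
qed

end

subsection \<open>Insertion of units\<close>

text \<open>\<open>S\<close> records the positions of the letters of \<open>X\<close>, so a word
  that arises in several ways is counted that often. Fixing the length \<open>n\<close> keeps the
  sum finite.\<close>

definition insert_sum ::
  "('k::field, 'v::ab_group_add) operad_data \<Rightarrow> nat \<Rightarrow> 'v list \<Rightarrow> ('v list \<Rightarrow> 'k) \<Rightarrow> 'k" where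
  "insert_sum P n X F = (\<Sum>S | S \<subseteq> {..<n} \<and> card S = length X. F (insert_at P n S X))"

lemma length_insert_at [simp]: "length (insert_at P n S X) = n"
  by (simp add: insert_at_def)

lemma insert_sum_cong:
  assumes "\<And>W. length W = n \<Longrightarrow> F W = G W"
  shows "insert_sum P n X F = insert_sum P n X G"
  unfolding insert_sum_def by (intro sum.cong refl assms) simp

lemma insert_sum_linear:
  "insert_sum P n X (\<lambda>W. F W + G W) = insert_sum P n X F + insert_sum P n X G"
  "insert_sum P n X (\<lambda>W. c * F W) = c * insert_sum P n X F"
  "insert_sum P n X (\<lambda>W. F W * c) = insert_sum P n X F * c"
  "insert_sum P n X (\<lambda>W. 0) = 0"
  by (simp_all add: insert_sum_def sum.distrib sum_distrib_left sum_distrib_right)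

lemma insert_sum_0: "insert_sum P 0 X F = (if X = [] then F [] else 0)"
proof -
  have "{S. S \<subseteq> {..<0::nat} \<and> card S = length X} = (if X = [] then {{}} else {})" by auto
  then show ?thesis by (simp add: insert_sum_def insert_at_def)
qed

lemma insert_at_Suc:
  "insert_at P (Suc n) (Suc ` S) X = ounit P # insert_at P n S X"
  "insert_at P (Suc n) (insert 0 (Suc ` S)) (x # X) = x # insert_at P n S X"
proof -
  have up: "[0..<Suc n] = 0 # map Suc [0..<n]" by (simp add: upt_conv_Cons map_Suc_upt del: upt_Suc)
  have "{j \<in> Suc ` S. j < Suc i} = Suc ` {j \<in> S. j < i}" for i by auto
  then have c: "card {j \<in> Suc ` S. j < Suc i} = card {j \<in> S. j < i}" for i
    by (simp add: card_image)
  have "{j \<in> insert 0 (Suc ` S). j < Suc i} = insert 0 (Suc ` {j \<in> S. j < i})" for i by auto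
  moreover have "finite {j \<in> S. j < i}" for i by (rule finite_subset[of _ "{..<i}"]) auto
  ultimately have c': "card {j \<in> insert 0 (Suc ` S). j < Suc i} = Suc (card {j \<in> S. j < i})" for i
    by (simp add: card_image card_insert_if image_iff)
  have m: "Suc i \<in> Suc ` S \<longleftrightarrow> i \<in> S" for i by auto
  show "insert_at P (Suc n) (Suc ` S) X = ounit P # insert_at P n S X"
    unfolding insert_at_def up by (simp add: c m comp_def)
  have "{j. (j = 0 \<or> j \<in> Suc ` S) \<and> j < (0::nat)} = {}" by auto
  then show "insert_at P (Suc n) (insert 0 (Suc ` S)) (x # X) = x # insert_at P n S X"
    unfolding insert_at_def up using c' by (simp add: m comp_def)
qed

text \<open>Position 0 carries either the first letter of \<open>X\<close> or a unit. This recursion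
  of Pascal type spares the evaluation of \<Psi> on words any work with sets of positions.\<close>

lemma insert_sum_Suc:
  "insert_sum P (Suc n) X F =
    (case X of [] \<Rightarrow> 0 | x # X' \<Rightarrow> insert_sum P n X' (\<lambda>W. F (x # W))) +
    insert_sum P n X (\<lambda>W. F (ounit P # W))"
proof -
  \<comment> \<open>\<open>B\<close> collects the position sets containing 0; the others are the
    shifts of the sets in \<open>A (length X)\<close>.\<close>
  define A where "A k = {S. S \<subseteq> {..<n} \<and> card S = k}" for k
  define B where "B = {S. S \<subseteq> {..<Suc n} \<and> card S = length X \<and> 0 \<in> S}"
  have finA: "finite (A k)" for k by (rule finite_subset[of _ "Pow {..<n}"]) (auto simp: A_def)
  have finB: "finite B" by (rule finite_subset[of _ "Pow {..<Suc n}"]) (auto simp: B_def)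
  have pre: "Suc ` {i. Suc i \<in> S} = S - {0}" for S
  proof -
    have "x \<in> Suc ` {i. Suc i \<in> S} \<longleftrightarrow> x \<in> S - {0}" for x by (cases x) auto
    then show ?thesis by blast
  qed
  have split: "{S. S \<subseteq> {..<Suc n} \<and> card S = length X} = B \<union> (`) Suc ` A (length X)"
  proof (intro subset_antisym subsetI)
    fix S assume S: "S \<in> {S. S \<subseteq> {..<Suc n} \<and> card S = length X}"
    show "S \<in> B \<union> (`) Suc ` A (length X)"
    proof (cases "0 \<in> S")
      case False
      then have "S = Suc ` {i. Suc i \<in> S}" using pre[of S] by simp
      moreover have "card {i. Suc i \<in> S} = card (Suc ` {i. Suc i \<in> S})" by (simp add: card_image)
      ultimately have "{i. Suc i \<in> S} \<in> A (length X)" using S by (auto simp: A_def)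
      then show ?thesis using \<open>S = Suc ` {i. Suc i \<in> S}\<close> by blast
    qed (use S in \<open>auto simp: B_def\<close>)
  qed (auto simp: A_def B_def card_image)
  have inj: "inj_on ((`) Suc) A'" for A' by (simp add: inj_on_def inj_image_eq_iff)
  have "insert_sum P (Suc n) X F = (\<Sum>S\<in>B. F (insert_at P (Suc n) S X)) +
      (\<Sum>S\<in>(`) Suc ` A (length X). F (insert_at P (Suc n) S X))"
    unfolding insert_sum_def split by (intro sum.union_disjoint finB finite_imageI finA) (auto simp: B_def)
  also have "(\<Sum>S\<in>(`) Suc ` A (length X). F (insert_at P (Suc n) S X)) =
      insert_sum P n X (\<lambda>W. F (ounit P # W))"
    by (simp add: sum.reindex[OF inj] insert_at_Suc insert_sum_def A_def)
  also have "(\<Sum>S\<in>B. F (insert_at P (Suc n) S X)) =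
      (case X of [] \<Rightarrow> 0 | x # X' \<Rightarrow> insert_sum P n X' (\<lambda>W. F (x # W)))"
  proof (cases X)
    case Nil
    have "B = {}"
    proof -
      have "S \<notin> B" for S
      proof
        assume "S \<in> B"
        then have "finite S" "S \<noteq> {}" "card S = 0" using Nil by (auto simp: B_def intro: finite_subset)
        then show False by simp
      qed
      then show ?thesis by blast
    qed
    then show ?thesis using Nil by simp
  next
    case (Cons x X')
    have "B = (\<lambda>S. insert 0 (Suc ` S)) ` A (length X')"
    proof (intro subset_antisym subsetI)
      fix S assume S: "S \<in> B"
      then have "finite S" by (auto simp: B_def intro: finite_subset)
      have e: "S = insert 0 (Suc ` {i. Suc i \<in> S})" using S pre[of S] by (auto simp: B_def)
      have "card {i. Suc i \<in> S} = card (S - {0})" by (simp add: card_image flip: pre)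
      also have "\<dots> = length X'" using S Cons \<open>finite S\<close> by (simp add: B_def)
      finally have "{i. Suc i \<in> S} \<in> A (length X')" using S by (auto simp: A_def B_def)
      then show "S \<in> (\<lambda>S. insert 0 (Suc ` S)) ` A (length X')" using e by blast
    next
      fix S assume "S \<in> (\<lambda>S. insert 0 (Suc ` S)) ` A (length X')"
      then obtain S' where S': "S = insert 0 (Suc ` S')" "S' \<subseteq> {..<n}" "card S' = length X'"
        by (auto simp: A_def)
      then have "finite S'" by (auto intro: finite_subset)
      then show "S \<in> B" using S' Cons by (auto simp: B_def card_image card_insert_if)
    qed
    moreover have "inj_on (\<lambda>S. insert 0 (Suc ` S)) (A (length X'))"
    proof (rule inj_onI)
      fix S S' assume "insert 0 (Suc ` S) = insert 0 (Suc ` S')"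
      moreover have "Suc ` S = insert 0 (Suc ` S) - {0}" for S by auto
      ultimately have "Suc ` S = Suc ` S'" by metis
      then show "S = S'" by (simp add: inj_image_eq_iff)
    qed
    ultimately show ?thesis using Cons
      by (simp add: sum.reindex insert_at_Suc insert_sum_def A_def)
  qed
  finally show ?thesis .
qed

text \<open>Each factor of the image of a word, a letter plus its value at the unit, either reads
  the next letter of \<open>X\<close> or accounts for an inserted unit, as in
  \<open>insert_sum_Suc\<close>. The plus sign in \<open>Psi\<close> is what makes this an unsigned
  sum over insertions.\<close>

lemma Psi_word:
  assumes "fs \<in> lists (graded_dual P)"
  shows "Psi P (word fs) X = insert_sum P (length fs) X (word fs)"
  using assms
proof (induction fs arbitrary: X)
  case Nil
  then show ?case using alg_homD(4)[OF Psi_generators(1), of P] by (cases X) (simp_all add: insert_sum_0)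
next
  case (Cons f fs)
  then have f: "f \<in> graded_dual P" "fs \<in> lists (graded_dual P)" by auto
  have "Psi P (word (f # fs)) = conc (word [f] + fscale (counit0 P f) (word [])) (Psi P (word fs))"
    using alg_hom_word_Cons[OF Psi_generators(1) f] Psi_generators(2)[OF f(1)] by simp
  then have "Psi P (word (f # fs)) X = conc (word [f]) (Psi P (word fs)) X + f (ounit P) * Psi P (word fs) X"
    by (simp add: conc_linear conc_unit plus_fun_apply fscale_apply counit0_def)
  then show ?case
    using Cons.IH by (cases X) (simp_all add: conc_Cons insert_sum_Suc insert_sum_linear)
qed

text \<open>\<open>F\<close> is a finite combination of words, so lengths above some
  \<open>N\<close> contribute nothing. The bound is uniform in \<open>X\<close> and may be enlarged,
  which allows the bounds of several elements to be merged.\<close>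

lemma Psi_apply:
  assumes "F \<in> space (dual_algebra P)"
  shows "\<exists>N. \<forall>M\<ge>N. \<forall>X. Psi P F X = (\<Sum>k\<le>M. insert_sum P k X F)"
  using assms
proof (induction rule: span_words_induct)
  case zero
  have "fun_space.subspace (space (dual_algebra P))" by simp
  from linear_on_zero[OF this alg_homD(1)[OF Psi_generators(1)]] have "Psi P 0 = 0" .
  moreover have "insert_sum P k X 0 = 0" for k X by (simp add: insert_sum_def zero_fun_apply)
  ultimately have "Psi P 0 X = (\<Sum>k\<le>M. insert_sum P k X 0)" for M X
    by (simp only: zero_fun_apply sum.neutral_const)
  then show ?case by (intro exI[of _ 0] allI impI)
next
  case (step c fs G)
  then obtain N where N: "\<And>M X. M \<ge> N \<Longrightarrow> Psi P G X = (\<Sum>k\<le>M. insert_sum P k X G)" by blast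
  have fs: "word fs \<in> space (dual_algebra P)" by (rule word_mem[OF step(1)])
  then have "fscale c (word fs) \<in> space (dual_algebra P)" by (simp add: fun_space.span_scale)
  then have Psi_eq: "Psi P (fscale c (word fs) + G) = fscale c (Psi P (word fs)) + Psi P G"
    using step(2) fs alg_homD(1)[OF Psi_generators(1), of P] linear_on_add linear_on_scale by metis
  have ins_eq: "insert_sum P k X (fscale c (word fs) + G) = c * insert_sum P k X (word fs) + insert_sum P k X G" for k X
    by (simp add: insert_sum_linear plus_fun_def fscale_def)
  have w: "Psi P (word fs) X = (\<Sum>k\<le>M. insert_sum P k X (word fs))" if "M \<ge> length fs" for M X
  proof -
    have "insert_sum P k X (word fs) = (if k = length fs then Psi P (word fs) X else 0)" for k
    proof (cases "k = length fs")
      case False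
      then have "insert_sum P k X (word fs) = insert_sum P k X (\<lambda>W. 0)"
        by (intro insert_sum_cong) (simp add: word_def)
      then show ?thesis using False by (simp add: insert_sum_linear)
    qed (simp add: Psi_word[OF step(1)])
    then show ?thesis using that by simp
  qed
  have "Psi P (fscale c (word fs) + G) X = (\<Sum>k\<le>M. insert_sum P k X (fscale c (word fs) + G))"
    if "M \<ge> max N (length fs)" for M X
  proof -
    have "N \<le> M" "length fs \<le> M" using that by simp_all
    then show ?thesis
      unfolding Psi_eq ins_eq plus_fun_apply fscale_apply
      by (simp only: N w sum.distrib sum_distrib_left)
  qed
  then show ?case by blast
qed

lemma Psi_tensor_apply:
  fixes P :: "('k::field, 'v::ab_group_add) operad_data"
  defines "T \<equiv> space (dual_algebra P)"
  assumes t: "t \<in> tensor_space T T"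
  shows "\<exists>N. \<forall>M\<ge>N. \<forall>X Y. tensor_map T T (Psi P) (Psi P) t (X, Y) =
    (\<Sum>k\<le>M. \<Sum>l\<le>M. insert_sum P k X (\<lambda>U. insert_sum P l Y (\<lambda>W. t (U, W))))"
proof -
  have sT: "fun_space.subspace T" by (simp add: T_def)
  have lin: "linear_on T fscale (Psi P)" using alg_homD(1)[OF Psi_generators(1)] unfolding T_def .
  show ?thesis
    using sT t
  proof (induction rule: tensor_space_induct)
    case zero
    have "tensor_map T T (Psi P) (Psi P) 0 (X, Y) =
      (\<Sum>k\<le>M. \<Sum>l\<le>M. insert_sum P k X (\<lambda>U. insert_sum P l Y (\<lambda>W. 0 (U, W))))" for M X Y
      by (simp only: tensor_map_zero[OF sT sT lin lin] insert_sum_linear zero_fun_apply sum.neutral_const)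
    then show ?case by (intro exI[of _ 0] allI impI)
  next
    case (add f g t)
    obtain N1 where N1: "\<forall>M\<ge>N1. \<forall>X. Psi P f X = (\<Sum>k\<le>M. insert_sum P k X f)"
      using Psi_apply[OF add(1)[unfolded T_def]] ..
    obtain N2 where N2: "\<forall>M\<ge>N2. \<forall>X. Psi P g X = (\<Sum>k\<le>M. insert_sum P k X g)"
      using Psi_apply[OF add(2)[unfolded T_def]] ..
    obtain N3 where N3: "\<forall>M\<ge>N3. \<forall>X Y. tensor_map T T (Psi P) (Psi P) t (X, Y) =
        (\<Sum>k\<le>M. \<Sum>l\<le>M. insert_sum P k X (\<lambda>U. insert_sum P l Y (\<lambda>W. t (U, W))))"
      using add(4) ..
    have "tensor_map T T (Psi P) (Psi P) (tensor f g + t) (X, Y) =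
      (\<Sum>k\<le>M. \<Sum>l\<le>M. insert_sum P k X (\<lambda>U. insert_sum P l Y (\<lambda>W. (tensor f g + t) (U, W))))"
      if M: "M \<ge> Max {N1, N2, N3}" for M X Y
    proof -
      have "tensor_map T T (Psi P) (Psi P) (tensor f g + t) (X, Y) =
        (\<Sum>k\<le>M. insert_sum P k X f) * (\<Sum>l\<le>M. insert_sum P l Y g) +
        tensor_map T T (Psi P) (Psi P) t (X, Y)"
        using M N1[rule_format, of M X] N2[rule_format, of M Y]
        by (simp add: tensor_map_add_pure[OF sT sT lin lin add(1-3)] plus_fun_apply)
      then show ?thesis
        using M N3[rule_format, of M X Y] by (simp add: plus_fun_apply insert_sum_linear sum.distrib sum_product)
    qed
    then show ?case by (intro exI[of _ "Max {N1, N2, N3}"] allI impI)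
  qed
qed

section \<open>Comparison of the two coproducts on generators\<close>

context operad
begin

text \<open>The generator is zero unless its left word has one letter, which forces
  \<open>k = 1\<close>. Inserting units produces a one-letter word only from the empty word, giving
  the unit, and from a single letter, giving that letter.\<close>

lemma insert_sum_coprod_star_gen:
  assumes f: "linear_form P f"
  shows "insert_sum P k X (\<lambda>U. insert_sum P l Y (\<lambda>W. coprod_star_gen P f (U, W))) =
    (if k = 1 then case X of
        [] \<Rightarrow> insert_sum P l Y (\<lambda>W. f (graft P (ounit P) W))
      | [x] \<Rightarrow> insert_sum P l Y (\<lambda>W. f (graft P x W))
      | _ \<Rightarrow> 0
    else 0)"
proof (cases "k = 1")
  case True
  then show ?thesis
    by (auto simp: insert_sum_Suc insert_sum_0 coprod_star_gen_def graft_def split: list.split)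
next
  case False
  have "insert_sum P k X (\<lambda>U. insert_sum P l Y (\<lambda>W. coprod_star_gen P f (U, W))) = insert_sum P k X (\<lambda>U. 0)"
  proof (rule insert_sum_cong)
    fix U :: "'v list" assume "length U = k"
    then have "coprod_star_gen P f (U, W) = 0" for W
      using False by (cases U; cases "tl U") (auto simp: coprod_star_gen_def)
    then show "insert_sum P l Y (\<lambda>W. coprod_star_gen P f (U, W)) = 0" by (simp add: insert_sum_linear)
  qed
  then show ?thesis using False by (simp add: insert_sum_linear)
qed

lemma graft_ounit:
  "graft P (ounit P) W = (case W of [w] \<Rightarrow> w | _ \<Rightarrow> 0)"
  by (auto simp: graft_homogeneous[OF ounit_component] ocomp_ounit_left split: list.split)

text \<open>Grafting onto the unit returns a one-letter word unchanged and kills all others. At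
  \<open>l = 1\<close> a single letter yields the bracket, while the empty word is filled up to the
  unit: this is the source of the scalar correction \<open>counit0\<close>.\<close>

lemma insert_sum_graft_ounit:
  assumes f: "linear_form P f"
  shows "insert_sum P l Y (\<lambda>W. f (graft P (ounit P) W)) =
    (if l = 1 then f (bracket P [] Y) + f (ounit P) * word [] Y else 0)"
proof (cases "l = 1")
  case True
  then show ?thesis
    using linear_form_0[OF f]
    by (auto simp: insert_sum_Suc insert_sum_0 graft_ounit split: list.split)
next
  case False
  have "insert_sum P l Y (\<lambda>W. f (graft P (ounit P) W)) = insert_sum P l Y (\<lambda>W. 0)"
    using False linear_form_0[OF f]
    by (intro insert_sum_cong) (auto simp: graft_homogeneous[OF ounit_component])
  then show ?thesis using False by (simp add: insert_sum_linear)
qed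

text \<open>The bracket sums over the arities \<open>l\<close> of \<open>x\<close> and the position
  sets below \<open>l\<close>, and the inner sum is \<open>insert_sum\<close> at length
  \<open>l\<close>. The cut-off \<open>M\<close> has to bound the arities of
  \<open>x\<close>.\<close>

lemma form_bracket_single:
  assumes f: "linear_form P f" and M: "\<And>n. part P n x \<noteq> 0 \<Longrightarrow> n \<le> M"
  shows "(\<Sum>l\<le>M. insert_sum P l Y (\<lambda>W. f (graft P x W))) = f (bracket P [x] Y)"
proof -
  have "insert_sum P l Y (\<lambda>W. f (graft P x W)) = insert_sum P l Y (\<lambda>W. f (ocomp P (part P l x) W))" for l
    by (intro insert_sum_cong) (simp add: graft_def)
  then have "(\<Sum>l\<le>M. insert_sum P l Y (\<lambda>W. f (graft P x W))) =
      (\<Sum>l\<le>M. insert_sum P l Y (\<lambda>W. f (ocomp P (part P l x) W)))" by simp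
  also have "\<dots> = (\<Sum>l | part P l x \<noteq> 0. insert_sum P l Y (\<lambda>W. f (ocomp P (part P l x) W)))"
    using M by (intro sum.mono_neutral_right)
      (auto simp: ocomp_zero_left linear_form_0[OF f] insert_sum_linear)
  also have "\<dots> = f (bracket P [x] Y)" by (simp add: linear_form_sum[OF f] insert_sum_def)
  finally show ?thesis .
qed

text \<open>An empty \<open>X\<close> is filled up to the unit, a single letter stays as it is, and
  for longer \<open>X\<close> both sides vanish. The scalar term shows up only at the pair of empty
  words.\<close>

lemma Psi_tensor_coprod_star_gen:
  assumes P0: "component P 0 = {0}" and fin: "finite_components P" and f: "f \<in> graded_dual P"
  defines "T \<equiv> space (dual_algebra P)"
  shows "tensor_map T T (Psi P) (Psi P) (coprod_star_gen P f) =
    coprod_prime_gen P f + fscale (counit0 P f) (tensor (word []) (word []))"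
proof (intro ext)
  fix z :: "'v list \<times> 'v list"
  obtain X Y where z: "z = (X, Y)" by (cases z)
  have lf: "linear_form P f" by (rule linear_form_graded_dual[OF f])
  have "coprod_star_gen P f \<in> tensor_space T T"
    using coprod_star_gen_mem[OF P0 fin f] by (simp add: T_def)
  then obtain N where N: "\<And>M. M \<ge> N \<Longrightarrow> tensor_map T T (Psi P) (Psi P) (coprod_star_gen P f) (X, Y) =
    (\<Sum>k\<le>M. \<Sum>l\<le>M. insert_sum P k X (\<lambda>U. insert_sum P l Y (\<lambda>W. coprod_star_gen P f (U, W))))"
    using Psi_tensor_apply unfolding T_def by metis
  obtain K where K: "\<And>n. part P n (hd X) \<noteq> 0 \<Longrightarrow> n \<le> K"
    using finite_parts[of "hd X"] unfolding finite_nat_set_iff_bounded_le by blast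
  \<comment> \<open>One cut-off for everything: beyond \<open>N\<close> for
    \<open>Psi_tensor_apply\<close>, beyond \<open>K\<close> for the arities of the letter when
    \<open>X = [x]\<close>, and at least 1 because the surviving terms have \<open>k = 1\<close>
    and, for empty \<open>X\<close>, \<open>l = 1\<close>.\<close>
  obtain M where M: "N \<le> M" "K \<le> M" "1 \<le> M" using that[of "N + K + 1"] by simp
  have inner: "(\<Sum>l\<le>M. insert_sum P k X (\<lambda>U. insert_sum P l Y (\<lambda>W. coprod_star_gen P f (U, W)))) =
    (if k = 1 then \<Sum>l\<le>M. (case X of
        [] \<Rightarrow> insert_sum P l Y (\<lambda>W. f (graft P (ounit P) W))
      | [x] \<Rightarrow> insert_sum P l Y (\<lambda>W. f (graft P x W))
      | _ \<Rightarrow> 0) else 0)" for k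
    by (simp add: insert_sum_coprod_star_gen[OF lf])
  have "tensor_map T T (Psi P) (Psi P) (coprod_star_gen P f) (X, Y) =
    (\<Sum>k\<le>M. if k = 1 then \<Sum>l\<le>M. (case X of
        [] \<Rightarrow> insert_sum P l Y (\<lambda>W. f (graft P (ounit P) W))
      | [x] \<Rightarrow> insert_sum P l Y (\<lambda>W. f (graft P x W))
      | _ \<Rightarrow> 0) else 0)"
    unfolding N[OF M(1)] inner ..
  also have "\<dots> = (\<Sum>l\<le>M. (case X of
        [] \<Rightarrow> insert_sum P l Y (\<lambda>W. f (graft P (ounit P) W))
      | [x] \<Rightarrow> insert_sum P l Y (\<lambda>W. f (graft P x W))
      | _ \<Rightarrow> 0))"
    by (subst sum.delta) (use M in auto)
  also have "\<dots> = f (bracket P X Y) + f (ounit P) * (word [] X * word [] Y)"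
  proof (cases X)
    case Nil
    have "(\<Sum>l\<le>M. if l = 1 then f (bracket P [] Y) + f (ounit P) * word [] Y else 0) =
      f (bracket P [] Y) + f (ounit P) * word [] Y"
      by (subst sum.delta) (use M in auto)
    then show ?thesis using Nil by (simp add: insert_sum_graft_ounit[OF lf])
  next
    case (Cons x X')
    show ?thesis
    proof (cases X')
      case Nil
      then show ?thesis
        using Cons K M(2) form_bracket_single[OF lf, of x M Y] by force
    next
      case (Cons x' X'')
      then show ?thesis using \<open>X = x # X'\<close> linear_form_0[OF lf] by simp
    qed
  qed
  finally show "tensor_map T T (Psi P) (Psi P) (coprod_star_gen P f) z =
    (coprod_prime_gen P f + fscale (counit0 P f) (tensor (word []) (word []))) z"
    by (simp add: z fun_ops coprod_prime_gen_def counit0_def)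
qed

section \<open>The second coproduct and its counit\<close>

lemma coprod_prime_hom:
  assumes P0: "component P 0 = {0}" and fin: "finite_components P"
  shows "alg_hom (dual_algebra P) (alg_tensor (dual_algebra P) (dual_algebra P)) (coprod_prime P)"
    and "f \<in> graded_dual P \<Longrightarrow> coprod_prime P (word [f]) = coprod_prime_gen P f"
proof -
  have lin: "linear_on (graded_dual P) fscale (coprod_prime_gen P)"
    by (auto simp: linear_on_def coprod_prime_gen_def fun_ops)
  have im: "coprod_prime_gen P ` graded_dual P \<subseteq> space (alg_tensor (dual_algebra P) (dual_algebra P))"
  proof
    fix g assume "g \<in> coprod_prime_gen P ` graded_dual P"
    then obtain f where f: "f \<in> graded_dual P" "g = coprod_prime_gen P f" by blast
    let ?T = "space (dual_algebra P)"
    have sT: "fun_space.subspace ?T" by simp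
    note h = alg_homD(1,2)[OF Psi_generators(1)]
    \<comment> \<open>Finiteness is inherited from \<open>coprod_star_gen\<close>, since the
      correction is a multiple of 1 \<otimes> 1.\<close>
    have "g = tensor_map ?T ?T (Psi P) (Psi P) (coprod_star_gen P f)
        - fscale (counit0 P f) (tensor (word []) (word []))"
      using Psi_tensor_coprod_star_gen[OF P0 fin f(1)] f(2) by simp
    also have "\<dots> \<in> tensor_space ?T ?T"
      using coprod_star_gen_mem[OF P0 fin f(1)] word_mem[of "[]" "graded_dual P"]
      by (intro fun_space.subspace_diff fun_space.subspace_scale subspace_tensor_space tensor_mem
          tensor_map_closed[OF sT sT h(1,1,2,2)]) simp_all
    finally show "g \<in> space (alg_tensor (dual_algebra P) (dual_algebra P))" by simp
  qed
  note U = free_lift_universal[OF subspace_graded_dual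
      unital_algebra_alg_tensor(1)[OF unital_algebra_tensor_algebra unital_algebra_tensor_algebra]
      lin im, folded coprod_prime_def]
  show "alg_hom (dual_algebra P) (alg_tensor (dual_algebra P) (dual_algebra P)) (coprod_prime P)"
    by (rule U(1))
  show "f \<in> graded_dual P \<Longrightarrow> coprod_prime P (word [f]) = coprod_prime_gen P f"
    by (rule U(2))
qed

lemma coprod_prime_Psi:
  assumes P0: "component P 0 = {0}" and fin: "finite_components P" and F: "F \<in> space (dual_algebra P)"
  defines "T \<equiv> space (dual_algebra P)"
  shows "coprod_prime P (Psi P F) = tensor_map T T (Psi P) (Psi P) (coprod_star P F)"
proof -
  let ?D = "dual_algebra P"
  note U = unital_algebra_tensor_algebra
  have "alg_hom (alg_tensor ?D ?D) (alg_tensor ?D ?D) (tensor_map T T (Psi P) (Psi P))"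
    unfolding T_def by (rule alg_hom_tensor_map[OF U U U U Psi_generators(1) Psi_generators(1)])
  note h = alg_hom_comp[OF Psi_generators(1) coprod_prime_hom(1)[OF P0 fin]]
    alg_hom_comp[OF coprod_star_hom(1)[OF P0 fin] this]
  show ?thesis
    using h _ F
  proof (rule tensor_algebra_hom_eq)
    fix f assume f: "f \<in> graded_dual P"
    have w: "word [f] \<in> space ?D" "word [] \<in> space ?D" using f by (auto intro!: word_mem simp del: tensor_algebra_simps)
    have "coprod_prime P (Psi P (word [f])) = coprod_prime P (word [f] + fscale (counit0 P f) (word []))"
      using Psi_generators(2)[OF f] by simp
    also have "\<dots> = coprod_prime P (word [f]) + fscale (counit0 P f) (coprod_prime P (word []))"
      using alg_homD(1)[OF coprod_prime_hom(1)[OF P0 fin]] w fun_space.span_scale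
      unfolding linear_on_def tensor_algebra_simps by metis
    also have "\<dots> = coprod_prime_gen P f + fscale (counit0 P f) (tensor (word []) (word []))"
      using alg_homD(4)[OF coprod_prime_hom(1)[OF P0 fin]] coprod_prime_hom(2)[OF P0 fin f] by simp
    also have "\<dots> = tensor_map T T (Psi P) (Psi P) (coprod_star P (word [f]))"
      using Psi_tensor_coprod_star_gen[OF P0 fin f] coprod_star_hom(2)[OF P0 fin f] by (simp add: T_def)
    finally show "coprod_prime P (Psi P (word [f])) = tensor_map T T (Psi P) (Psi P) (coprod_star P (word [f]))" .
  qed
qed

text \<open>On generators this is read off the bracket: an empty left word returns a single letter,
  and an empty right word fills every input of \<open>x\<close> with the unit, which returns
  \<open>x\<close>. On products the empty word has only one cut, so the double sum collapses to a
  concatenation.\<close>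

lemma coprod_prime_empty_word:
  assumes P0: "component P 0 = {0}" and fin: "finite_components P" and F: "F \<in> space (dual_algebra P)"
  shows "coprod_prime P F ([], Y) = F Y" "coprod_prime P F (X, []) = F X"
proof -
  note hom = coprod_prime_hom[OF P0 fin]
  have words: "coprod_prime P (word fs) ([], Y) = word fs Y \<and> coprod_prime P (word fs) (X, []) = word fs X"
    if "fs \<in> lists (graded_dual P)" for fs X Y
    using that
  proof (induction fs arbitrary: X Y)
    case Nil
    then show ?case using alg_homD(4)[OF hom(1)] by simp
  next
    case (Cons f fs)
    then have f: "f \<in> graded_dual P" "fs \<in> lists (graded_dual P)" by auto
    note lf = linear_form_graded_dual[OF f(1)]
    have gen: "coprod_prime_gen P f ([], Y) = word [f] Y" for Y
      using linear_form_0[OF lf] by (auto simp: coprod_prime_gen_def split: list.split)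
    have gen': "coprod_prime_gen P f (X, []) = word [f] X" for X
    proof -
      have "insert_at P n {} [] = replicate n (ounit P)" for n
        by (simp add: insert_at_def map_replicate_const)
      moreover have "{S. S \<subseteq> {..<n} \<and> card S = 0} = {{}}" for n :: nat
        by (auto simp: card_eq_0_iff intro: finite_subset)
      ultimately have "bracket P [x] [] = x" for x
        by (simp add: ocomp_ounit_right[OF part_component] sum_parts)
      then show ?thesis
        using linear_form_0[OF lf]
        by (cases X; cases "tl X") (auto simp: coprod_prime_gen_def simp del: bracket.simps(2))
    qed
    have "coprod_prime P (word (f # fs)) = mult (alg_tensor (dual_algebra P) (dual_algebra P))
        (coprod_prime_gen P f) (coprod_prime P (word fs))"
      using alg_hom_word_Cons[OF hom(1) f] hom(2)[OF f(1)] by simp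
    moreover have "coprod_prime_gen P f \<in> space (alg_tensor (dual_algebra P) (dual_algebra P))"
      using alg_homD(3)[OF hom(1) word_mem, of "[f]"] hom(2)[OF f(1)] f(1) by simp
    ultimately have eq: "coprod_prime P (word (f # fs)) (X, Y) = (\<Sum>i\<le>length X. \<Sum>j\<le>length Y.
        coprod_prime_gen P f (take i X, take j Y) * coprod_prime P (word fs) (drop i X, drop j Y))" for X Y
      using mult_alg_tensor_apply[OF _ alg_homD(3)[OF hom(1) word_mem[OF f(2)]]] by simp
    have "coprod_prime P (word (f # fs)) ([], Y) = conc (word [f]) (word fs) Y"
      using Cons.IH f(2) by (simp add: eq gen conc_def)
    moreover have "coprod_prime P (word (f # fs)) (X, []) = conc (word [f]) (word fs) X"
      using Cons.IH f(2) by (simp add: eq gen' conc_def)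
    ultimately show ?case by (simp add: conc_word)
  qed
  have lin: "linear_on (space (dual_algebra P)) (*) (\<lambda>F. coprod_prime P F z)" for z
    using alg_homD(1)[OF hom(1)] by (simp add: linear_on_def plus_fun_apply fscale_apply)
  have ev: "linear_on (space (dual_algebra P)) (*) (\<lambda>F. F z)" for z
    by (simp add: linear_on_def fun_ops)
  show "coprod_prime P F ([], Y) = F Y"
    using lin ev _ F by (rule tensor_algebra_linear_eq) (simp add: words)
  show "coprod_prime P F (X, []) = F X"
    using lin ev _ F by (rule tensor_algebra_linear_eq) (simp add: words)
qed

lemma counit_D_prime:
  assumes P0: "component P 0 = {0}" and fin: "finite_components P"
  shows "is_counit (D_prime P) (\<lambda>F. F [])"
proof -
  let ?T = "space (dual_algebra P)"
  have sT: "fun_space.subspace ?T" by simp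
  have lin: "linear_on ?T (*) (\<lambda>F. F [])" by (simp add: linear_on_def fun_ops)
  note L = counit_lift[OF sT lin]
  \<comment> \<open>Contracting a leg by evaluation at the empty word means setting its coordinate
    to the empty word.\<close>
  have left: "tensor_lift ?T ?T (\<lambda>b c. fscale (b []) c) t = (\<lambda>Y. t ([], Y))"
    and right: "tensor_lift ?T ?T (\<lambda>b c. fscale (c []) b) t = (\<lambda>X. t (X, []))"
    if t: "t \<in> tensor_space ?T ?T" for t
  proof -
    have l: "linear_on (tensor_space ?T ?T) fscale (\<lambda>t Y. t ([], Y))"
      "linear_on (tensor_space ?T ?T) fscale (\<lambda>t X. t (X, []))"
      by (auto simp: linear_on_def fun_ops)
    show "tensor_lift ?T ?T (\<lambda>b c. fscale (b []) c) t = (\<lambda>Y. t ([], Y))"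
      using sT L(1) l(1) _ t by (rule tensor_space_linear_eq) (auto simp: L(3) fun_ops simp del: tensor_algebra_simps)
    show "tensor_lift ?T ?T (\<lambda>b c. fscale (c []) b) t = (\<lambda>X. t (X, []))"
      using sT L(2) l(2) _ t
      by (rule tensor_space_linear_eq) (auto simp: L(4) fun_ops simp del: tensor_algebra_simps)
  qed
  have mem: "coprod_prime P F \<in> tensor_space ?T ?T" if "F \<in> ?T" for F
    using alg_homD(3)[OF coprod_prime_hom(1)[OF P0 fin] that] by simp
  show ?thesis
    unfolding is_counit_def D_prime_def
    using lin left[OF mem] right[OF mem] coprod_prime_empty_word[OF P0 fin]
    by (simp add: conc_def del: tensor_algebra_simps(1))
qed

end

text \<open>Every morphism fixes the multiples of \<open>word []\<close>, so the scalar that one map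
  adds to a generator is taken off by the other. Morphisms agreeing on generators agree
  everywhere.\<close>

lemma Psi_inverse:
  assumes "F \<in> space (dual_algebra P)"
  shows "Psi_inv P (Psi P F) = F" "Psi P (Psi_inv P F) = F"
proof -
  let ?D = "dual_algebra P"
  have id: "alg_hom ?D ?D (\<lambda>F. F)" by (simp add: alg_hom_def linear_on_def)
  have gen: "\<Phi> (word [f] + fscale c (word [])) = \<Phi> (word [f]) + fscale c (word [])"
    if "alg_hom ?D ?D \<Phi>" "f \<in> graded_dual P" for \<Phi> f c
  proof -
    have w: "word [f] \<in> space ?D" "word [] \<in> space ?D" using that(2) by (auto intro!: word_mem simp del: tensor_algebra_simps)
    then have "\<Phi> (word [f] + fscale c (word [])) = \<Phi> (word [f]) + fscale c (\<Phi> (word []))"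
      using alg_homD(1)[OF that(1)] fun_space.span_scale
      unfolding linear_on_def tensor_algebra_simps by metis
    then show ?thesis using alg_homD(4)[OF that(1)] by simp
  qed
  show "Psi_inv P (Psi P F) = F"
    using alg_hom_comp[OF Psi_generators(1) Psi_inv_generators(1)] id _ assms
  proof (rule tensor_algebra_hom_eq)
    fix f assume f: "f \<in> graded_dual P"
    show "Psi_inv P (Psi P (word [f])) = word [f]"
      using gen[OF Psi_inv_generators(1) f, of "counit0 P f"] Psi_generators(2)[OF f] Psi_inv_generators(2)[OF f]
      by simp
  qed
  show "Psi P (Psi_inv P F) = F"
    using alg_hom_comp[OF Psi_inv_generators(1) Psi_generators(1)] id _ assms
  proof (rule tensor_algebra_hom_eq)
    fix f assume f: "f \<in> graded_dual P"
    show "Psi P (Psi_inv P (word [f])) = word [f]"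
      using gen[OF Psi_generators(1) f, of "- counit0 P f"] Psi_generators(2)[OF f] Psi_inv_generators(2)[OF f]
      by (simp add: fun_space.scale_minus_left)
  qed
qed

theorem proposition52:
  fixes P :: "('k::field_char_0, 'v::ab_group_add) operad_data"
  assumes "operad P"
    and "component P 0 = {0}"
    and "finite_components P"
  shows "bialgebra_iso (D_star P) (D_prime P) (Psi P) \<and>
    bialgebra_iso (D_prime P) (D_star P) (Psi_inv P) \<and>
    (\<forall>F\<in>space (D_star P). Psi_inv P (Psi P F) = F) \<and>
    (\<forall>F\<in>space (D_prime P). Psi P (Psi_inv P F) = F)"
proof -
  interpret operad P by (fact assms(1))
  \<comment> \<open>\<open>D_star\<close> and \<open>D_prime\<close> extend the algebra
    \<open>dual_algebra P\<close> by a coproduct and are records of another type, so facts about the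
    algebra are carried over field by field.\<close>
  have D: "space (D_star P) = space (dual_algebra P)" "space (D_prime P) = space (dual_algebra P)"
    "coprod (D_star P) = coprod_star P" "coprod (D_prime P) = coprod_prime P"
    "alg_tensor (D_star P) (D_star P) = alg_tensor (dual_algebra P) (dual_algebra P)"
    "alg_tensor (D_prime P) (D_prime P) = alg_tensor (dual_algebra P) (dual_algebra P)"
    by (simp_all add: D_star_def D_prime_def alg_tensor_def)
  have U: "unital_algebra (D_star P)" "unital_algebra (D_prime P)"
    using unital_algebra_tensor_algebra[of "graded_dual P"]
    by (simp_all add: unital_algebra_def D_star_def D_prime_def)
  have hom: "alg_hom (D_star P) (D_prime P) (Psi P)" "alg_hom (D_prime P) (D_star P) (Psi_inv P)"
    "alg_hom (D_star P) (alg_tensor (D_star P) (D_star P)) (coprod (D_star P))"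
    "alg_hom (D_prime P) (alg_tensor (D_prime P) (D_prime P)) (coprod (D_prime P))"
    unfolding D using Psi_generators(1)[of P] Psi_inv_generators(1)[of P]
      coprod_star_hom(1)[OF assms(2,3)] coprod_prime_hom(1)[OF assms(2,3)]
    by (simp_all add: alg_hom_def D_star_def D_prime_def)
  have "bialgebra_iso (D_star P) (D_prime P) (Psi P)" "bialgebra_iso (D_prime P) (D_star P) (Psi_inv P)"
    by (rule bialgebra_iso_transport[OF U hom(1,2) _ _ hom(3,4) _ _ counit_D_prime[OF assms(2,3)]];
        simp add: D Psi_inverse coprod_prime_Psi[OF assms(2,3)] coprod_star_coassoc[OF assms(2,3)]
          del: tensor_algebra_simps)+
  then show ?thesis by (simp add: D Psi_inverse del: tensor_algebra_simps)
qed

end
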